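(* Let $w$ be an integrable weight function on $[-1,1]$ with $w(x)>0$ almost everywhere, and let $t_1,t_2,\ldots$ be distinct parameters in $(-1,1)$. Suppose that the asymptotic distribution of the parameters $\{t_i : i\le n\}$ is given by a measure $\nu$ on $[-1,1]$, i.e., for every continuous function $f$ on $[-1,1]$, $$\lim_{n\to\infty}\frac1n\sum_{j=1}^n f(t_j)=\int_{-1}^1 f(x)\,d\nu(x).$$ If $\nu=p\,\delta_{-1}+q\,\delta_1+r\,\delta_0+[1-(p+q+r)]\,\nu_0$, where $p,q,r>0$, $p+q+r\le 1$, and $\nu_0$ is a probability measure on $[-1,1]$ satisfying $$\int_{-1}^1\log|t|\,d\nu_0(t)>-\infty,$$ then the asymptotic distribution of the nodes, both for orthogonal quadrature and for Gaussian quadrature, is given by the measure $$\mu=p\,\delta_1+q\,\delta_{-1}+r\,\mu_0+[1-(p+q+r)]\,\mu_b,$$ where $\mu_0$ is the arcsin measure on $[-1,1]$ with weight function $\mu_0'(x)=\frac1\pi\frac1{\sqrt{1-x^2}}$ and $\mu_b$ is an absolutely continuous measure on $[-1,1]$ with weight function $$\mu_b'(x)=\frac1\pi\frac1{\sqrt{1-x^2}}\int_{-1}^1\frac{\sqrt{1-t^2}}{1+xt}\,d\nu_0(t).$$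
   Context: $\delta_a$ is the unit measure with all its mass concentrated at $a$. If, for each $n$, $x_{1,n},\ldots,x_{n,n}\in(-1,1)$ are the $n$ nodes of a quadrature rule, "the asymptotic distribution of the nodes is given by $\mu$" means $\lim_{n\to\infty}\frac1n\sum_{j=1}^n f(x_{j,n})=\int_{-1}^1 f\,d\mu$ for every continuous $f$ on $[-1,1]$. Orthogonal quadrature: the $n$ nodes are the $n$ (simple) zeros in $(-1,1)$ of $r_{n+1}(t_1,\ldots,t_{n+1};x)=\frac{1}{1+t_{n+1}x}+\sum_{i=1}^n\frac{c_i}{1+t_ix}$, where the real numbers $c_i$ are chosen so that $\int_{-1}^1 r_{n+1}(t_1,\ldots,t_{n+1};x)\frac{w(x)}{1+t_ix}\,dx=0$ for $i=1,\ldots,n$. Gaussian quadrature: the $n$ nodes are the unique $n$ distinct points $x_1,\ldots,x_n\in(-1,1)$ for which there are strictly positive weights $\beta_1,\ldots,\beta_n$ with $\int_{-1}^1\frac{w(x)}{1+t_kx}\,dx=\sum_{i=1}^n\frac{\beta_i}{1+t_kx_i}$ for $k=1,\ldots,2n$.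
   Formalization: If p+q+r<1, it is also assumed that ν₀ has no mass at −1 or 1; otherwise the claim fails: for p=q=r=1/4 and ν₀=δ₁ the weight μ_b' vanishes, so μ has mass 3/4, while node averages of f=1 equal 1. *)

theory Defs
  imports "HOL-Probability.Probability"
begin

text \<open>
  Measures on \<open>[-1, 1]\<close> are represented as Borel measures on the real line that are
  concentrated on \<open>{-1..1}\<close>.
\<close>

definition prob_measure_on_interval :: "real measure \<Rightarrow> bool" where
  "prob_measure_on_interval M \<longleftrightarrow>
     prob_space M \<and> sets M = sets borel \<and> emeasure M (- {-1..1}) = 0"

definition add_measure :: "'a measure \<Rightarrow> 'a measure \<Rightarrow> 'a measure" (infixl \<open>\<oplus>\<^sub>M\<close> 65) where
  "M \<oplus>\<^sub>M N = measure_of (space M) (sets M) (\<lambda>A. emeasure M A + emeasure N A)"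

lemma space_add_measure [simp]: "space (M \<oplus>\<^sub>M N) = space M"
  by (simp add: add_measure_def)

lemma sets_add_measure [simp, measurable_cong]: "sets (M \<oplus>\<^sub>M N) = sets M"
  by (simp add: add_measure_def)

lemma emeasure_add_measure:
  assumes "sets M = sets N" and "A \<in> sets M"
  shows "emeasure (M \<oplus>\<^sub>M N) A = emeasure M A + emeasure N A"
proof (rule emeasure_measure_of[OF add_measure_def])
  show "sets M \<subseteq> Pow (space M)"
    by (rule sets.space_closed)
  show "A \<in> sets (M \<oplus>\<^sub>M N)"
    using assms(2) by simp
  show "positive (sets (M \<oplus>\<^sub>M N)) (\<lambda>A. emeasure M A + emeasure N A)"
    by (simp add: positive_def)
  show "countably_additive (sets (M \<oplus>\<^sub>M N)) (\<lambda>A. emeasure M A + emeasure N A)"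
  proof (rule countably_additiveI)
    fix F :: "nat \<Rightarrow> 'a set"
    assume F: "range F \<subseteq> sets (M \<oplus>\<^sub>M N)" "disjoint_family F"
    have "(\<Sum>i. emeasure M (F i) + emeasure N (F i)) =
        (\<Sum>i. emeasure M (F i)) + (\<Sum>i. emeasure N (F i))"
      by (rule suminf_add[symmetric]) auto
    also have "\<dots> = emeasure M (\<Union>i. F i) + emeasure N (\<Union>i. F i)"
      using F assms(1) by (simp add: suminf_emeasure)
    finally show "(\<Sum>i. emeasure M (F i) + emeasure N (F i)) =
        emeasure M (\<Union>i. F i) + emeasure N (\<Union>i. F i)" .
  qed
qed

abbreviation dirac :: "real \<Rightarrow> real measure" where
  "dirac a \<equiv> return borel a"

text \<open>
  The points \<open>x n 1, \<dots>, x n n\<close> are the \<open>n\<close>-th row of a triangular array; entries outside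
  \<open>1 \<le> j \<le> n\<close> play no role.
\<close>

definition asymptotic_distribution :: "(nat \<Rightarrow> nat \<Rightarrow> real) \<Rightarrow> real measure \<Rightarrow> bool" where
  "asymptotic_distribution x \<mu> \<longleftrightarrow>
     (\<forall>f :: real \<Rightarrow> real. continuous_on {-1..1} f \<longrightarrow>
        (\<lambda>n. 1 / real n * (\<Sum>j=1..n. f (x n j))) \<longlonglongrightarrow> (LINT y:{-1..1}|\<mu>. f y))"

text \<open>
  In the following the parameters are \<open>t 1, t 2, \<dots>\<close>; the value \<open>t 0\<close> is not used.
\<close>

definition orth_rational :: "(nat \<Rightarrow> real) \<Rightarrow> nat \<Rightarrow> (nat \<Rightarrow> real) \<Rightarrow> real \<Rightarrow> real" where
  "orth_rational t n c x = 1 / (1 + t (n + 1) * x) + (\<Sum>i=1..n. c i / (1 + t i * x))"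

definition orthogonal_quadrature_nodes ::
    "(real \<Rightarrow> real) \<Rightarrow> (nat \<Rightarrow> real) \<Rightarrow> nat \<Rightarrow> (nat \<Rightarrow> real) \<Rightarrow> bool" where
  "orthogonal_quadrature_nodes w t n x \<longleftrightarrow>
     (\<exists>c. (\<forall>i\<in>{1..n}.
              (LINT y|lebesgue_on {-1..1}. orth_rational t n c y * (w y / (1 + t i * y))) = 0) \<and>
          inj_on x {1..n} \<and>
          x ` {1..n} = {y \<in> {-1<..<1}. orth_rational t n c y = 0})"

definition gaussian_quadrature_nodes ::
    "(real \<Rightarrow> real) \<Rightarrow> (nat \<Rightarrow> real) \<Rightarrow> nat \<Rightarrow> (nat \<Rightarrow> real) \<Rightarrow> bool" where
  "gaussian_quadrature_nodes w t n x \<longleftrightarrow>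
     inj_on x {1..n} \<and> x ` {1..n} \<subseteq> {-1<..<1} \<and>
     (\<exists>\<beta>. (\<forall>i\<in>{1..n}. 0 < \<beta> i) \<and>
          (\<forall>k\<in>{1..2 * n}.
              (LINT y|lebesgue_on {-1..1}. w y / (1 + t k * y)) =
              (\<Sum>i=1..n. \<beta> i / (1 + t k * x i))))"

text \<open>
  \<open>- log |t|\<close> with value \<open>\<infinity>\<close> at \<open>0\<close> (whereas \<open>ln 0 = 0\<close> in the library).
  For \<open>|t| > 1\<close> it is truncated to \<open>0\<close>, which is irrelevant for measures on \<open>[-1, 1]\<close>.
  Thus the integral of \<open>log |t|\<close> is greater than \<open>-\<infinity>\<close> iff the nonnegative integral
  of this function is finite.
\<close>

definition neg_log_abs :: "real \<Rightarrow> ennreal" where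
  "neg_log_abs t = (if t = 0 then \<infinity> else ennreal (- ln \<bar>t\<bar>))"

text \<open>
  At \<open>x = 1\<close> and \<open>x = -1\<close> both densities below have the value \<open>0\<close>, because \<open>1 / 0 = 0\<close>.
\<close>

definition arcsin_measure :: "real measure" where
  "arcsin_measure =
     density lborel (\<lambda>x. ennreal (indicator {-1..1} x * (1 / pi * (1 / sqrt (1 - x\<^sup>2)))))"

definition mu_b :: "real measure \<Rightarrow> real measure" where
  "mu_b \<nu>\<^sub>0 =
     density lborel (\<lambda>x. ennreal (indicator {-1..1} x *
       (1 / pi * (1 / sqrt (1 - x\<^sup>2)) *
        (LINT t:{-1..1}|\<nu>\<^sub>0. sqrt (1 - t\<^sup>2) / (1 + x * t)))))"

end

theory Submission
  imports Defs
begin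

text \<open>
  Write \<open>x = cos \<theta>\<close> and \<open>\<alpha>(t) = t / (1 + sqrt (1 - t\<^sup>2))\<close>. Up to a constant factor,
  \<open>1 + t cos \<theta>\<close> is \<open>\<bar>1 + \<alpha>(t) e\<^sup>i\<^sup>\<theta>\<bar>\<^sup>2\<close>. In both quadrature rules the nodes \<open>x\<^sub>j = cos \<theta>\<^sub>j\<close> are
  the zeros of a polynomial \<open>P = \<Prod> 2 (x - x\<^sub>j)\<close> of degree \<open>n\<close> that is orthogonal to all
  polynomials of lower degree for a weight \<open>w / \<omega>\<close>, where \<open>\<omega>\<close> is a product of \<open>2n\<close> (Gaussian rule)
  or \<open>2n + 1\<close> (orthogonal rule) factors \<open>1 + \<alpha>\<^sub>k\<^sup>2 + 2 \<alpha>\<^sub>k x\<close>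
  (\<open>gaussian_nodes_orthogonal\<close>, \<open>orthogonal_nodes_orthogonal\<close>). Hence \<open>P\<close> has the smallest
  weighted norm among the polynomials with its leading coefficient. The competitor
  \<open>2 Re (e\<^sup>-\<^sup>i\<^sup>n\<^sup>\<theta> \<Prod>(1 + \<alpha>\<^sub>k e\<^sup>i\<^sup>\<theta>))\<close>, a polynomial in \<open>cos \<theta>\<close>, shows that
  \<open>\<integral> P\<^sup>2 w / \<omega>\<close> is bounded independently of \<open>n\<close> (\<open>orthogonal_norm_bound\<close>). Here the point mass
  of \<open>\<nu>\<close> at \<open>0\<close> enters: some \<open>\<alpha>\<^sub>k\<close> is eventually small, which keeps the leading coefficient of the
  competitor away from \<open>0\<close> and allows one factor of \<open>\<omega>\<close> to be dropped when there are \<open>2n + 1\<close>.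

  Now consider \<open>U = log (P\<^sup>2 / \<omega>) (cos \<theta>)\<close>. It combines, with coefficients \<open>2\<close> and \<open>-1\<close>, \<open>O(n)\<close> kernels
  \<open>log \<bar>1 + \<zeta>\<^sup>2 - 2 \<zeta> cos \<theta>\<bar>\<close> with \<open>\<bar>\<zeta>\<bar> \<le> 1\<close>, whose mean value is \<open>0\<close> by Jensen's formula and which are
  uniformly bounded in \<open>L\<^sup>2\<close>. The norm bound says that \<open>e\<^sup>U\<close> has a bounded integral against
  \<open>w (cos \<theta>) sin \<theta>\<close>, which is positive almost everywhere. So the positive part of \<open>U\<close> has a
  bounded integral outside a set of small measure, and an integral of at most \<open>\<epsilon> n\<close> over that set.
  Since \<open>U\<close> has mean \<open>0\<close>, the integral of \<open>\<bar>U\<bar>\<close> is \<open>o(n)\<close> (\<open>mean_abs_tendsto_0\<close>). Its \<open>m\<close>-th cosine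
  coefficient is therefore \<open>o(n)\<close> too, and this coefficient is a multiple of
  \<open>\<Sum> cos (m \<theta>\<^sub>j) - (1 / 2) \<Sum> (- \<alpha>\<^sub>k)\<^sup>m\<close> (\<open>moments_of_near_extremal_polynomials\<close>).

  Consequently the averages of the Chebyshev polynomial \<open>T\<^sub>m\<close> over the nodes have the same limit as
  those of \<open>(- \<alpha>)\<^sup>m\<close> over the parameters, namely \<open>\<integral> (- \<alpha>)\<^sup>m d\<nu>\<close>. On the other hand, the
  measure \<open>\<mu>\<close> arises from \<open>\<nu>\<close> by replacing the unit mass at \<open>t\<close> with the Poisson kernel of the point
  \<open>- \<alpha>(t)\<close>, whose \<open>m\<close>-th cosine moment is \<open>(- \<alpha>(t))\<^sup>m\<close>; the masses at \<open>0\<close> and \<open>\<plusminus>1\<close>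
  turn into the arcsine measure and the masses at \<open>\<mp>1\<close>. So the limit is \<open>\<integral> T\<^sub>m d\<mu>\<close>
  (\<open>moments_mu_nu\<close>), and the Weierstrass theorem extends the convergence to continuous functions.
\<close>

section \<open>Integrals over the angle\<close>

abbreviation angles :: "real measure" where
  "angles \<equiv> lebesgue_on {0..pi}"

lemma finite_measure_angles: "finite_measure angles"
  by (intro finite_measure_lebesgue_on) auto

interpretation angles: finite_measure angles
  by (rule finite_measure_angles)

lemma continuous_integrable_angles:
  "continuous_on UNIV f \<Longrightarrow> integrable angles f" for f :: "real \<Rightarrow> real"
  by (rule continuous_imp_integrable_real) (auto intro: continuous_on_subset)

lemma borel_measurable_angles:
  "f \<in> borel_measurable borel \<Longrightarrow> f \<in> borel_measurable angles" for f :: "real \<Rightarrow> real"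
  by (intro measurable_restrict_space1 measurable_completion) simp

lemma integral_cos_multiple:
  "(LINT \<theta>|angles. cos (of_int k * \<theta>)) = (if k = 0 then pi else 0)"
proof (cases "k = 0")
  case True
  then show ?thesis by (simp add: measure_restrict_space)
next
  case False
  have "((\<lambda>\<theta>. cos (of_int k * \<theta>)) has_integral
      (sin (of_int k * pi) / of_int k - sin (of_int k * 0) / of_int k)) {0..pi}"
    using False
    by (intro fundamental_theorem_of_calculus)
      (auto intro!: derivative_eq_intros simp flip: has_real_derivative_iff_has_vector_derivative)
  moreover have "sin (of_int k * pi) = 0"
    by (subst mult.commute) (rule sin_zero_iff_int2[THEN iffD2], auto)
  ultimately have "integral {0..pi} (\<lambda>\<theta>. cos (of_int k * \<theta>)) = 0"
    by (simp add: integral_unique)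
  then show ?thesis using False
    by (subst lebesgue_integral_eq_integral) (auto intro!: continuous_integrable_angles continuous_intros)
qed

lemma integral_cos_cos:
  "(LINT \<theta>|angles. cos (real k * \<theta>) * cos (real m * \<theta>)) =
     (if k = m then if m = 0 then pi else pi / 2 else 0)"
proof -
  have "(LINT \<theta>|angles. cos (real k * \<theta>) * cos (real m * \<theta>)) =
      (LINT \<theta>|angles. cos (of_int (int k - int m) * \<theta>) / 2 + cos (of_int (int k + int m) * \<theta>) / 2)"
    by (intro Bochner_Integration.integral_cong refl)
      (simp add: cos_times_cos ring_distribs add_divide_distrib)
  also have "\<dots> = (LINT \<theta>|angles. cos (of_int (int k - int m) * \<theta>)) / 2
      + (LINT \<theta>|angles. cos (of_int (int k + int m) * \<theta>)) / 2"
    by (subst Bochner_Integration.integral_add)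
      (auto intro!: continuous_integrable_angles continuous_intros simp del: of_int_diff of_int_add)
  also have "\<dots> = (if k = m then if m = 0 then pi else pi / 2 else 0)"
    unfolding integral_cos_multiple by auto
  finally show ?thesis .
qed

section \<open>The logarithmic kernel\<close>

text \<open>
  For \<open>\<zeta> = e\<^sup>i\<^sup>\<phi>\<close> this is \<open>ln \<bar>2 cos \<phi> - 2 cos \<theta>\<bar>\<close>, the contribution of a zero
  \<open>cos \<phi>\<close>; for real \<open>\<zeta> = - a\<close> it is \<open>ln (1 + a\<^sup>2 + 2 a cos \<theta>)\<close>, the contribution of a factor of
  the denominator. One complex parameter covers both.
\<close>
definition log_kernel :: "complex \<Rightarrow> real \<Rightarrow> real" where
  "log_kernel \<zeta> \<theta> = ln (cmod (1 + \<zeta>\<^sup>2 - 2 * \<zeta> * of_real (cos \<theta>)))"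

text \<open>
  The kernel is the sum of the values of \<open>log \<bar>1 - \<zeta> z\<bar>\<close> at \<open>z = e\<^sup>i\<^sup>\<theta>\<close> and at its conjugate;
  this gives access to the power series of the complex logarithm.
\<close>
lemma log_kernel_factor:
  "1 + \<zeta>\<^sup>2 - 2 * \<zeta> * of_real (cos \<theta>) = (1 - \<zeta> * cis \<theta>) * (1 - \<zeta> * cis (- \<theta>))"
proof -
  have "cis \<theta> * cis (- \<theta>) = 1" by (simp add: cis_mult)
  moreover have "cis \<theta> + cis (- \<theta>) = 2 * of_real (cos \<theta>)"
    by (simp add: complex_eq_iff)
  moreover have "(1 - \<zeta> * cis \<theta>) * (1 - \<zeta> * cis (- \<theta>)) =
      1 + \<zeta>\<^sup>2 * (cis \<theta> * cis (- \<theta>)) - \<zeta> * (cis \<theta> + cis (- \<theta>))"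
    by (simp add: algebra_simps power2_eq_square)
  ultimately show ?thesis by (simp add: algebra_simps)
qed

lemma log_kernel_measurable [measurable]: "log_kernel \<zeta> \<in> borel_measurable borel"
  unfolding log_kernel_def by measurable

lemma factor_nonzero: "cmod \<zeta> < 1 \<Longrightarrow> 1 + \<zeta>\<^sup>2 - 2 * \<zeta> * of_real (cos \<theta>) \<noteq> 0"
proof -
  assume z: "cmod \<zeta> < 1"
  have "\<zeta> * cis a \<noteq> 1" for a
    using z by (metis mult.right_neutral norm_cis norm_mult norm_one order_less_irrefl)
  then show ?thesis unfolding log_kernel_factor by (metis eq_iff_diff_eq_0 mult_eq_0_iff)
qed

lemma log_kernel_series:
  assumes z: "cmod \<zeta> < 1"
  shows "(\<lambda>k. - (2 * Re (\<zeta> ^ k) / real k) * cos (real k * \<theta>)) sums log_kernel \<zeta> \<theta>"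
proof -
  have ser: "(\<lambda>k. - Re (\<zeta> ^ k * cis (real k * a)) / real k) sums ln (cmod (1 - \<zeta> * cis a))" for a
  proof -
    have "cmod (- (\<zeta> * cis a)) < 1" using z by (simp add: norm_mult)
    from sums_Re[OF Ln_series'[OF this]] have
      "(\<lambda>k. Re (- ((\<zeta> * cis a) ^ k) / of_nat k)) sums Re (Ln (1 - \<zeta> * cis a))" by simp
    moreover have "1 - \<zeta> * cis a \<noteq> 0"
      using z by (metis eq_iff_diff_eq_0 mult.right_neutral norm_cis norm_mult norm_one order_less_irrefl)
    ultimately show ?thesis
      by (simp add: power_mult_distrib Re_divide_of_nat Complex.DeMoivre del: times_complex.sel)
  qed
  have nz: "1 - \<zeta> * cis \<theta> \<noteq> 0" "1 - \<zeta> * cis (- \<theta>) \<noteq> 0"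
    using factor_nonzero[OF z, of \<theta>] unfolding log_kernel_factor by auto
  have "(\<lambda>k. - Re (\<zeta> ^ k * cis (real k * \<theta>)) / real k + - Re (\<zeta> ^ k * cis (real k * - \<theta>)) / real k)
      sums (ln (cmod (1 - \<zeta> * cis \<theta>)) + ln (cmod (1 - \<zeta> * cis (- \<theta>))))"
    by (intro sums_add ser)
  moreover have "ln (cmod (1 - \<zeta> * cis \<theta>)) + ln (cmod (1 - \<zeta> * cis (- \<theta>))) = log_kernel \<zeta> \<theta>"
    unfolding log_kernel_def log_kernel_factor norm_mult using nz by (simp add: ln_mult)
  moreover have "- Re (\<zeta> ^ k * cis (real k * \<theta>)) / real k + - Re (\<zeta> ^ k * cis (real k * - \<theta>)) / real k
      = - (2 * Re (\<zeta> ^ k) / real k) * cos (real k * \<theta>)" for k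
    by (simp add: algebra_simps flip: add_divide_distrib)
  ultimately show ?thesis by simp
qed

lemma log_kernel_continuous:
  assumes z: "cmod \<zeta> < 1"
  shows "continuous_on UNIV (log_kernel \<zeta>)"
  unfolding log_kernel_def using factor_nonzero[OF z]
  by (intro continuous_intros) auto

lemma log_kernel_series_integral:
  assumes z: "cmod \<zeta> < 1" and f: "continuous_on UNIV f"
  shows "(\<lambda>k. - (2 * Re (\<zeta> ^ k) / real k) * (LINT \<theta>|angles. cos (real k * \<theta>) * f \<theta>))
           sums (LINT \<theta>|angles. log_kernel \<zeta> \<theta> * f \<theta>)"
proof -
  let ?g = "\<lambda>k \<theta>. - (2 * Re (\<zeta> ^ k) / real k) * (cos (real k * \<theta>) * f \<theta>)"
  have bound: "\<bar>?g k \<theta>\<bar> \<le> 2 * cmod \<zeta> ^ k * \<bar>f \<theta>\<bar>" for k \<theta>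
  proof -
    have "\<bar>Re (\<zeta> ^ k)\<bar> \<le> cmod \<zeta> ^ k"
      using abs_Re_le_cmod[of "\<zeta> ^ k"] by (simp add: norm_power)
    moreover have "\<bar>Re (\<zeta> ^ k)\<bar> / real k \<le> \<bar>Re (\<zeta> ^ k)\<bar>"
      using divide_left_mono[of 1 "real k" "\<bar>Re (\<zeta> ^ k)\<bar>"] by (cases "k = 0") auto
    ultimately have "\<bar>2 * Re (\<zeta> ^ k) / real k\<bar> \<le> 2 * cmod \<zeta> ^ k"
      by (simp add: abs_mult)
    then have "\<bar>2 * Re (\<zeta> ^ k) / real k\<bar> * \<bar>cos (real k * \<theta>)\<bar> \<le> (2 * cmod \<zeta> ^ k) * 1"
      by (intro mult_mono) (auto simp: abs_mult)
    then have "\<bar>2 * Re (\<zeta> ^ k) / real k\<bar> * \<bar>cos (real k * \<theta>)\<bar> * \<bar>f \<theta>\<bar> \<le> (2 * cmod \<zeta> ^ k) * 1 * \<bar>f \<theta>\<bar>"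
      by (intro mult_right_mono) auto
    then show ?thesis by (simp add: abs_mult mult.assoc)
  qed
  have sg: "summable (\<lambda>k. 2 * cmod \<zeta> ^ k * c)" for c
    using z by (intro summable_mult summable_mult2 summable_geometric) auto
  have int: "integrable angles (?g k)" for k
    by (intro continuous_integrable_angles continuous_intros f)
  have "(\<lambda>k. LINT \<theta>|angles. ?g k \<theta>) sums (LINT \<theta>|angles. (\<Sum>k. ?g k \<theta>))"
  proof (rule sums_integral[OF int])
    show "AE \<theta> in angles. summable (\<lambda>k. norm (?g k \<theta>))"
      by (intro AE_I2 summable_comparison_test[OF _ sg]) (use bound in auto)
    have "(LINT \<theta>|angles. norm (?g k \<theta>)) \<le> 2 * cmod \<zeta> ^ k * (LINT \<theta>|angles. \<bar>f \<theta>\<bar>)" for k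
    proof -
      have "(LINT \<theta>|angles. norm (?g k \<theta>)) \<le> (LINT \<theta>|angles. 2 * cmod \<zeta> ^ k * \<bar>f \<theta>\<bar>)"
        using bound
        by (intro integral_mono integrable_norm int integrable_mult_right
            continuous_integrable_angles continuous_intros f) auto
      then show ?thesis by simp
    qed
    then show "summable (\<lambda>k. LINT \<theta>|angles. norm (?g k \<theta>))"
      by (intro summable_comparison_test[OF _ sg[of "LINT \<theta>|angles. \<bar>f \<theta>\<bar>"]])
        (auto intro!: exI[of _ 0] simp: abs_of_nonneg integral_nonneg)
  qed
  moreover have "(\<Sum>k. ?g k \<theta>) = log_kernel \<zeta> \<theta> * f \<theta>" for \<theta>
    using sums_mult2[OF log_kernel_series[OF z, of \<theta>], of "f \<theta>"]
    by (subst sums_unique[symmetric]) (auto simp only: mult.assoc)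
  ultimately show ?thesis by simp
qed

text \<open>
  Orthogonality of the cosines leaves a single term of the series. The case \<open>m = 0\<close> is included:
  both sides are \<open>0\<close> by the convention for division by \<open>0\<close>, which is Jensen's formula.
\<close>
lemma log_kernel_cos_interior:
  assumes z: "cmod \<zeta> < 1"
  shows "(LINT \<theta>|angles. log_kernel \<zeta> \<theta> * cos (real m * \<theta>)) = - (pi * Re (\<zeta> ^ m) / real m)"
proof -
  have a: "(\<lambda>k. - (2 * Re (\<zeta> ^ k) / real k) * (LINT \<theta>|angles. cos (real k * \<theta>) * cos (real m * \<theta>)))
      sums (LINT \<theta>|angles. log_kernel \<zeta> \<theta> * cos (real m * \<theta>))"
    by (rule log_kernel_series_integral[OF z]) (intro continuous_intros)
  have b: "(\<lambda>k. - (2 * Re (\<zeta> ^ k) / real k) *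
      (LINT \<theta>|angles. cos (real k * \<theta>) * cos (real m * \<theta>))) =
      (\<lambda>k. if k = m then - (pi * Re (\<zeta> ^ m) / real m) else 0)"
    by (auto simp: integral_cos_cos fun_eq_iff)
  have c: "(\<lambda>k. if k = m then - (pi * Re (\<zeta> ^ m) / real m) else 0) sums
      - (pi * Re (\<zeta> ^ m) / real m)"
    by (rule sums_single)
  show ?thesis using a c unfolding b by (rule sums_unique2)
qed

definition log_kernel_const :: real where
  "log_kernel_const = 2 * pi * (\<Sum>k. 1 / real k ^ 2)"

text \<open>
  Parseval's identity, obtained by integrating the series of one factor against the other; the
  coefficients are \<open>O(1 / k)\<close> uniformly in \<open>\<zeta>\<close>.
\<close>
lemma log_kernel_sq_interior:
  assumes z: "cmod \<zeta> < 1"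
  shows "(LINT \<theta>|angles. (log_kernel \<zeta> \<theta>)\<^sup>2) \<le> log_kernel_const"
proof -
  have s: "(\<lambda>k. - (2 * Re (\<zeta> ^ k) / real k) * (LINT \<theta>|angles. cos (real k * \<theta>) * log_kernel \<zeta> \<theta>))
      sums (LINT \<theta>|angles. log_kernel \<zeta> \<theta> * log_kernel \<zeta> \<theta>)"
    by (rule log_kernel_series_integral[OF z log_kernel_continuous[OF z]])
  have r: "\<bar>Re (\<zeta> ^ k)\<bar> \<le> 1" for k
    using abs_Re_le_cmod[of "\<zeta> ^ k"] z power_le_one[of "cmod \<zeta>" k] by (simp add: norm_power)
  have "(LINT \<theta>|angles. log_kernel \<zeta> \<theta> * log_kernel \<zeta> \<theta>) \<le> (\<Sum>k. 2 * pi * (1 / real k ^ 2))"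
  proof (rule sums_le[OF _ s])
    show "(\<lambda>k. 2 * pi * (1 / real k ^ 2)) sums (\<Sum>k. 2 * pi * (1 / real k ^ 2))"
      using inverse_power_summable[of 2, where 'a = real]
      by (intro summable_sums summable_mult) (simp add: inverse_eq_divide)
    fix k
    have "- (2 * Re (\<zeta> ^ k) / real k) * (LINT \<theta>|angles. cos (real k * \<theta>) * log_kernel \<zeta> \<theta>)
        = 2 * pi * ((Re (\<zeta> ^ k))\<^sup>2 / real k ^ 2)"
      using log_kernel_cos_interior[OF z, of k]
      by (subst mult.commute[of "cos _"]) (simp add: power2_eq_square)
    also have "\<dots> \<le> 2 * pi * (1 / real k ^ 2)"
      using r[of k] by (intro mult_left_mono divide_right_mono) (auto simp: abs_square_le_1)
    finally show "- (2 * Re (\<zeta> ^ k) / real k) * (LINT \<theta>|angles. cos (real k * \<theta>) * log_kernel \<zeta> \<theta>)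
        \<le> 2 * pi * (1 / real k ^ 2)" .
  qed
  also have "\<dots> = log_kernel_const"
    unfolding log_kernel_const_def using inverse_power_summable[of 2, where 'a = real]
    by (intro suminf_mult) (simp add: inverse_eq_divide)
  finally show ?thesis by (simp add: power2_eq_square)
qed

lemma norm_factor_unit:
  "cmod (1 + (cis \<phi>)\<^sup>2 - 2 * cis \<phi> * of_real (cos \<theta>)) = \<bar>2 * cos \<phi> - 2 * cos \<theta>\<bar>"
proof -
  have "1 + (cis \<phi>)\<^sup>2 - 2 * cis \<phi> * of_real (cos \<theta>) = cis \<phi> * of_real (2 * cos \<phi> - 2 * cos \<theta>)"
  proof -
    have "cis \<phi> * cis (- \<phi>) = 1" by (simp add: cis_mult)
    moreover have "of_real (2 * cos \<phi>) = cis \<phi> + cis (- \<phi>)" by (simp add: complex_eq_iff)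
    ultimately show ?thesis by (simp add: algebra_simps power2_eq_square)
  qed
  then show ?thesis by (simp only: norm_mult norm_cis norm_of_real mult_1)
qed

lemma log_kernel_unit:
  "log_kernel (cis \<phi>) \<theta> = ln \<bar>2 * cos \<phi> - 2 * cos \<theta>\<bar>"
  unfolding log_kernel_def norm_factor_unit ..

lemma AE_angles_cos_neq: "AE \<theta> in angles. cos \<theta> \<noteq> c"
proof -
  have "{\<theta> \<in> {0..pi}. cos \<theta> = c} \<subseteq> {arccos c}"
    by (auto simp: arccos_cos)
  then have "{\<theta> \<in> {0..pi}. cos \<theta> = c} \<in> null_sets lebesgue"
    by (meson finite.emptyI finite_insert finite_subset negligible_finite negligible_iff_null_sets)
  then have "AE \<theta> in lebesgue. \<theta> \<in> {0..pi} \<longrightarrow> cos \<theta> \<noteq> c"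
    by (auto dest!: AE_not_in elim!: eventually_mono)
  then show ?thesis by (subst AE_restrict_space_iff) auto
qed

text \<open>
  Moving a boundary point \<open>u\<close> radially inwards at most halves its distance from \<open>1\<close>. This makes the
  kernels along a radius dominated by the one at its end point.
\<close>
lemma norm_shrink_lower:
  assumes "cmod u = 1" "0 \<le> \<rho>" "\<rho> \<le> 1"
  shows "cmod (1 - u) \<le> 2 * cmod (1 - of_real \<rho> * u)"
proof -
  have "1 - u = (1 - of_real \<rho> * u) - of_real (1 - \<rho>) * u" by (simp add: algebra_simps)
  then have "cmod (1 - u) \<le> cmod (1 - of_real \<rho> * u) + cmod (of_real (1 - \<rho>) * u)"
    by (metis norm_triangle_ineq4)
  also have "cmod (of_real (1 - \<rho>) * u) = 1 - \<rho>" using assms by (simp only: norm_mult norm_of_real) auto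
  also have "1 - \<rho> \<le> cmod (1 - of_real \<rho> * u)"
    using norm_triangle_ineq2[of 1 "of_real \<rho> * u"] assms by (simp add: norm_mult)
  finally show ?thesis by simp
qed

lemma log_kernel_shrink_bound:
  assumes "cmod \<zeta> = 1" "0 \<le> \<rho>" "\<rho> < 1" and nz: "1 + \<zeta>\<^sup>2 - 2 * \<zeta> * of_real (cos \<theta>) \<noteq> 0"
  shows "\<bar>log_kernel (of_real \<rho> * \<zeta>) \<theta>\<bar> \<le> \<bar>log_kernel \<zeta> \<theta>\<bar> + ln 4"
proof -
  have "cmod (of_real \<rho> * \<zeta>) < 1" using assms by (simp add: norm_mult)
  note nz' = factor_nonzero[OF this, of \<theta>]
  define A where "A = cmod (1 + (of_real \<rho> * \<zeta>)\<^sup>2 - 2 * (of_real \<rho> * \<zeta>) * of_real (cos \<theta>))"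
  define B where "B = cmod (1 + \<zeta>\<^sup>2 - 2 * \<zeta> * of_real (cos \<theta>))"
  have pos: "0 < A" "0 < B" using nz nz' by (auto simp: A_def B_def)
  have "B \<le> (2 * cmod (1 - of_real \<rho> * (\<zeta> * cis \<theta>))) * (2 * cmod (1 - of_real \<rho> * (\<zeta> * cis (- \<theta>))))"
    unfolding B_def log_kernel_factor norm_mult
    by (intro mult_mono norm_shrink_lower) (use assms in \<open>auto simp: norm_mult\<close>)
  also have "\<dots> = 4 * A"
    unfolding A_def log_kernel_factor norm_mult by (simp add: mult.assoc)
  finally have BA: "B \<le> 4 * A" .
  have le2: "cmod (1 - of_real \<rho> * \<zeta> * cis a) \<le> 2" for a
    using norm_triangle_ineq4[of 1 "of_real \<rho> * \<zeta> * cis a"] assms by (simp add: norm_mult)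
  have "A \<le> 2 * 2"
    unfolding A_def log_kernel_factor norm_mult by (intro mult_mono le2) auto
  then have "ln A \<le> ln 4" using pos by simp
  moreover have "ln B - ln 4 \<le> ln A"
    using BA pos ln_mono[of B "4 * A"] by (simp add: ln_mult)
  ultimately show ?thesis unfolding log_kernel_def A_def[symmetric] B_def[symmetric] by linarith
qed

context
  fixes \<zeta> :: complex
  assumes unit: "cmod \<zeta> = 1"
begin

private definition shrink :: "nat \<Rightarrow> complex" where
  "shrink i = of_real (real i / (real i + 1)) * \<zeta>"

private lemma norm_shrink: "cmod (shrink i) < 1"
  unfolding shrink_def using unit by (simp add: norm_mult del: of_real_divide)

private lemma shrink_tendsto: "shrink \<longlonglongrightarrow> \<zeta>"
proof -
  have "(\<lambda>i. of_real (real i / (real i + 1)) * \<zeta>) \<longlonglongrightarrow> of_real 1 * \<zeta>"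
    by (intro tendsto_intros) (use LIMSEQ_n_over_Suc_n in \<open>simp add: add.commute\<close>)
  then show ?thesis unfolding shrink_def[abs_def] by simp
qed

lemma AE_unit_factor_nonzero:
  "AE \<theta> in angles. 1 + \<zeta>\<^sup>2 - 2 * \<zeta> * of_real (cos \<theta>) \<noteq> 0"
proof -
  have "cis (Arg \<zeta>) = \<zeta>" using unit cis_Arg[of \<zeta>] by (cases "\<zeta> = 0") (auto simp: sgn_eq)
  then have *: "cmod (1 + \<zeta>\<^sup>2 - 2 * \<zeta> * of_real (cos \<theta>)) = \<bar>2 * cos (Arg \<zeta>) - 2 * cos \<theta>\<bar>" for \<theta>
    using norm_factor_unit[of "Arg \<zeta>" \<theta>] by simp
  show ?thesis using AE_angles_cos_neq[of "cos (Arg \<zeta>)"]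
  proof eventually_elim
    case (elim \<theta>)
    then have "cmod (1 + \<zeta>\<^sup>2 - 2 * \<zeta> * of_real (cos \<theta>)) \<noteq> 0" unfolding * by simp
    then show ?case by simp
  qed
qed

private lemma log_kernel_shrink_tendsto:
  assumes "1 + \<zeta>\<^sup>2 - 2 * \<zeta> * of_real (cos \<theta>) \<noteq> 0"
  shows "(\<lambda>i. log_kernel (shrink i) \<theta>) \<longlonglongrightarrow> log_kernel \<zeta> \<theta>"
  unfolding log_kernel_def
  by (intro tendsto_intros shrink_tendsto) (use assms in auto)

text \<open>
  On the unit circle the kernel has a logarithmic singularity; Fatou's lemma carries the \<open>L\<^sup>2\<close> bound
  over from the interior, and integrability follows from it.
\<close>
private lemma log_kernel_sq_nn_integral:
  "(\<integral>\<^sup>+\<theta>. ennreal ((log_kernel \<zeta> \<theta>)\<^sup>2) \<partial>angles) \<le> ennreal log_kernel_const"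
proof -
  have "(\<integral>\<^sup>+\<theta>. ennreal ((log_kernel \<zeta> \<theta>)\<^sup>2) \<partial>angles) =
      (\<integral>\<^sup>+\<theta>. liminf (\<lambda>i. ennreal ((log_kernel (shrink i) \<theta>)\<^sup>2)) \<partial>angles)"
  proof (rule nn_integral_cong_AE)
    show "AE \<theta> in angles. ennreal ((log_kernel \<zeta> \<theta>)\<^sup>2) = liminf (\<lambda>i. ennreal ((log_kernel (shrink i) \<theta>)\<^sup>2))"
      using AE_unit_factor_nonzero
    proof eventually_elim
      case (elim \<theta>)
      have "(\<lambda>i. ennreal ((log_kernel (shrink i) \<theta>)\<^sup>2)) \<longlonglongrightarrow> ennreal ((log_kernel \<zeta> \<theta>)\<^sup>2)"
        by (intro tendsto_ennrealI tendsto_intros log_kernel_shrink_tendsto elim)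
      then show ?case by (intro lim_imp_Liminf[symmetric]) auto
    qed
  qed
  also have "\<dots> \<le> liminf (\<lambda>i. \<integral>\<^sup>+\<theta>. ennreal ((log_kernel (shrink i) \<theta>)\<^sup>2) \<partial>angles)"
    by (intro nn_integral_liminf measurable_compose[OF _ measurable_ennreal] borel_measurable_power
      borel_measurable_angles log_kernel_measurable)
  also have "\<dots> \<le> ennreal log_kernel_const"
  proof -
    have "(\<integral>\<^sup>+\<theta>. ennreal ((log_kernel (shrink i) \<theta>)\<^sup>2) \<partial>angles) \<le> ennreal log_kernel_const" for i
    proof -
      have "integrable angles (\<lambda>\<theta>. (log_kernel (shrink i) \<theta>)\<^sup>2)"
        by (intro continuous_integrable_angles continuous_on_power log_kernel_continuous norm_shrink)
      then show ?thesis
        by (subst nn_integral_eq_integral) (auto intro!: ennreal_leI log_kernel_sq_interior norm_shrink)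
    qed
    then show ?thesis by (intro Liminf_le) auto
  qed
  finally show ?thesis .
qed

private lemma log_kernel_sq_integrable: "integrable angles (\<lambda>\<theta>. (log_kernel \<zeta> \<theta>)\<^sup>2)"
  using log_kernel_sq_nn_integral
  by (intro integrableI_bounded borel_measurable_power borel_measurable_angles log_kernel_measurable)
    (auto simp: le_less_trans)

private lemma log_kernel_integrable: "integrable angles (log_kernel \<zeta>)"
proof (rule Bochner_Integration.integrable_bound)
  show "integrable angles (\<lambda>\<theta>. 1 + (log_kernel \<zeta> \<theta>)\<^sup>2)"
    using log_kernel_sq_integrable by simp
  have "\<bar>y\<bar> \<le> \<bar>1 + y\<^sup>2\<bar>" for y :: real
    using zero_le_power2[of "\<bar>y\<bar> - 1"] by (simp add: power2_diff)
  then show "AE \<theta> in angles. norm (log_kernel \<zeta> \<theta>) \<le> norm (1 + (log_kernel \<zeta> \<theta>)\<^sup>2)"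
    by simp
qed (intro borel_measurable_angles log_kernel_measurable)

private lemma log_kernel_cos_unit:
  "(LINT \<theta>|angles. log_kernel \<zeta> \<theta> * cos (real m * \<theta>)) = - (pi * Re (\<zeta> ^ m) / real m)"
proof -
  have "(\<lambda>i. LINT \<theta>|angles. log_kernel (shrink i) \<theta> * cos (real m * \<theta>)) \<longlonglongrightarrow>
      (LINT \<theta>|angles. log_kernel \<zeta> \<theta> * cos (real m * \<theta>))"
  proof (rule integral_dominated_convergence[where w = "\<lambda>\<theta>. \<bar>log_kernel \<zeta> \<theta>\<bar> + ln 4"])
    show "AE \<theta> in angles. (\<lambda>i. log_kernel (shrink i) \<theta> * cos (real m * \<theta>))
        \<longlonglongrightarrow> log_kernel \<zeta> \<theta> * cos (real m * \<theta>)"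
      using AE_unit_factor_nonzero
      by eventually_elim (intro tendsto_intros log_kernel_shrink_tendsto)
    show "AE \<theta> in angles. norm (log_kernel (shrink i) \<theta> * cos (real m * \<theta>)) \<le> \<bar>log_kernel \<zeta> \<theta>\<bar> + ln 4" for i
      using AE_unit_factor_nonzero
    proof eventually_elim
      case (elim \<theta>)
      have "\<bar>log_kernel (shrink i) \<theta>\<bar> \<le> \<bar>log_kernel \<zeta> \<theta>\<bar> + ln 4"
        unfolding shrink_def by (intro log_kernel_shrink_bound elim unit) auto
      then show ?case
        using mult_mono[of "\<bar>log_kernel (shrink i) \<theta>\<bar>" "\<bar>log_kernel \<zeta> \<theta>\<bar> + ln 4" "\<bar>cos (real m * \<theta>)\<bar>" 1]
        by (simp add: abs_mult)
    qed
  qed (auto intro!: borel_measurable_angles log_kernel_integrable)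
  moreover have "(\<lambda>i. LINT \<theta>|angles. log_kernel (shrink i) \<theta> * cos (real m * \<theta>)) \<longlonglongrightarrow>
      - (pi * Re (\<zeta> ^ m) / real m)"
    unfolding log_kernel_cos_interior[OF norm_shrink] divide_inverse
    by (intro tendsto_intros shrink_tendsto)
  ultimately show ?thesis by (rule LIMSEQ_unique)
qed

lemmas log_kernel_unit_facts =
  log_kernel_sq_nn_integral log_kernel_sq_integrable log_kernel_integrable log_kernel_cos_unit

end

text \<open>
  The kernels with \<open>\<bar>\<zeta>\<bar> \<le> 1\<close>: interior parameters are covered by the series, those of modulus \<open>1\<close>
  by the radial limit.
\<close>
lemma
  assumes z: "cmod \<zeta> \<le> 1"
  shows integrable_log_kernel: "integrable angles (log_kernel \<zeta>)"
    and integrable_log_kernel_sq: "integrable angles (\<lambda>\<theta>. (log_kernel \<zeta> \<theta>)\<^sup>2)"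
    and integral_log_kernel_sq: "(LINT \<theta>|angles. (log_kernel \<zeta> \<theta>)\<^sup>2) \<le> log_kernel_const"
    and integral_log_kernel_cos:
      "(LINT \<theta>|angles. log_kernel \<zeta> \<theta> * cos (real m * \<theta>)) = - (pi * Re (\<zeta> ^ m) / real m)"
proof -
  have "integrable angles (log_kernel \<zeta>) \<and> integrable angles (\<lambda>\<theta>. (log_kernel \<zeta> \<theta>)\<^sup>2) \<and>
    (LINT \<theta>|angles. (log_kernel \<zeta> \<theta>)\<^sup>2) \<le> log_kernel_const \<and>
    (LINT \<theta>|angles. log_kernel \<zeta> \<theta> * cos (real m * \<theta>)) = - (pi * Re (\<zeta> ^ m) / real m)"
  proof (cases "cmod \<zeta> = 1")
    case True
    note f = log_kernel_unit_facts[OF True]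
    have "0 \<le> log_kernel_const"
      unfolding log_kernel_const_def using inverse_power_summable[of 2, where 'a = real]
      by (intro mult_nonneg_nonneg suminf_nonneg) (auto simp: inverse_eq_divide)
    then have "(LINT \<theta>|angles. (log_kernel \<zeta> \<theta>)\<^sup>2) \<le> log_kernel_const"
      using f(1) nn_integral_eq_integral[OF f(2)] by simp
    with f show ?thesis by blast
  next
    case False
    then have z1: "cmod \<zeta> < 1" using z by simp
    show ?thesis
      by (intro conjI log_kernel_sq_interior log_kernel_cos_interior continuous_integrable_angles
         continuous_on_power log_kernel_continuous z1)
  qed
  then show "integrable angles (log_kernel \<zeta>)" "integrable angles (\<lambda>\<theta>. (log_kernel \<zeta> \<theta>)\<^sup>2)"
    "(LINT \<theta>|angles. (log_kernel \<zeta> \<theta>)\<^sup>2) \<le> log_kernel_const"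
    "(LINT \<theta>|angles. log_kernel \<zeta> \<theta> * cos (real m * \<theta>)) = - (pi * Re (\<zeta> ^ m) / real m)"
    by blast+
qed

text \<open>
  Choosing first \<open>a\<close> small and then the measure of \<open>E\<close> small makes the bound small, uniformly in
  \<open>\<zeta>\<close>. This is what allows poles of the rational weight to approach the interval.
\<close>
lemma log_kernel_uniformly_integrable:
  assumes z: "cmod \<zeta> \<le> 1" and E: "E \<in> sets angles" and a: "0 < a"
  shows "(LINT \<theta>|angles. indicator E \<theta> * \<bar>log_kernel \<zeta> \<theta>\<bar>) \<le> a * log_kernel_const + measure angles E / a"
proof -
  have iE: "integrable angles (indicator E :: real \<Rightarrow> real)"
    using E by (intro integrable_real_indicator) (auto simp: angles.emeasure_finite simp flip: less_top)
  have "(LINT \<theta>|angles. indicator E \<theta> * \<bar>log_kernel \<zeta> \<theta>\<bar>) \<le>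
      (LINT \<theta>|angles. a * (log_kernel \<zeta> \<theta>)\<^sup>2 + indicator E \<theta> / a)"
  proof (rule integral_mono)
    show "integrable angles (\<lambda>\<theta>. indicator E \<theta> * \<bar>log_kernel \<zeta> \<theta>\<bar>)"
      using integrable_real_mult_indicator[OF E integrable_abs[OF integrable_log_kernel[OF z]]]
      by (simp add: mult.commute)
    show "integrable angles (\<lambda>\<theta>. a * (log_kernel \<zeta> \<theta>)\<^sup>2 + indicator E \<theta> / a)"
      by (intro Bochner_Integration.integrable_add integrable_mult_right integrable_divide
          integrable_log_kernel_sq z iE)
    (* completing the square in 2 a y - 1 *)
    have "y \<le> a * y\<^sup>2 + 1 / a" for y
    proof -
      have "0 \<le> (2 * a * y - 1)\<^sup>2" by simp
      then have "4 * a * y \<le> 4 * a * a * y\<^sup>2 + 1" by (simp add: power2_eq_square algebra_simps)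
      then have "4 * a * y \<le> 4 * a * (a * y\<^sup>2 + 1 / a)" using a by (simp add: algebra_simps)
      then show ?thesis using a by (subst (asm) mult_le_cancel_left_pos) auto
    qed
    from this[of "\<bar>_\<bar>"] show "indicator E \<theta> * \<bar>log_kernel \<zeta> \<theta>\<bar> \<le> a * (log_kernel \<zeta> \<theta>)\<^sup>2 + indicator E \<theta> / a" for \<theta>
      using a by (auto simp: indicator_def)
  qed
  also have "\<dots> = a * (LINT \<theta>|angles. (log_kernel \<zeta> \<theta>)\<^sup>2) + measure angles E / a"
    using sets.Int_space_eq2[OF E]
    by (subst Bochner_Integration.integral_add) (simp_all add: integrable_log_kernel_sq z iE)
  also have "\<dots> \<le> a * log_kernel_const + measure angles E / a"
    using integral_log_kernel_sq[OF z] a by simp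
  finally show ?thesis .
qed

section \<open>Mean-zero sequences and the substitution x = cos theta\<close>

text \<open>
  A mean-zero sequence is controlled by its positive part, because its positive and negative parts
  have the same integral. Off the small set where \<open>g\<close> is below a threshold, the positive part is at most \<open>exp U\<close>
  and hence bounded in mean by the weighted bound; on that set uniform integrability applies.
\<close>
lemma (in finite_measure) mean_abs_tendsto_0:
  fixes U :: "nat \<Rightarrow> 'a \<Rightarrow> real" and g :: "'a \<Rightarrow> real"
  assumes intU: "\<And>n. integrable M (U n)" and mean: "\<And>n. (LINT x|M. U n x) = 0"
    and unif: "\<And>e. 0 < e \<Longrightarrow> \<exists>d>0. \<forall>n>0. \<forall>E\<in>sets M. measure M E < d \<longrightarrow>
                 (LINT x|M. indicator E x * \<bar>U n x\<bar>) \<le> e * real n"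
    and g [measurable]: "g \<in> borel_measurable M" and g_pos: "AE x in M. 0 < g x"
    and int: "\<forall>\<^sub>F n in sequentially. integrable M (\<lambda>x. exp (U n x) * g x)"
    and bound: "\<forall>\<^sub>F n in sequentially. (LINT x|M. exp (U n x) * g x) \<le> B"
  shows "(\<lambda>n. (LINT x|M. \<bar>U n x\<bar>) / real n) \<longlonglongrightarrow> 0"
proof (rule tendstoI)
  fix e :: real assume e: "0 < e"
  obtain d where d: "0 < d" and
    dE: "\<And>n E. 0 < n \<Longrightarrow> E \<in> sets M \<Longrightarrow> measure M E < d \<Longrightarrow> (LINT x|M. indicator E x * \<bar>U n x\<bar>) \<le> (e / 6) * real n"
    using unif[of "e / 6"] e by auto
  (* the sets where g is small shrink to a null set, so one of them has measure below d *)
  define A where "A i = {x \<in> space M. g x < 1 / real (Suc i)}" for i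
  have A [measurable]: "A i \<in> sets M" for i unfolding A_def by measurable
  have "(\<lambda>i. measure M (A i)) \<longlonglongrightarrow> measure M (\<Inter>i. A i)"
  proof (rule finite_Lim_measure_decseq)
    show "decseq A"
      unfolding decseq_def A_def
      by (auto elim!: less_le_trans intro!: divide_left_mono)
  qed auto
  moreover have "measure M (\<Inter>i. A i) = 0"
  proof -
    have "AE x in M. x \<notin> (\<Inter>i. A i)"
      using g_pos
    proof eventually_elim
      case (elim x)
      obtain i where "1 / real (Suc i) < g x" using elim nat_approx_posE by blast
      then have "x \<notin> A i" by (auto simp: A_def)
      then show ?case by auto
    qed
    then have "emeasure M (\<Inter>i. A i) = 0"
      by (subst AE_iff_measurable[symmetric, where P = "\<lambda>x. x \<notin> (\<Inter>i. A i)"]) (auto simp: A_def)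
    then show ?thesis by (simp add: measure_def)
  qed
  ultimately have "\<forall>\<^sub>F i in sequentially. measure M (A i) < d"
    using d by (auto dest: order_tendstoD(2))
  then obtain i where i: "measure M (A i) < d" using eventually_happens' by force
  define r where "r = real (Suc i)"
  have r: "0 < r" by (simp add: r_def)
  have main: "(LINT x|M. \<bar>U n x\<bar>) \<le> 2 * ((e / 6) * real n + r * B)"
    if n: "0 < n" "integrable M (\<lambda>x. exp (U n x) * g x)" "(LINT x|M. exp (U n x) * g x) \<le> B" for n
  proof -
    have iA: "integrable M (\<lambda>x. indicator (A i) x * \<bar>U n x\<bar>)"
      using integrable_real_mult_indicator[OF A integrable_abs[OF intU]] by (simp add: mult.commute)
    have ir: "integrable M (\<lambda>x. r * (exp (U n x) * g x))" by (intro integrable_mult_right n)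
    have "(LINT x|M. \<bar>U n x\<bar>) = (LINT x|M. 2 * max 0 (U n x) - U n x)"
      by (intro Bochner_Integration.integral_cong) auto
    also have "\<dots> = 2 * (LINT x|M. max 0 (U n x))"
      using intU mean by (subst Bochner_Integration.integral_diff) (auto intro!: integrable_max)
    also have "(LINT x|M. max 0 (U n x)) \<le>
        (LINT x|M. indicator (A i) x * \<bar>U n x\<bar> + r * (exp (U n x) * g x))"
    proof (rule integral_mono_AE)
      show "integrable M (\<lambda>x. max 0 (U n x))" using intU by (intro integrable_max) auto
      show "integrable M (\<lambda>x. indicator (A i) x * \<bar>U n x\<bar> + r * (exp (U n x) * g x))"
        by (intro Bochner_Integration.integrable_add iA ir)
      show "AE x in M. max 0 (U n x) \<le> indicator (A i) x * \<bar>U n x\<bar> + r * (exp (U n x) * g x)"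
        using g_pos AE_space
      proof eventually_elim
        case (elim x)
        show ?case
        proof (cases "x \<in> A i")
          case True
          moreover have "0 \<le> r * (exp (U n x) * g x)" using r elim by simp
          ultimately show ?thesis by auto
        next
          case False
          then have "1 \<le> r * g x" using elim r by (auto simp: A_def r_def divide_simps mult.commute)
          then have "exp (U n x) * 1 \<le> exp (U n x) * (r * g x)" by (intro mult_left_mono) auto
          moreover have "max 0 (U n x) \<le> exp (U n x) * 1"
            using exp_ge_add_one_self[of "U n x"] exp_gt_zero[of "U n x"]
            by (simp add: max_def del: exp_ge_add_one_self exp_gt_zero)
          ultimately have "max 0 (U n x) \<le> exp (U n x) * (r * g x)" by (rule order_trans[rotated])
          also have "\<dots> = indicator (A i) x * \<bar>U n x\<bar> + r * (exp (U n x) * g x)" using False by simp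
          finally show ?thesis .
        qed
      qed
    qed
    also have "\<dots> = (LINT x|M. indicator (A i) x * \<bar>U n x\<bar>) + r * (LINT x|M. exp (U n x) * g x)"
      using iA ir by simp
    also have "\<dots> \<le> (e / 6) * real n + r * B"
      by (intro add_mono mult_left_mono dE i A n) (use r in auto)
    finally show ?thesis by simp
  qed
  have "\<forall>\<^sub>F n in sequentially. 2 * (r * B) / real n < e / 2"
  proof -
    have "(\<lambda>n. 2 * (r * B) / real n) \<longlonglongrightarrow> 0" by (rule lim_const_over_n)
    then show ?thesis by (rule order_tendstoD(2)) (use e in simp)
  qed
  then show "\<forall>\<^sub>F n in sequentially. dist ((LINT x|M. \<bar>U n x\<bar>) / real n) 0 < e"
    using int bound eventually_gt_at_top[of 0]
  proof eventually_elim
    case (elim n)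
    have "(LINT x|M. \<bar>U n x\<bar>) / real n \<le> 2 * ((e / 6) * real n + r * B) / real n"
      using elim by (intro divide_right_mono main) auto
    also have "\<dots> = e / 3 + 2 * (r * B) / real n" using elim by (simp add: field_simps)
    also have "\<dots> < e" using elim e by simp
    finally show ?case by (simp add: abs_of_nonneg integral_nonneg)
  qed
qed

text \<open>
  Stated for Lebesgue measurable functions, because nothing more is known of a weight. The equivalence
  is used in both directions: for the given weight, and for densities that are known as functions of the angle.
\<close>
lemma cos_substitution:
  fixes f :: "real \<Rightarrow> real"
  shows "integrable (lebesgue_on {-1..1}) f \<longleftrightarrow> integrable angles (\<lambda>\<theta>. f (cos \<theta>) * sin \<theta>)" (is ?int)
    and "integrable (lebesgue_on {-1..1}) f \<Longrightarrow>
      (LINT \<theta>|angles. f (cos \<theta>) * sin \<theta>) = (LINT x|lebesgue_on {-1..1}. f x)"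
proof -
  have im: "cos ` {0..pi} = {-1..1}"
  proof (intro equalityI subsetI)
    fix y :: real assume "y \<in> {-1..1}"
    then show "y \<in> cos ` {0..pi}"
      by (intro image_eqI[of _ _ "arccos y"]) (auto intro: arccos_lbound arccos_ubound)
  qed auto
  have inj: "inj_on cos {0..pi}"
    by (intro inj_onI) (metis atLeastAtMost_iff cos_inj_pi)
  have ab: "g absolutely_integrable_on S \<longleftrightarrow> integrable (lebesgue_on S) g"
    if "S \<in> sets lebesgue" for g :: "real \<Rightarrow> real" and S
    using that by (simp add: integrable_restrict_space set_integrable_def)
  have eq: "\<bar>- sin \<theta>\<bar> * f (cos \<theta>) = f (cos \<theta>) * sin \<theta>" if "\<theta> \<in> {0..pi}" for \<theta>
    using sin_ge_zero[of \<theta>] that by simp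
  have sub: "integrable angles (\<lambda>\<theta>. \<bar>- sin \<theta>\<bar> * f (cos \<theta>)) \<and>
        integral {0..pi} (\<lambda>\<theta>. \<bar>- sin \<theta>\<bar> * f (cos \<theta>)) = b \<longleftrightarrow>
      integrable (lebesgue_on {-1..1}) f \<and> integral {-1..1} f = b" for b
  proof -
    have "(\<lambda>\<theta>. \<bar>- sin \<theta>\<bar> * f (cos \<theta>)) absolutely_integrable_on {0..pi} \<and>
        integral {0..pi} (\<lambda>\<theta>. \<bar>- sin \<theta>\<bar> * f (cos \<theta>)) = b \<longleftrightarrow>
      f absolutely_integrable_on cos ` {0..pi} \<and> integral (cos ` {0..pi}) f = b"
      by (rule has_absolute_integral_change_of_variables_1') (auto intro!: derivative_eq_intros inj)
    moreover have "{0..pi} \<in> sets lebesgue" "{-1..1::real} \<in> sets lebesgue" by auto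
    ultimately show ?thesis unfolding im by (simp only: ab)
  qed
  have c: "integrable angles (\<lambda>\<theta>. \<bar>- sin \<theta>\<bar> * f (cos \<theta>)) \<longleftrightarrow>
      integrable angles (\<lambda>\<theta>. f (cos \<theta>) * sin \<theta>)"
    by (rule Bochner_Integration.integrable_cong[OF refl]) (rule eq, simp)
  show i: ?int using sub unfolding c by blast
  assume f: "integrable (lebesgue_on {-1..1}) f"
  have "integral {0..pi} (\<lambda>\<theta>. f (cos \<theta>) * sin \<theta>) = integral {0..pi} (\<lambda>\<theta>. \<bar>- sin \<theta>\<bar> * f (cos \<theta>))"
    by (rule integral_cong) (rule eq[symmetric])
  also have "\<dots> = integral {-1..1} f" using sub f by blast
  finally show "(LINT \<theta>|angles. f (cos \<theta>) * sin \<theta>) = (LINT x|lebesgue_on {-1..1}. f x)"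
    by (subst (1 2) lebesgue_integral_eq_integral) (use f i in auto)
qed

lemmas integral_cos_substitution = cos_substitution(1)[THEN iffD1] cos_substitution(2)

lemma AE_angles_sin_pos: "AE \<theta> in angles. 0 < sin \<theta>"
  using AE_angles_cos_neq[of 1] AE_angles_cos_neq[of "-1"] AE_space
proof eventually_elim
  case (elim \<theta>)
  then have "\<theta> \<noteq> 0" "\<theta> \<noteq> pi" by auto
  then show ?case using elim by (intro sin_gt_zero) auto
qed

text \<open>
  The preimage of a null set under \<open>cos\<close> is null: apply the substitution to its indicator function
  and use that \<open>sin \<theta>\<close> is positive almost everywhere.
\<close>
lemma AE_cos_substitution:
  assumes P: "AE x in lebesgue_on {-1..1}. P x"
  shows "AE \<theta> in angles. P (cos \<theta>)"
proof -
  obtain N where N: "N \<in> null_sets (lebesgue_on {-1..1})" "{x \<in> {-1..1}. \<not> P x} \<subseteq> N"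
    using P by (auto elim!: AE_E simp: null_sets_def)
  have "N \<in> sets (lebesgue_on {-1..1})" "emeasure (lebesgue_on {-1..1}) N = 0" using N by auto
  then have i: "integrable (lebesgue_on {-1..1}) (indicator N :: real \<Rightarrow> real)"
    by (intro integrable_real_indicator) auto
  have "(LINT x|lebesgue_on {-1..1}. indicator N x) = (0::real)"
    using N sets.Int_space_eq2[of N "lebesgue_on {-1..1}"] by (auto simp: measure_def null_sets_def)
  then have "(LINT \<theta>|angles. indicator N (cos \<theta>) * sin \<theta>) = (0::real)"
    using integral_cos_substitution(2)[OF i] by simp
  then have "AE \<theta> in angles. indicator N (cos \<theta>) * sin \<theta> = (0::real)"
    using integral_cos_substitution(1)[OF i]
    by (subst (asm) integral_nonneg_eq_0_iff_AE) (auto intro!: AE_I2 mult_nonneg_nonneg sin_ge_zero)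
  then show ?thesis
    using AE_angles_sin_pos AE_space
  proof eventually_elim
    case (elim \<theta>)
    then have "cos \<theta> \<notin> N" by (auto simp: indicator_def)
    moreover have "cos \<theta> \<in> {-1..1}" by simp
    ultimately show ?case using N(2) by blast
  qed
qed

section \<open>Asymptotic moments of nearly extremal polynomials\<close>

text \<open>
  The factor is \<open>\<bar>1 + a e\<^sup>i\<^sup>\<theta>\<bar>\<^sup>2\<close> when \<open>c = cos \<theta>\<close>.
\<close>
lemma quadratic_factor_bounds:
  fixes a c :: real
  assumes "\<bar>a\<bar> < 1" "\<bar>c\<bar> \<le> 1"
  shows "(1 - \<bar>a\<bar>)\<^sup>2 \<le> 1 + a\<^sup>2 + 2 * a * c" "0 < 1 + a\<^sup>2 + 2 * a * c"
proof -
  have "\<bar>a * c\<bar> \<le> \<bar>a\<bar> * 1" unfolding abs_mult using assms by (intro mult_left_mono) auto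
  then show *: "(1 - \<bar>a\<bar>)\<^sup>2 \<le> 1 + a\<^sup>2 + 2 * a * c" by (simp add: power2_diff)
  have "0 < (1 - \<bar>a\<bar>)\<^sup>2" using assms by simp
  with * show "0 < 1 + a\<^sup>2 + 2 * a * c" by linarith
qed

lemma log_kernel_of_real:
  assumes "\<bar>a\<bar> < 1"
  shows "log_kernel (of_real (- a)) \<theta> = ln (1 + a\<^sup>2 + 2 * a * cos \<theta>)"
proof -
  have "1 + (complex_of_real (- a))\<^sup>2 - 2 * of_real (- a) * of_real (cos \<theta>) = of_real (1 + a\<^sup>2 + 2 * a * cos \<theta>)"
    by simp
  then show ?thesis
    unfolding log_kernel_def using quadratic_factor_bounds(2)[OF assms, of "cos \<theta>"]
    by (simp only: norm_of_real) simp
qed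

lemma integral_weighted_sum_log_kernel:
  fixes z :: "'i \<Rightarrow> complex" and c :: "'i \<Rightarrow> real"
  assumes "\<And>i. i \<in> I \<Longrightarrow> cmod (z i) \<le> 1"
  shows "integrable angles (\<lambda>\<theta>. \<Sum>i\<in>I. c i * log_kernel (z i) \<theta>)"
    and "(LINT \<theta>|angles. (\<Sum>i\<in>I. c i * log_kernel (z i) \<theta>) * cos (real m * \<theta>)) =
           - (pi / real m) * (\<Sum>i\<in>I. c i * Re (z i ^ m))"
proof -
  show "integrable angles (\<lambda>\<theta>. \<Sum>i\<in>I. c i * log_kernel (z i) \<theta>)"
    using assms by (intro Bochner_Integration.integrable_sum integrable_mult_right integrable_log_kernel)
  have i: "integrable angles (\<lambda>\<theta>. log_kernel (z i) \<theta> * cos (real m * \<theta>))" if "i \<in> I" for i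
  proof (rule Bochner_Integration.integrable_bound[OF integrable_log_kernel[OF assms[OF that]]])
    show "(\<lambda>\<theta>. log_kernel (z i) \<theta> * cos (real m * \<theta>)) \<in> borel_measurable angles"
      by (intro borel_measurable_angles) measurable
    show "AE \<theta> in angles. norm (log_kernel (z i) \<theta> * cos (real m * \<theta>)) \<le> norm (log_kernel (z i) \<theta>)"
      by (intro AE_I2) (simp add: abs_mult mult_left_le)
  qed
  have "(LINT \<theta>|angles. (\<Sum>i\<in>I. c i * log_kernel (z i) \<theta>) * cos (real m * \<theta>)) =
      (LINT \<theta>|angles. (\<Sum>i\<in>I. c i * (log_kernel (z i) \<theta> * cos (real m * \<theta>))))"
    by (simp add: sum_distrib_right mult.assoc)
  also have "\<dots> = (\<Sum>i\<in>I. c i * (LINT \<theta>|angles. log_kernel (z i) \<theta> * cos (real m * \<theta>)))"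
    using i by (subst Bochner_Integration.integral_sum) auto
  also have "\<dots> = (\<Sum>i\<in>I. c i * - (pi * Re (z i ^ m) / real m))"
    using assms by (intro sum.cong refl arg_cong2[of _ _ _ _ times] integral_log_kernel_cos)
  also have "\<dots> = - (pi / real m) * (\<Sum>i\<in>I. c i * Re (z i ^ m))"
    by (simp add: sum_distrib_left algebra_simps)
  finally show "(LINT \<theta>|angles. (\<Sum>i\<in>I. c i * log_kernel (z i) \<theta>) * cos (real m * \<theta>)) =
           - (pi / real m) * (\<Sum>i\<in>I. c i * Re (z i ^ m))" .
qed

lemma weighted_sum_log_kernel_uniformly_integrable:
  fixes z :: "'i \<Rightarrow> complex" and c :: "'i \<Rightarrow> real"
  assumes z: "\<And>i. i \<in> I \<Longrightarrow> cmod (z i) \<le> 1" and E: "E \<in> sets angles" and a: "0 < a"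
  shows "(LINT \<theta>|angles. indicator E \<theta> * \<bar>\<Sum>i\<in>I. c i * log_kernel (z i) \<theta>\<bar>)
           \<le> (\<Sum>i\<in>I. \<bar>c i\<bar>) * (a * log_kernel_const + measure angles E / a)"
proof -
  have iE: "integrable angles (\<lambda>\<theta>. indicator E \<theta> * \<bar>f \<theta>\<bar>)" if "integrable angles f" for f :: "real \<Rightarrow> real"
    using integrable_real_mult_indicator[OF E integrable_abs[OF that]] by (simp add: mult.commute)
  note i1 = iE[OF integrable_log_kernel[OF z]]
  have "(LINT \<theta>|angles. indicator E \<theta> * \<bar>\<Sum>i\<in>I. c i * log_kernel (z i) \<theta>\<bar>) \<le>
      (LINT \<theta>|angles. (\<Sum>i\<in>I. \<bar>c i\<bar> * (indicator E \<theta> * \<bar>log_kernel (z i) \<theta>\<bar>)))"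
  proof (rule integral_mono)
    show "integrable angles (\<lambda>\<theta>. indicator E \<theta> * \<bar>\<Sum>i\<in>I. c i * log_kernel (z i) \<theta>\<bar>)"
      by (intro iE integral_weighted_sum_log_kernel z)
    show "integrable angles (\<lambda>\<theta>. \<Sum>i\<in>I. \<bar>c i\<bar> * (indicator E \<theta> * \<bar>log_kernel (z i) \<theta>\<bar>))"
      by (intro Bochner_Integration.integrable_sum integrable_mult_right i1)
    show "indicator E \<theta> * \<bar>\<Sum>i\<in>I. c i * log_kernel (z i) \<theta>\<bar> \<le>
        (\<Sum>i\<in>I. \<bar>c i\<bar> * (indicator E \<theta> * \<bar>log_kernel (z i) \<theta>\<bar>))" for \<theta>
      using sum_abs[of "\<lambda>i. c i * log_kernel (z i) \<theta>" I] by (simp add: indicator_def abs_mult)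
  qed
  also have "\<dots> = (\<Sum>i\<in>I. \<bar>c i\<bar> * (LINT \<theta>|angles. indicator E \<theta> * \<bar>log_kernel (z i) \<theta>\<bar>))"
    by (subst Bochner_Integration.integral_sum) (auto intro!: integrable_mult_right i1)
  also have "\<dots> \<le> (\<Sum>i\<in>I. \<bar>c i\<bar> * (a * log_kernel_const + measure angles E / a))"
    by (intro sum_mono mult_left_mono log_kernel_uniformly_integrable z E a) auto
  finally show ?thesis by (simp add: sum_distrib_right)
qed

lemma log_kernel_const_nonneg: "0 \<le> log_kernel_const"
proof -
  have "0 \<le> (LINT \<theta>|angles. (log_kernel 0 \<theta>)\<^sup>2)" by (intro Bochner_Integration.integral_nonneg) auto
  also have "\<dots> \<le> log_kernel_const" by (rule integral_log_kernel_sq) simp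
  finally show ?thesis .
qed

lemma integrable_continuous_mult_weight:
  fixes w :: "real \<Rightarrow> real"
  assumes w: "integrable (lebesgue_on {-1..1}) w" and f: "continuous_on {-1..1} f"
  shows "integrable (lebesgue_on {-1..1}) (\<lambda>y. f y * w y)"
proof -
  have "bounded (f ` {-1..1})" using f by (intro compact_imp_bounded compact_continuous_image) auto
  then obtain C where C: "\<And>y. y \<in> {-1..1} \<Longrightarrow> \<bar>f y\<bar> \<le> C" unfolding bounded_iff by force
  show ?thesis
  proof (rule Bochner_Integration.integrable_bound[OF integrable_mult_right[OF w, of C]])
    show "(\<lambda>y. f y * w y) \<in> borel_measurable (lebesgue_on {-1..1})"
      using w
      by (intro borel_measurable_times[OF continuous_imp_measurable_on_sets_lebesgue[OF f]]) auto
    show "AE y in lebesgue_on {-1..1}. norm (f y * w y) \<le> norm (C * w y)"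
      using C by (intro AE_I2) (force simp: abs_mult intro!: mult_right_mono)
  qed
qed

lemma continuous_on_inverse_factors:
  assumes "finite K" "\<And>k. k \<in> K \<Longrightarrow> \<bar>a k\<bar> < 1" "continuous_on {-1..1} f"
  shows "continuous_on {-1..1} (\<lambda>y::real. f y / (\<Prod>k\<in>K. 1 + (a k)\<^sup>2 + 2 * a k * y) :: real)"
proof (intro continuous_intros ballI assms)
  fix y :: real assume "y \<in> {-1..1}"
  then have "1 + (a k)\<^sup>2 + 2 * a k * y \<noteq> 0" if "k \<in> K" for k
    using quadratic_factor_bounds(2)[OF assms(2)[OF that], of y] by (auto simp: abs_le_iff)
  then show "(\<Prod>k\<in>K. 1 + (a k)\<^sup>2 + 2 * a k * y) \<noteq> 0" using assms by auto
qed

text \<open>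
  The points \<open>x n j\<close> are the zeros of the \<open>n\<close>-th polynomial and \<open>a n k\<close> the parameters of its
  denominator. The logarithm of the quotient is a combination of kernels of mean \<open>0\<close>; the
  bound on its weighted integral forces its mean modulus to be \<open>o(n)\<close>, and its cosine coefficients
  are the asserted differences of moments.
\<close>
lemma moments_of_near_extremal_polynomials:
  fixes w :: "real \<Rightarrow> real" and x :: "nat \<Rightarrow> nat \<Rightarrow> real"
    and K :: "nat \<Rightarrow> 'k set" and a :: "nat \<Rightarrow> 'k \<Rightarrow> real"
  assumes w_integrable: "integrable (lebesgue_on {-1..1}) w"
    and w_pos: "AE x in lebesgue_on {-1..1}. 0 < w x"
    and x: "\<And>n j. j \<in> {1..n} \<Longrightarrow> x n j \<in> {-1..1}"
    and K: "\<And>n. finite (K n)" "\<And>n. card (K n) \<le> 2 * n + 1"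
    and a: "\<And>n k. k \<in> K n \<Longrightarrow> \<bar>a n k\<bar> < 1"
    and bound: "\<forall>\<^sub>F n in sequentially.
      (LINT y|lebesgue_on {-1..1}. (\<Prod>j=1..n. 2 * y - 2 * x n j)\<^sup>2 /
         (\<Prod>k\<in>K n. 1 + (a n k)\<^sup>2 + 2 * a n k * y) * w y) \<le> B"
    and m: "0 < m"
  shows "(\<lambda>n. ((\<Sum>j=1..n. cos (real m * arccos (x n j))) - (\<Sum>k\<in>K n. (- a n k) ^ m) / 2) / real n)
           \<longlonglongrightarrow> 0"
proof -
  (* zeros enter with weight 2 because the polynomial is squared, denominator factors with weight -1 *)
  define z where "z n i = (case i of Inl j \<Rightarrow> cis (arccos (x n j)) | Inr k \<Rightarrow> of_real (- a n k))"
    for n and i :: "nat + 'k"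
  define c where "c i = (case i of Inl _ \<Rightarrow> (2 :: real) | Inr _ \<Rightarrow> - 1)" for i :: "nat + 'k"
  define I where "I n = {1..n} <+> K n" for n
  define U where "U n \<theta> = (\<Sum>i\<in>I n. c i * log_kernel (z n i) \<theta>)" for n \<theta>
  have z: "cmod (z n i) \<le> 1" if "i \<in> I n" for n i
    using that a[of _ n] by (auto simp: I_def z_def intro: less_imp_le)
  have sumI: "(\<Sum>i\<in>I n. f i) = (\<Sum>j=1..n. f (Inl j)) + (\<Sum>k\<in>K n. f (Inr k))" for f :: "nat + 'k \<Rightarrow> real" and n
    unfolding I_def using K by (simp add: sum.Plus)
  define R where "R n y = (\<Prod>j=1..n. 2 * y - 2 * x n j)\<^sup>2 / (\<Prod>k\<in>K n. 1 + (a n k)\<^sup>2 + 2 * a n k * y)" for n y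
  have expU: "AE \<theta> in angles. exp (U n \<theta>) = R n (cos \<theta>)" for n
  proof -
    have "AE \<theta> in angles. \<forall>j\<in>{1..n}. cos \<theta> \<noteq> x n j"
      by (intro AE_finite_allI AE_angles_cos_neq) simp
    then show ?thesis
    proof eventually_elim
      case (elim \<theta>)
      have 1: "exp (2 * log_kernel (cis (arccos (x n j))) \<theta>) = (2 * cos \<theta> - 2 * x n j)\<^sup>2" if "j \<in> {1..n}" for j
      proof -
        have "cos \<theta> \<noteq> x n j" using elim that by blast
        then have "exp (log_kernel (cis (arccos (x n j))) \<theta>) = \<bar>2 * x n j - 2 * cos \<theta>\<bar>"
          unfolding log_kernel_unit using x[OF that] by (subst exp_ln) auto
        then show ?thesis unfolding exp_double by (simp add: power2_commute)
      qed
      have 2: "exp (log_kernel (of_real (- a n k)) \<theta>) = 1 + (a n k)\<^sup>2 + 2 * a n k * cos \<theta>" if "k \<in> K n" for k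
        unfolding log_kernel_of_real[OF a[OF that]]
        using quadratic_factor_bounds(2)[OF a[OF that], of "cos \<theta>"] by simp
      have "U n \<theta> = (\<Sum>j=1..n. 2 * log_kernel (cis (arccos (x n j))) \<theta>) - (\<Sum>k\<in>K n. log_kernel (of_real (- a n k)) \<theta>)"
        unfolding U_def sumI by (simp add: z_def c_def sum_negf)
      then have "exp (U n \<theta>) = (\<Prod>j=1..n. exp (2 * log_kernel (cis (arccos (x n j))) \<theta>)) /
          (\<Prod>k\<in>K n. exp (log_kernel (of_real (- a n k)) \<theta>))"
        using K by (simp only: exp_diff exp_sum finite_atLeastAtMost)
      also have "\<dots> = R n (cos \<theta>)"
        unfolding R_def prod_power_distrib by (intro arg_cong2[of _ _ _ _ divide] prod.cong refl 1 2)
      finally show ?case .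
    qed
  qed
  have intR: "integrable (lebesgue_on {-1..1}) (\<lambda>y. R n y * w y)" for n
    unfolding R_def
    by (intro integrable_continuous_mult_weight w_integrable continuous_on_inverse_factors K a
        continuous_intros)
  have "(\<lambda>n. (LINT \<theta>|angles. \<bar>U n \<theta>\<bar>) / real n) \<longlonglongrightarrow> 0"
  proof (rule angles.mean_abs_tendsto_0[where g = "\<lambda>\<theta>. w (cos \<theta>) * sin \<theta>"])
    show "integrable angles (U n)" for n
      unfolding U_def[abs_def] by (intro integral_weighted_sum_log_kernel z)
    show "(LINT \<theta>|angles. U n \<theta>) = 0" for n
      using integral_weighted_sum_log_kernel(2)[of "I n" "z n" c 0] z unfolding U_def by simp
    show "(\<lambda>\<theta>. w (cos \<theta>) * sin \<theta>) \<in> borel_measurable angles"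
      using integral_cos_substitution(1)[OF w_integrable] by simp
    show "AE \<theta> in angles. 0 < w (cos \<theta>) * sin \<theta>"
      using AE_cos_substitution[OF w_pos] AE_angles_sin_pos by eventually_elim simp
    have meas: "(\<lambda>\<theta>. exp (U n \<theta>) * (w (cos \<theta>) * sin \<theta>)) \<in> borel_measurable angles" for n
    proof (rule borel_measurable_times)
      show "(\<lambda>\<theta>. exp (U n \<theta>)) \<in> borel_measurable angles"
        unfolding U_def by (intro borel_measurable_angles) measurable
      show "(\<lambda>\<theta>. w (cos \<theta>)* sin \<theta>) \<in> borel_measurable angles"
        using integral_cos_substitution(1)[OF w_integrable] by simp
    qed
    have ae: "AE \<theta> in angles. R n (cos \<theta>) * w (cos \<theta>) * sin \<theta> = exp (U n \<theta>) * (w (cos \<theta>) * sin \<theta>)" for n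
      using expU[of n] by eventually_elim simp
    note sub = integral_cos_substitution[OF intR]
    show "\<forall>\<^sub>F n in sequentially. integrable angles (\<lambda>\<theta>. exp (U n \<theta>) * (w (cos \<theta>) * sin \<theta>))"
      by (intro always_eventually allI integrable_cong_AE_imp[OF sub(1) meas ae])
    have "(LINT \<theta>|angles. exp (U n \<theta>) * (w (cos \<theta>) * sin \<theta>)) = (LINT y|lebesgue_on {-1..1}. R n y * w y)" for n
      unfolding sub(2)[symmetric] using ae[of n] meas[of n] sub(1)[of n]
      by (intro integral_cong_AE) (auto elim: eventually_mono)
    then show "\<forall>\<^sub>F n in sequentially. (LINT \<theta>|angles. exp (U n \<theta>) * (w (cos \<theta>) * sin \<theta>)) \<le> B"
      using bound unfolding R_def by simp
    fix e :: real assume e: "0 < e"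
    define C where "C = log_kernel_const + 1"
    have C: "0 < C" "log_kernel_const \<le> C" using log_kernel_const_nonneg by (auto simp: C_def)
    (* at most 5 n kernels, counted with weights, each contributing at most e / 10 + e / 10 *)
    define b where "b = e / (10 * C)"
    have b: "0 < b" using e C by (simp add: b_def)
    have "(LINT \<theta>|angles. indicator E \<theta> * \<bar>U n \<theta>\<bar>) \<le> e * real n"
      if n: "0 < n" and E: "E \<in> sets angles" "measure angles E < b * e / 10" for n E
    proof -
      have "(LINT \<theta>|angles. indicator E \<theta> * \<bar>U n \<theta>\<bar>) \<le>
          (\<Sum>i\<in>I n. \<bar>c i\<bar>) * (b * log_kernel_const + measure angles E / b)"
        unfolding U_def by (intro weighted_sum_log_kernel_uniformly_integrable z E b)
      also have "\<dots> \<le> (5 * real n) * (e / 10 + e / 10)"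
      proof (intro mult_mono add_mono)
        have "(\<Sum>i\<in>I n. \<bar>c i\<bar>) = 2 * real n + real (card (K n))" unfolding sumI by (simp add: c_def)
        also have "real (card (K n)) \<le> real (2 * n + 1)" using K(2) by (intro of_nat_mono)
        finally show "(\<Sum>i\<in>I n. \<bar>c i\<bar>) \<le> 5 * real n" using n by simp
        have "b * log_kernel_const \<le> b * C" using b C by simp
        then show "b * log_kernel_const \<le> e / 10" using C by (simp add: b_def)
        show "measure angles E / b \<le> e / 10" using E b by (simp add: divide_simps mult.commute)
        show "0 \<le> b * log_kernel_const + measure angles E / b"
          using b log_kernel_const_nonneg by (intro add_nonneg_nonneg mult_nonneg_nonneg divide_nonneg_nonneg) auto
      qed simp
      finally show ?thesis by (simp add: mult.commute)
    qed
    then show "\<exists>d>0. \<forall>n>0. \<forall>E\<in>sets angles. measure angles E < d \<longrightarrow>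
        (LINT \<theta>|angles. indicator E \<theta> * \<bar>U n \<theta>\<bar>) \<le> e * real n"
      using b e by (intro exI[of _ "b * e / 10"]) auto
  qed
  then have "(\<lambda>n. real m / (2 * pi) * ((LINT \<theta>|angles. \<bar>U n \<theta>\<bar>) / real n)) \<longlonglongrightarrow> real m / (2 * pi) * 0"
    by (intro tendsto_mult_left)
  then have lim: "(\<lambda>n. real m / (2 * pi) * ((LINT \<theta>|angles. \<bar>U n \<theta>\<bar>) / real n)) \<longlonglongrightarrow> 0" by simp
  show ?thesis
  proof (rule Lim_null_comparison[OF always_eventually[OF allI] lim])
    fix n
    define S where "S = (\<Sum>j=1..n. cos (real m * arccos (x n j))) - (\<Sum>k\<in>K n. (- a n k) ^ m) / 2"
    have re: "Re (complex_of_real (- b) ^ m) = (- b) ^ m" for b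
      unfolding of_real_power[symmetric] by simp
    have "(LINT \<theta>|angles. U n \<theta> * cos (real m * \<theta>)) = - (pi / real m) * (2 * S)"
      unfolding U_def
      by (subst integral_weighted_sum_log_kernel(2), use z in blast, unfold sumI)
        (simp add: z_def c_def S_def re Complex.DeMoivre sum_negf right_diff_distrib del: of_real_minus
          flip: sum_distrib_left)
    moreover have "\<bar>LINT \<theta>|angles. U n \<theta> * cos (real m * \<theta>)\<bar> \<le> (LINT \<theta>|angles. \<bar>U n \<theta>\<bar>)"
    proof -
      have iU: "integrable angles (U n)"
        unfolding U_def[abs_def] by (intro integral_weighted_sum_log_kernel z)
      have le: "\<bar>U n \<theta> * cos (real m * \<theta>)\<bar> \<le> \<bar>U n \<theta>\<bar>" for \<theta>
        by (simp add: abs_mult mult_left_le)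
      have iC: "integrable angles (\<lambda>\<theta>. U n \<theta> * cos (real m * \<theta>))"
      proof (rule Bochner_Integration.integrable_bound[OF iU])
        show "(\<lambda>\<theta>. U n \<theta> * cos (real m * \<theta>)) \<in> borel_measurable angles"
          unfolding U_def by (intro borel_measurable_angles) measurable
      qed (use le in auto)
      have "\<bar>LINT \<theta>|angles. U n \<theta> * cos (real m * \<theta>)\<bar> \<le> (LINT \<theta>|angles. \<bar>U n \<theta> * cos (real m * \<theta>)\<bar>)"
        by (rule integral_abs_bound)
      also have "\<dots> \<le> (LINT \<theta>|angles. \<bar>U n \<theta>\<bar>)"
        by (intro integral_mono integrable_abs iC iU le)
      finally show ?thesis .
    qed
    ultimately have "pi / real m * (2 * \<bar>S\<bar>) \<le> (LINT \<theta>|angles. \<bar>U n \<theta>\<bar>)"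
      by (simp add: abs_mult)
    then have "\<bar>S\<bar> \<le> real m / (2 * pi) * (LINT \<theta>|angles. \<bar>U n \<theta>\<bar>)"
      using m by (simp add: field_simps)
    then have "\<bar>S\<bar> / real n \<le> real m / (2 * pi) * (LINT \<theta>|angles. \<bar>U n \<theta>\<bar>) / real n"
      by (intro divide_right_mono) auto
    then show "norm (((\<Sum>j=1..n. cos (real m * arccos (x n j))) - (\<Sum>k\<in>K n. (- a n k) ^ m) / 2) / real n)
        \<le> real m / (2 * pi) * ((LINT \<theta>|angles. \<bar>U n \<theta>\<bar>) / real n)"
      unfolding S_def by simp
  qed
qed

section \<open>Chebyshev polynomials and a uniform norm bound\<close>

fun chebyshev :: "nat \<Rightarrow> real poly" where
  "chebyshev 0 = 1"
| "chebyshev (Suc 0) = [:0, 1:]"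
| "chebyshev (Suc (Suc n)) = [:0, 2:] * chebyshev (Suc n) - chebyshev n"

lemma poly_chebyshev_cos: "poly (chebyshev n) (cos \<theta>) = cos (real n * \<theta>)"
proof (induction n rule: chebyshev.induct)
  case (3 n)
  have "cos (real (Suc (Suc n)) * \<theta>) + cos (real n * \<theta>) = 2 * cos \<theta> * cos (real (Suc n) * \<theta>)"
    using cos_plus_cos[of "real (Suc (Suc n)) * \<theta>" "real n * \<theta>"] by (simp add: algebra_simps add_divide_distrib)
  then show ?case using 3 by simp
qed auto

lemma degree_chebyshev: "degree (chebyshev n) \<le> n"
proof (induction n rule: chebyshev.induct)
  case (3 n)
  have "degree ([:0, 2:] * chebyshev (Suc n)) \<le> Suc (Suc n)"
    using degree_mult_le[of "[:0, 2:]" "chebyshev (Suc n)"] 3 by simp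
  then show ?case using 3 by (auto intro!: degree_diff_le)
qed auto

lemma lead_coeff_chebyshev: "coeff (chebyshev (Suc n)) (Suc n) = 2 ^ n"
proof (induction n)
  case (Suc n)
  have "coeff (chebyshev n) (Suc (Suc n)) = 0"
    by (intro coeff_eq_0) (use degree_chebyshev[of n] in simp)
  then show ?case using Suc by simp
qed simp

text \<open>
  With \<open>D(z) = \<Prod>(1 + a\<^sub>k z)\<close> of degree \<open>2n\<close>, the function \<open>2 Re (e\<^sup>-\<^sup>i\<^sup>n\<^sup>\<theta> D(e\<^sup>i\<^sup>\<theta>))\<close> is at most
  \<open>2 \<bar>D\<bar>\<close>. Expanding \<open>D\<close> over subsets \<open>A\<close> of \<open>K\<close> writes it as a combination of
  \<open>cos ((card A - n) \<theta>)\<close>, hence as a polynomial in \<open>cos \<theta>\<close>; only \<open>A = {}\<close> and \<open>A = K\<close>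
  contribute to the coefficient of degree \<open>n\<close>.
\<close>
lemma extremal_polynomial_exists:
  fixes a :: "'k \<Rightarrow> real"
  assumes K: "finite K" "card K = 2 * n" and n: "0 < n"
  shows "\<exists>Q. degree Q \<le> n \<and> coeff Q n = 2 ^ n * (1 + (\<Prod>k\<in>K. a k)) \<and>
           (\<forall>y\<in>{-1..1}. (poly Q y)\<^sup>2 \<le> 4 * (\<Prod>k\<in>K. 1 + (a k)\<^sup>2 + 2 * a k * y))"
proof -
  (* the degree of the Chebyshev polynomial that belongs to A, the modulus of card A - n *)
  define l where "l A = (if card A \<le> n then n - card A else card A - n)" for A :: "'k set"
  define Q where "Q = (\<Sum>A\<in>Pow K. smult (2 * (\<Prod>k\<in>A. a k)) (chebyshev (l A)))"
  have cA: "card A \<le> 2 * n" if "A \<subseteq> K" for A using card_mono[OF K(1) that] K(2) by simp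
  have l: "l A \<le> n" if "A \<subseteq> K" for A using cA[OF that] by (cases "card A \<le> n") (simp_all add: l_def)
  have l_less: "l A < n" if "A \<subseteq> K" "A \<noteq> {}" "A \<noteq> K" for A
  proof -
    have "finite A" using that(1) K(1) by (rule finite_subset)
    then have "card A \<noteq> 0" using that(2) by simp
    moreover have "card A < 2 * n" using psubset_card_mono[of K A] K that by auto
    ultimately show ?thesis by (auto simp: l_def)
  qed
  have deg: "degree Q \<le> n"
    unfolding Q_def
    by (intro degree_sum_le)
      (use K l degree_chebyshev in \<open>auto intro!: order_trans[OF degree_smult_le] intro: order_trans\<close>)
  have ne: "{} \<noteq> K" using K n by auto
  obtain n' where n': "n = Suc n'" using n by (cases n) auto
  have "coeff Q n = (\<Sum>A\<in>Pow K. 2 * (\<Prod>k\<in>A. a k) * coeff (chebyshev (l A)) n)"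
    unfolding Q_def by (simp add: coeff_sum)
  also have "\<dots> = (\<Sum>A\<in>{{}, K}. 2 * (\<Prod>k\<in>A. a k) * coeff (chebyshev (l A)) n)"
  proof (rule sum.mono_neutral_right)
    show "\<forall>A\<in>Pow K - {{}, K}. 2 * (\<Prod>k\<in>A. a k) * coeff (chebyshev (l A)) n = 0"
      using l_less degree_chebyshev by (auto intro!: coeff_eq_0 intro: le_less_trans)
  qed (use K in auto)
  also have "\<dots> = 2 ^ n * (1 + (\<Prod>k\<in>K. a k))"
    using ne K n' lead_coeff_chebyshev[of n'] by (simp add: l_def algebra_simps)
  finally have co: "coeff Q n = 2 ^ n * (1 + (\<Prod>k\<in>K. a k))" .
  have "(poly Q y)\<^sup>2 \<le> 4 * (\<Prod>k\<in>K. 1 + (a k)\<^sup>2 + 2 * a k * y)" if y: "y \<in> {-1..1}" for y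
  proof -
    define \<theta> where "\<theta> = arccos y"
    have y_cos: "y = cos \<theta>" using y by (simp add: \<theta>_def)
    define D where "D = (\<Prod>k\<in>K. of_real (a k) * cis \<theta> + 1)"
    have D: "D = (\<Sum>A\<in>Pow K. of_real (\<Prod>k\<in>A. a k) * cis \<theta> ^ card A)"
      unfolding D_def prod_add[OF K(1)] by (simp add: prod.distrib)
    have "poly Q y = (\<Sum>A\<in>Pow K. 2 * (\<Prod>k\<in>A. a k) * cos (real (l A) * \<theta>))"
      unfolding Q_def y_cos by (simp add: poly_sum poly_chebyshev_cos)
    also have "\<dots> = (\<Sum>A\<in>Pow K. 2 * Re (of_real (\<Prod>k\<in>A. a k) * (cis (- (real n * \<theta>)) * cis \<theta> ^ card A)))"
    proof (rule sum.cong[OF refl])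
      fix A :: "'k set"
      have re: "Re (complex_of_real r * u) = r * Re u" for r u by simp
      have "Re (cis (- (real n * \<theta>)) * cis \<theta> ^ card A) = cos ((real (card A) - real n) * \<theta>)"
        unfolding Complex.DeMoivre cis_mult by (simp add: algebra_simps)
      also have "\<dots> = cos (real (l A) * \<theta>)"
      proof (cases "card A \<le> n")
        case True
        have "(real (card A) - real n) * \<theta> = - ((real n - real (card A)) * \<theta>)" by (simp add: algebra_simps)
        then show ?thesis using True unfolding l_def by (simp only: cos_minus of_nat_diff if_True)
      qed (simp add: l_def of_nat_diff)
      finally show "2 * (\<Prod>k\<in>A. a k) * cos (real (l A) * \<theta>) =
          2 * Re (of_real (\<Prod>k\<in>A. a k) * (cis (- (real n * \<theta>)) * cis \<theta> ^ card A))"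
        by (simp only: re mult.assoc)
    qed
    also have "\<dots> = 2 * Re (cis (- (real n * \<theta>)) * D)"
      unfolding D by (simp only: sum_distrib_left Re_sum mult.left_commute)
    finally have "\<bar>poly Q y\<bar> \<le> 2 * cmod D"
      using abs_Re_le_cmod[of "cis (- (real n * \<theta>)) * D"] by (simp add: norm_mult del: times_complex.sel)
    then have "(poly Q y)\<^sup>2 \<le> (2 * cmod D)\<^sup>2" by (subst abs_le_square_iff[symmetric]) simp
    also have "\<dots> = 4 * (\<Prod>k\<in>K. (cmod (of_real (a k) * cis \<theta> + 1))\<^sup>2)"
      unfolding D_def by (simp add: power_mult_distrib prod_norm[symmetric] prod_power_distrib)
    also have "(\<Prod>k\<in>K. (cmod (of_real (a k) * cis \<theta> + 1))\<^sup>2) = (\<Prod>k\<in>K. 1 + (a k)\<^sup>2 + 2 * a k * y)"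
    proof (rule prod.cong[OF refl])
      fix k
      have "(cmod (of_real (a k) * cis \<theta> + 1))\<^sup>2 = (a k * cos \<theta> + 1)\<^sup>2 + (a k * sin \<theta>)\<^sup>2"
        by (simp add: cmod_power2)
      also have "\<dots> = (a k)\<^sup>2 * ((sin \<theta>)\<^sup>2 + (cos \<theta>)\<^sup>2) + 2 * a k * cos \<theta> + 1"
        by (simp only: power2_eq_square) algebra
      finally show "(cmod (of_real (a k) * cis \<theta> + 1))\<^sup>2 = 1 + (a k)\<^sup>2 + 2 * a k * y"
        unfolding sin_cos_squared_add y_cos by simp
    qed
    finally show ?thesis .
  qed
  with deg co show ?thesis by blast
qed

text \<open>
  Normalised so that it is the product of the factors \<open>2 (y - x\<^sub>j)\<close> whose logarithms are the
  kernels of unit modulus.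
\<close>
definition nodal_poly :: "nat \<Rightarrow> (nat \<Rightarrow> real) \<Rightarrow> real poly" where
  "nodal_poly n x = (\<Prod>j=1..n. [:- 2 * x j, 2:])"

lemma poly_nodal_poly: "poly (nodal_poly n x) y = (\<Prod>j=1..n. 2 * y - 2 * x j)"
  unfolding nodal_poly_def by (simp add: poly_prod algebra_simps)

lemma degree_nodal_poly: "degree (nodal_poly n x) = n"
  unfolding nodal_poly_def by (subst degree_prod_eq_sum_degree) auto

lemma lead_coeff_nodal_poly: "coeff (nodal_poly n x) n = 2 ^ n"
  using lead_coeff_prod[of "\<lambda>j. [:- 2 * x j, 2:]" "{1..n}"]
  unfolding degree_nodal_poly[unfolded nodal_poly_def] nodal_poly_def by simp

lemma nodal_poly_root: "j \<in> {1..n} \<Longrightarrow> poly (nodal_poly n x) (x j) = 0"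
  unfolding poly_nodal_poly by (intro prod_zero) auto

text \<open>
  Orthogonality makes the nodal polynomial minimal among the polynomials with the same leading
  coefficient, so it is compared with the polynomial built from the parameters in \<open>K'\<close>. The parameter
  \<open>k0\<close> bounds the product of all parameters in \<open>K'\<close> by \<open>1 / 2\<close>, so that the leading coefficient can
  be normalised at the cost of a factor \<open>2\<close>. A factor of the denominator outside \<open>K'\<close> is harmless since it
  is at least \<open>1 / 4\<close>. The constant is \<open>64 = 4 \<sqdot> 2\<^sup>2 \<sqdot> 4\<close>.
\<close>
lemma orthogonal_norm_bound:
  fixes w :: "real \<Rightarrow> real" and a :: "'k \<Rightarrow> real"
  assumes w_integrable: "integrable (lebesgue_on {-1..1}) w"
    and w_pos: "AE x in lebesgue_on {-1..1}. 0 < w x"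
    and K: "finite K" and a: "\<And>k. k \<in> K \<Longrightarrow> \<bar>a k\<bar> < 1"
    and K': "K' \<subseteq> K" "card K' = 2 * n" "card (K - K') \<le> 1" 
      "\<And>k. k \<in> K - K' \<Longrightarrow> \<bar>a k\<bar> \<le> 1 / 2"
    and k0: "k0 \<in> K'" "\<bar>a k0\<bar> \<le> 1 / 2"
    and n: "0 < n"
    and orth: "\<And>q. degree q < n \<Longrightarrow>
      (LINT y|lebesgue_on {-1..1}. poly (nodal_poly n x * q) y /
         (\<Prod>k\<in>K. 1 + (a k)\<^sup>2 + 2 * a k * y) * w y) = 0"
  shows "(LINT y|lebesgue_on {-1..1}. (\<Prod>j=1..n. 2 * y - 2 * x j)\<^sup>2 /
         (\<Prod>k\<in>K. 1 + (a k)\<^sup>2 + 2 * a k * y) * w y) \<le> 64 * (LINT y|lebesgue_on {-1..1}. w y)"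
proof -
  define \<omega> where "\<omega> y = (\<Prod>k\<in>K. 1 + (a k)\<^sup>2 + 2 * a k * y)" for y
  define L where "L p = (LINT y|lebesgue_on {-1..1}. poly p y / \<omega> y * w y)" for p
  have int: "integrable (lebesgue_on {-1..1}) (\<lambda>y. poly p y / \<omega> y * w y)" for p
    unfolding \<omega>_def
    by (intro integrable_continuous_mult_weight w_integrable continuous_on_inverse_factors K a continuous_intros)
  have L_add: "L (p + q) = L p + L q" for p q
    unfolding L_def poly_add add_divide_distrib distrib_right
    by (rule Bochner_Integration.integral_add[OF int int])
  have L_diff: "L (p - q) = L p - L q" for p q
    using L_add[of "p - q" q] by simp
  have \<omega>_pos: "0 < \<omega> y" if "y \<in> {-1..1}" for y
    unfolding \<omega>_def using that quadratic_factor_bounds(2)[OF a, of _ y]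
    by (intro prod_pos) (auto simp: abs_le_iff)
  define P where "P = nodal_poly n x"
  define c where "c = 1 + (\<Prod>k\<in>K'. a k)"
  have K'fin: "finite K'" using K K' finite_subset by blast
  have "\<bar>\<Prod>k\<in>K'. a k\<bar> \<le> 1 / 2"
  proof -
    have "\<bar>\<Prod>k\<in>K'. a k\<bar> = \<bar>a k0\<bar> * (\<Prod>k\<in>K' - {k0}. \<bar>a k\<bar>)"
      using k0 K'fin by (simp add: prod.remove abs_mult abs_prod)
    also have "\<dots> \<le> 1 / 2 * 1"
      using k0 K' a by (intro mult_mono prod_le_1 prod_nonneg) (auto intro!: less_imp_le[OF a])
    finally show ?thesis by simp
  qed
  then have c: "1 / 2 \<le> c" unfolding c_def by linarith
  obtain Q where Q: "degree Q \<le> n" "coeff Q n = 2 ^ n * c"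
    "\<And>y. y \<in> {-1..1} \<Longrightarrow> (poly Q y)\<^sup>2 \<le> 4 * (\<Prod>k\<in>K'. 1 + (a k)\<^sup>2 + 2 * a k * y)"
    using extremal_polynomial_exists[OF K'fin K'(2) n, of a] unfolding c_def by blast
  define R where "R = smult (1 / c) Q"
  have R_bound: "(poly R y)\<^sup>2 / \<omega> y \<le> 64" if y: "y \<in> {-1..1}" for y
  proof -
    have y': "\<bar>y\<bar> \<le> 1" using y by (auto simp: abs_le_iff)
    have "1 / 4 \<le> (\<Prod>k\<in>K - K'. 1 + (a k)\<^sup>2 + 2 * a k * y)"
    proof -
      have f: "finite (K - K')" using K by simp
      have "1 / 4 \<le> 1 + (a k)\<^sup>2 + 2 * a k * y" if k: "k \<in> K - K'" for k
      proof -
        have "(1 / 2)\<^sup>2 \<le> (1 - \<bar>a k\<bar>)\<^sup>2" using K'(4)[OF k] by (intro power_mono) auto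
        also have "\<dots> \<le> 1 + (a k)\<^sup>2 + 2 * a k * y" using quadratic_factor_bounds(1)[OF a y'] k by auto
        finally show ?thesis by (simp add: power2_eq_square)
      qed
      moreover have "K - K' = {} \<or> (\<exists>k. K - K' = {k})"
        using K'(3) f by (metis card_1_singletonE card_0_eq le_less less_one)
      ultimately show ?thesis
      proof (elim disjE exE)
        fix k assume k: "K - K' = {k}" and *: "\<And>k. k \<in> K - K' \<Longrightarrow> 1 / 4 \<le> 1 + (a k)\<^sup>2 + 2 * a k * y"
        show ?thesis using *[of k] unfolding k by simp
      next
        assume "K - K' = {}"
        then show ?thesis by (simp only: prod.empty)
      qed
    qed
    moreover have p': "0 \<le> (\<Prod>k\<in>K'. 1 + (a k)\<^sup>2 + 2 * a k * y)"
      using quadratic_factor_bounds(2)[OF a y'] K' by (intro prod_nonneg) (auto intro: less_imp_le)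
    ultimately have "(\<Prod>k\<in>K'. 1 + (a k)\<^sup>2 + 2 * a k * y) * (1 / 4) \<le> \<omega> y"
      unfolding \<omega>_def prod.subset_diff[OF K'(1) K] by (subst mult.commute) (intro mult_right_mono)
    then have "(poly Q y)\<^sup>2 \<le> 16 * \<omega> y" using Q(3)[OF y] by linarith
    moreover have "(poly R y)\<^sup>2 = (1 / c)\<^sup>2 * (poly Q y)\<^sup>2" unfolding R_def by (simp add: power_mult_distrib power_divide)
    moreover have "(1 / c)\<^sup>2 \<le> 2\<^sup>2" using c by (intro power_mono) (auto simp: divide_simps)
    ultimately have "(poly R y)\<^sup>2 \<le> 2\<^sup>2 * (16 * \<omega> y)"
      by (simp only:) (intro mult_mono, auto)
    then show ?thesis using \<omega>_pos[OF y] by (simp add: divide_simps)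
  qed
  have "degree (P - R) < n"
  proof -
    have "degree R \<le> n" unfolding R_def using Q(1) degree_smult_le order_trans by blast
    then have "degree (P - R) \<le> n" unfolding P_def using degree_nodal_poly by (intro degree_diff_le) auto
    moreover have "coeff (P - R) n = 0"
      unfolding P_def R_def using c Q(2) by (simp add: lead_coeff_nodal_poly)
    ultimately have "P - R = 0 \<or> degree (P - R) < n" by (rule eq_zero_or_degree_less)
    then show ?thesis using n by auto
  qed
  then have "L (P * (P - R)) = 0" using orth unfolding L_def P_def \<omega>_def by blast
  then have PP: "L (P * P) = L (P * R)" unfolding right_diff_distrib L_diff by simp
  have "0 \<le> L ((P - R) * (P - R))"
    unfolding L_def
  proof (rule integral_nonneg_AE)
    show "AE y in lebesgue_on {-1..1}. 0 \<le> poly ((P - R) * (P - R)) y / \<omega> y * w y"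
      using w_pos AE_space
    proof eventually_elim
      case (elim y)
      then show ?case unfolding poly_mult using \<omega>_pos[of y]
        by (intro mult_nonneg_nonneg divide_nonneg_nonneg zero_le_square) auto
    qed
  qed
  also have "(P - R) * (P - R) = P * P - P * R - (P * R - R * R)" by (simp add: algebra_simps)
  finally have "L (P * P) \<le> L (R * R)" unfolding L_diff PP by simp
  also have "\<dots> \<le> (LINT y|lebesgue_on {-1..1}. 64 * w y)"
    unfolding L_def
  proof (rule integral_mono_AE[OF int])
    show "integrable (lebesgue_on {-1..1}) (\<lambda>y. 64 * w y)" using w_integrable by simp
    show "AE y in lebesgue_on {-1..1}. poly (R * R) y / \<omega> y * w y \<le> 64 * w y"
      using w_pos AE_space
    proof eventually_elim
      case (elim y)
      then show ?case using R_bound[of y] by (intro mult_right_mono) (auto simp: power2_eq_square)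
    qed
  qed
  finally show ?thesis
    unfolding L_def P_def \<omega>_def by (simp add: poly_nodal_poly power2_eq_square)
qed

section \<open>The Poisson kernel\<close>

text \<open>
  The Joukowski parameter: for \<open>t \<noteq> 0\<close>, \<open>- alpha t\<close> is the solution of modulus at most \<open>1\<close> of
  \<open>z + 1 / z = - 2 / t\<close>, so that it represents the pole \<open>- 1 / t\<close> of \<open>1 / (1 + t x)\<close> in the unit disc.
\<close>
definition alpha :: "real \<Rightarrow> real" where
  "alpha t = t / (1 + sqrt (1 - t\<^sup>2))"

lemma alpha_facts:
  assumes "t \<in> {-1..1}"
  shows one_plus_alpha_sq: "1 + (alpha t)\<^sup>2 = 2 / (1 + sqrt (1 - t\<^sup>2))"
    and one_minus_alpha_sq: "1 - (alpha t)\<^sup>2 = 2 * sqrt (1 - t\<^sup>2) / (1 + sqrt (1 - t\<^sup>2))"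
    and quadratic_factor_alpha: "1 + (alpha t)\<^sup>2 + 2 * alpha t * y = (1 + (alpha t)\<^sup>2) * (1 + t * y)"
    and abs_alpha_le: "\<bar>alpha t\<bar> \<le> \<bar>t\<bar>"
proof -
  define s where "s = sqrt (1 - t\<^sup>2)"
  have "t\<^sup>2 \<le> 1" using assms by (auto simp: abs_square_le_1 abs_le_iff)
  then have s: "0 \<le> s" "s\<^sup>2 = 1 - t\<^sup>2" by (auto simp: s_def)
  have t2: "t\<^sup>2 = 1 - s\<^sup>2" using s by simp
  have a: "alpha t = t / (1 + s)" by (simp add: alpha_def s_def)
  have ne: "1 + s \<noteq> 0" using s by simp
  have sum: "(1 + s)\<^sup>2 + t\<^sup>2 = 2 * (1 + s)" and diff: "(1 + s)\<^sup>2 - t\<^sup>2 = 2 * s * (1 + s)"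
    unfolding t2 by (simp_all add: power2_eq_square algebra_simps)
  have h: "c * v / v\<^sup>2 = c / v" for c v :: real by (simp add: power2_eq_square)
  have "1 + (alpha t)\<^sup>2 = ((1 + s)\<^sup>2 + t\<^sup>2) / (1 + s)\<^sup>2"
    unfolding a using ne by (simp add: power_divide add_divide_distrib)
  then show 1: "1 + (alpha t)\<^sup>2 = 2 / (1 + sqrt (1 - t\<^sup>2))"
    unfolding sum s_def[symmetric] h .
  have "1 - (alpha t)\<^sup>2 = ((1 + s)\<^sup>2 - t\<^sup>2) / (1 + s)\<^sup>2"
    unfolding a using ne by (simp add: power_divide diff_divide_distrib)
  then show "1 - (alpha t)\<^sup>2 = 2 * sqrt (1 - t\<^sup>2) / (1 + sqrt (1 - t\<^sup>2))"
    unfolding diff s_def[symmetric] h .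
  show "1 + (alpha t)\<^sup>2 + 2 * alpha t * y = (1 + (alpha t)\<^sup>2) * (1 + t * y)"
    unfolding 1 unfolding a s_def[symmetric] by (simp add: distrib_left)
  have "\<bar>t\<bar> / (1 + s) \<le> \<bar>t\<bar> / 1" using s by (intro divide_left_mono) auto
  then show "\<bar>alpha t\<bar> \<le> \<bar>t\<bar>" unfolding a using s by simp
qed

lemma continuous_on_alpha: "continuous_on {-1..1} alpha"
  unfolding alpha_def[abs_def]
proof (intro continuous_intros ballI)
  fix t :: real assume "t \<in> {-1..1}"
  then have "0 \<le> sqrt (1 - t\<^sup>2)" by (auto simp: abs_square_le_1 abs_le_iff)
  then show "1 + sqrt (1 - t\<^sup>2) \<noteq> 0" by linarith
qed

lemma alpha_measurable [measurable]: "alpha \<in> borel_measurable borel"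
  unfolding alpha_def[abs_def] by measurable

lemma alpha_special [simp]: "alpha (-1) = -1" "alpha 0 = 0" "alpha 1 = 1"
  by (simp_all add: alpha_def)

lemma poisson_kernel_alpha:
  assumes "\<bar>t\<bar> < 1"
  shows "sqrt (1 - t\<^sup>2) / (1 + t * cos \<theta>) =
    (1 - (alpha t)\<^sup>2) / (1 + (alpha t)\<^sup>2 + 2 * alpha t * cos \<theta>)"
proof -
  have t: "t \<in> {-1..1}" using assms by auto
  have "\<bar>t * cos \<theta>\<bar> \<le> \<bar>t\<bar> * 1" unfolding abs_mult by (intro mult_left_mono) auto
  then have 1: "1 + t * cos \<theta> \<noteq> 0" using assms by linarith
  have "0 \<le> sqrt (1 - t\<^sup>2)" using assms by (simp add: abs_square_le_1)
  then have 2: "1 + sqrt (1 - t\<^sup>2) \<noteq> 0" by linarith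
  show ?thesis
    unfolding quadratic_factor_alpha[OF t] unfolding one_plus_alpha_sq[OF t] one_minus_alpha_sq[OF t]
    using 1 2 by (simp add: divide_simps)
qed

text \<open>
  The left-hand side is twice the real part of the geometric series in \<open>b e\<^sup>i\<^sup>\<theta>\<close>.
\<close>
lemma poisson_kernel_series:
  fixes b :: real
  assumes b: "\<bar>b\<bar> < 1"
  shows "(\<lambda>k. 2 * b ^ k * cos (real k * \<theta>)) sums ((1 - b\<^sup>2) / (1 + b\<^sup>2 - 2 * b * cos \<theta>) + 1)"
proof -
  define u where "u = of_real b * cis \<theta>"
  have u: "cmod u < 1" using b by (simp add: u_def norm_mult)
  have pos: "0 < 1 + b\<^sup>2 - 2 * b * cos \<theta>"
    using quadratic_factor_bounds(2)[of "- b" "cos \<theta>"] b by simp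
  have "(\<lambda>k. 2 * Re (u ^ k)) sums (2 * Re (1 / (1 - u)))"
    by (intro sums_mult sums_Re geometric_sums u)
  moreover have "Re (u ^ k) = b ^ k * cos (real k * \<theta>)" for k
    unfolding u_def power_mult_distrib Complex.DeMoivre by (simp flip: of_real_power)
  moreover have "2 * Re (1 / (1 - u)) = (1 - b\<^sup>2) / (1 + b\<^sup>2 - 2 * b * cos \<theta>) + 1"
  proof -
    have "Re (1 / (1 - u)) = (1 - b * cos \<theta>) / ((1 - b * cos \<theta>)\<^sup>2 + (b * sin \<theta>)\<^sup>2)"
      unfolding u_def by (simp add: Re_divide)
    also have "(1 - b * cos \<theta>)\<^sup>2 + (b * sin \<theta>)\<^sup>2 = 1 - 2 * b * cos \<theta> + b\<^sup>2 * ((sin \<theta>)\<^sup>2 + (cos \<theta>)\<^sup>2)"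
      by (simp only: power2_eq_square) algebra
    finally have "Re (1 / (1 - u)) = (1 - b * cos \<theta>) / (1 + b\<^sup>2 - 2 * b * cos \<theta>)" by (simp add: algebra_simps)
    then show ?thesis using pos by (simp add: field_simps)
  qed
  ultimately show ?thesis by (simp add: mult.assoc)
qed

text \<open>
  The Poisson kernel at the point \<open>- alpha t\<close> reproduces the harmonic function \<open>Re (z\<^sup>m)\<close>. In the
  variable \<open>x = cos \<theta>\<close> this says that the measure which replaces the unit mass at \<open>t\<close> has Chebyshev
  moments \<open>(- alpha t)\<^sup>m\<close>.
\<close>
lemma poisson_integral:
  assumes t: "\<bar>t\<bar> < 1"
  shows "(LINT \<theta>|angles. cos (real m * \<theta>) * (sqrt (1 - t\<^sup>2) / (1 + t * cos \<theta>))) = pi * (- alpha t) ^ m"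
proof -
  define b where "b = - alpha t"
  have b: "\<bar>b\<bar> < 1" using abs_alpha_le[of t] t unfolding b_def by (simp add: abs_le_iff) linarith
  let ?g = "\<lambda>k \<theta>. 2 * b ^ k * (cos (real k * \<theta>) * cos (real m * \<theta>))"
  have bound: "\<bar>?g k \<theta>\<bar> \<le> 2 * \<bar>b\<bar> ^ k" for k \<theta>
  proof -
    have "\<bar>cos (real k * \<theta>)\<bar> * \<bar>cos (real m * \<theta>)\<bar> \<le> 1 * 1" by (intro mult_mono) auto
    then show ?thesis by (simp add: abs_mult power_abs mult_left_le)
  qed
  have sg: "summable (\<lambda>k. 2 * \<bar>b\<bar> ^ k * c)" for c
    using b by (intro summable_mult summable_mult2 summable_geometric) auto
  have int: "integrable angles (?g k)" for k
    by (intro continuous_integrable_angles continuous_intros)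
  have "(\<lambda>k. LINT \<theta>|angles. ?g k \<theta>) sums (LINT \<theta>|angles. (\<Sum>k. ?g k \<theta>))"
  proof (rule sums_integral[OF int])
    show "AE \<theta> in angles. summable (\<lambda>k. norm (?g k \<theta>))"
      using bound by (intro AE_I2 summable_comparison_test[OF _ sg[of 1]]) auto
    have "(LINT \<theta>|angles. norm (?g k \<theta>)) \<le> 2 * \<bar>b\<bar> ^ k * measure angles (space angles)" for k
    proof -
      have "(LINT \<theta>|angles. norm (?g k \<theta>)) \<le> (LINT \<theta>|angles. 2 * \<bar>b\<bar> ^ k)"
        using bound by (intro integral_mono integrable_norm int) auto
      then show ?thesis by (simp add: mult.commute)
    qed
    then show "summable (\<lambda>k. LINT \<theta>|angles. norm (?g k \<theta>))"
      by (intro summable_comparison_test[OF _ sg[of "measure angles (space angles)"]])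
        (auto intro!: exI[of _ 0] simp: abs_of_nonneg Bochner_Integration.integral_nonneg)
  qed
  moreover have "(\<Sum>k. ?g k \<theta>) = (sqrt (1 - t\<^sup>2) / (1 + t * cos \<theta>) + 1) * cos (real m * \<theta>)" for \<theta>
  proof -
    have "(\<lambda>k. 2 * b ^ k * cos (real k * \<theta>) * cos (real m * \<theta>)) sums
        ((sqrt (1 - t\<^sup>2) / (1 + t * cos \<theta>) + 1) * cos (real m * \<theta>))"
      using sums_mult2[OF poisson_kernel_series[OF b, of \<theta>], of "cos (real m * \<theta>)"]
      unfolding poisson_kernel_alpha[OF t] by (simp add: b_def)
    then show ?thesis by (subst sums_unique[symmetric]) (auto simp only: mult.assoc)
  qed
  moreover have "(LINT \<theta>|angles. ?g k \<theta>) = (if k = m then (if m = 0 then 2 else 1) * pi * b ^ m else 0)" for k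
    by (simp add: integral_cos_cos)
  ultimately have "(\<lambda>k. if k = m then (if m = 0 then 2 else 1) * pi * b ^ m else 0) sums
      (LINT \<theta>|angles. (sqrt (1 - t\<^sup>2) / (1 + t * cos \<theta>) + 1) * cos (real m * \<theta>))" by simp
  from sums_unique2[OF sums_single this]
  have "(LINT \<theta>|angles. (sqrt (1 - t\<^sup>2) / (1 + t * cos \<theta>) + 1) * cos (real m * \<theta>)) =
      (if m = 0 then 2 else 1) * pi * b ^ m" by simp
  moreover have "(LINT \<theta>|angles. (sqrt (1 - t\<^sup>2) / (1 + t * cos \<theta>) + 1) * cos (real m * \<theta>)) =
      (LINT \<theta>|angles. cos (real m * \<theta>) * (sqrt (1 - t\<^sup>2) / (1 + t * cos \<theta>))) +
      (LINT \<theta>|angles. cos (real m * \<theta>))"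
  proof (subst Bochner_Integration.integral_add[symmetric])
    have nz: "1 + t * cos \<theta> \<noteq> 0" for \<theta>
    proof -
      have "\<bar>t * cos \<theta>\<bar> \<le> \<bar>t\<bar> * 1" unfolding abs_mult by (intro mult_left_mono) auto
      then show ?thesis using t by linarith
    qed
    show "integrable angles (\<lambda>\<theta>. cos (real m * \<theta>) * (sqrt (1 - t\<^sup>2) / (1 + t * cos \<theta>)))"
      using nz by (intro continuous_integrable_angles continuous_intros) auto
    show "integrable angles (\<lambda>\<theta>. cos (real m * \<theta>))"
      by (intro continuous_integrable_angles continuous_intros)
  qed (simp add: algebra_simps)
  moreover have "(LINT \<theta>|angles. cos (real m * \<theta>)) = (if m = 0 then pi else 0)"
    using integral_cos_multiple[of "int m"] by simp
  ultimately show ?thesis by (cases "m = 0") (auto simp: b_def)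
qed

section \<open>Partial fractions and orthogonality of the nodal polynomial\<close>

lemma degree_prod_linear:
  fixes t :: "'i \<Rightarrow> real"
  assumes "finite I"
  shows "degree (\<Prod>i\<in>I. [:1, t i:]) \<le> card I" and "coeff (\<Prod>i\<in>I. [:1, t i:]) (card I) = (\<Prod>i\<in>I. t i)"
proof -
  have "degree (\<Prod>i\<in>I. [:1, t i:]) \<le> card I \<and> coeff (\<Prod>i\<in>I. [:1, t i:]) (card I) = (\<Prod>i\<in>I. t i)"
    using assms
  proof (induction I)
    case (insert k I)
    define W where "W = (\<Prod>i\<in>I. [:1, t i:])"
    have W: "degree W \<le> card I" "coeff W (card I) = (\<Prod>i\<in>I. t i)" using insert by (auto simp: W_def)
    have "degree ([:1, t k:] * W) \<le> Suc (card I)"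
      using degree_mult_le[of "[:1, t k:]" W] W by (auto split: if_splits)
    moreover have "coeff W (Suc (card I)) = 0" using W by (intro coeff_eq_0) simp
    ultimately show ?case using insert.hyps W unfolding W_def[symmetric] by (simp add: W_def)
  qed simp
  then show "degree (\<Prod>i\<in>I. [:1, t i:]) \<le> card I" and "coeff (\<Prod>i\<in>I. [:1, t i:]) (card I) = (\<Prod>i\<in>I. t i)"
    by auto
qed

text \<open>
  Induction on \<open>I\<close>. Splitting off a factor with \<open>t k \<noteq> 0\<close> uses the value at its zero \<open>- 1 / t k\<close>; a
  factor with \<open>t k = 0\<close> is constant and stands for a pole at infinity, so the leading coefficient takes over the role of that value.
\<close>
lemma partial_fractions:
  fixes t :: "'i \<Rightarrow> real"
  assumes "finite I" "inj_on t I" "q = 0 \<or> degree q < card I"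
  shows "\<exists>c. q = (\<Sum>i\<in>I. smult (c i) (\<Prod>j\<in>I - {i}. [:1, t j:]))"
  using assms
proof (induction I arbitrary: q)
  case (insert k I)
  define W where "W = (\<Prod>i\<in>I. [:1, t i:])"
  have W: "degree W \<le> card I" "coeff W (card I) = (\<Prod>i\<in>I. t i)"
    unfolding W_def by (intro degree_prod_linear insert)+
  have tk: "t i \<noteq> t k" if "i \<in> I" for i using insert.prems(1) insert.hyps(2) that by (auto simp: inj_on_def)
  have q: "degree q \<le> card I" using insert by auto
  have "\<exists>b r. q = smult b W + [:1, t k:] * r \<and> (r = 0 \<or> degree r < card I)"
  proof (cases "t k = 0")
    case True
    have "(\<Prod>i\<in>I. t i) \<noteq> 0" using tk True insert.hyps by auto
    moreover define b where "b = coeff q (card I) / (\<Prod>i\<in>I. t i)"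
    ultimately have "coeff (q - smult b W) (card I) = 0" using W by simp
    moreover have "degree (q - smult b W) \<le> card I"
      using q W(1) degree_smult_le[of b W] by (intro degree_diff_le) auto
    ultimately have "q - smult b W = 0 \<or> degree (q - smult b W) < card I" using eq_zero_or_degree_less by blast
    then show ?thesis using True by (intro exI[of _ b] exI[of _ "q - smult b W"]) auto
  next
    case False
    define z where "z = - 1 / t k"
    have "1 + t i * z \<noteq> 0" if "i \<in> I" for i
      using tk[OF that] False by (auto simp: z_def field_simps)
    then have "poly W z \<noteq> 0"
      unfolding W_def poly_prod using insert.hyps by (auto simp: mult.commute)
    moreover define b where "b = poly q z / poly W z"
    ultimately have "poly (q - smult b W) z = 0" by simp
    then obtain r where r: "q - smult b W = [:- z, 1:] * r" unfolding poly_eq_0_iff_dvd by (auto elim: dvdE)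
    define r' where "r' = smult (1 / t k) r"
    have eq: "q - smult b W = [:1, t k:] * r'"
      unfolding r r'_def z_def using False by (simp add: field_simps smult_add_right)
    have "degree (q - smult b W) \<le> card I"
      using q W(1) degree_smult_le[of b W] by (intro degree_diff_le) auto
    moreover have "degree ([:1, t k:] * r') = Suc (degree r')" if "r' \<noteq> 0"
      using False that by (subst degree_mult_eq) auto
    ultimately have "r' = 0 \<or> degree r' < card I" unfolding eq by (metis Suc_le_eq)
    moreover have "q = smult b W + [:1, t k:] * r'" unfolding eq[symmetric] by simp
    ultimately show ?thesis by blast
  qed
  then obtain b r where r: "q = smult b W + [:1, t k:] * r" "r = 0 \<or> degree r < card I" by blast
  obtain c where c: "r = (\<Sum>i\<in>I. smult (c i) (\<Prod>j\<in>I - {i}. [:1, t j:]))"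
    using insert.IH[OF _ r(2)] insert.prems(1) by auto
  have "[:1, t k:] * r = (\<Sum>i\<in>I. smult (c i) (\<Prod>j\<in>insert k I - {i}. [:1, t j:]))"
    unfolding c sum_distrib_left
  proof (rule sum.cong[OF refl])
    fix i assume i: "i \<in> I"
    then have "insert k I - {i} = insert k (I - {i})" using insert.hyps by auto
    then show "[:1, t k:] * smult (c i) (\<Prod>j\<in>I - {i}. [:1, t j:]) = smult (c i) (\<Prod>j\<in>insert k I - {i}. [:1, t j:])"
      using insert.hyps by (simp del: mult_pCons_left)
  qed
  moreover have "insert k I - {k} = I" using insert.hyps by auto
  ultimately have "q = (\<Sum>i\<in>insert k I. smult ((c(k := b)) i) (\<Prod>j\<in>insert k I - {i}. [:1, t j:]))"
    using insert.hyps unfolding r(1) W_def by (auto intro!: sum.cong)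
  then show ?case by blast
qed auto

lemma one_plus_mult_cos_pos:
  fixes t \<theta> :: real
  assumes "\<bar>t\<bar> < 1"
  shows "0 < 1 + t * cos \<theta>"
proof -
  have "\<bar>t * cos \<theta>\<bar> \<le> \<bar>t\<bar> * 1" unfolding abs_mult by (intro mult_left_mono) auto
  then show ?thesis using assms by linarith
qed

lemma poly_linear: "poly [:1, a:] y = 1 + a * y" for a y :: real
  by (simp add: mult.commute)

lemma partial_fractions_eval:
  fixes t :: "'i \<Rightarrow> real"
  assumes I: "finite I" "inj_on t I" "degree q < card I"
  obtains c where "\<And>y. (\<And>i. i \<in> I \<Longrightarrow> 1 + t i * y \<noteq> 0) \<Longrightarrow>
    poly q y / (\<Prod>i\<in>I. 1 + t i * y) = (\<Sum>i\<in>I. c i / (1 + t i * y))"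
proof -
  obtain c where c: "q = (\<Sum>i\<in>I. smult (c i) (\<Prod>j\<in>I - {i}. [:1, t j:]))"
    using partial_fractions[of I t q] I by blast
  show thesis
  proof (rule that[of c])
    fix y assume nz: "\<And>i. i \<in> I \<Longrightarrow> 1 + t i * y \<noteq> 0"
    have "poly q y / (\<Prod>i\<in>I. 1 + t i * y) = (\<Sum>i\<in>I. c i * (\<Prod>j\<in>I - {i}. 1 + t j * y) / (\<Prod>i\<in>I. 1 + t i * y))"
      unfolding c by (simp add: poly_sum poly_prod sum_divide_distrib mult.commute)
    also have "\<dots> = (\<Sum>i\<in>I. c i / (1 + t i * y))"
    proof (intro sum.cong refl)
      fix i assume i: "i \<in> I"
      have "(\<Prod>j\<in>I - {i}. 1 + t j * y) \<noteq> 0" using nz I(1) by auto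
      then show "c i * (\<Prod>j\<in>I - {i}. 1 + t j * y) / (\<Prod>i\<in>I. 1 + t i * y) = c i / (1 + t i * y)"
        unfolding prod.remove[OF I(1) i] by simp
    qed
    finally show "poly q y / (\<Prod>i\<in>I. 1 + t i * y) = (\<Sum>i\<in>I. c i / (1 + t i * y))" .
  qed
qed

lemma one_plus_mult_pos:
  fixes t y :: real
  assumes "t \<in> {-1<..<1}" "y \<in> {-1..1}"
  shows "0 < 1 + t * y"
  using one_plus_mult_cos_pos[of t "arccos y"] assms by auto

text \<open>
  The rule is exact on the partial fractions \<open>1 / (1 + t\<^sub>k x)\<close>, hence on all \<open>p / \<Prod>(1 + t\<^sub>k x)\<close>
  with \<open>p\<close> of degree below \<open>2n\<close>, and its value is \<open>0\<close> when \<open>p\<close> is a multiple of the nodal polynomial.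
\<close>
lemma gaussian_nodes_orthogonal:
  assumes w_integrable: "integrable (lebesgue_on {-1..1}) w"
    and t_distinct: "inj_on t {1..}" and t_range: "\<forall>i\<ge>1. t i \<in> {-1<..<1}"
    and nodes: "gaussian_quadrature_nodes w t n x" and q: "degree q < n"
  shows "(LINT y|lebesgue_on {-1..1}. poly (nodal_poly n x * q) y / (\<Prod>k\<in>{1..2*n}. 1 + t k * y) * w y) = 0"
proof -
  obtain \<beta> where \<beta>: "\<And>k. k \<in> {1..2 * n} \<Longrightarrow>
      (LINT y|lebesgue_on {-1..1}. w y / (1 + t k * y)) = (\<Sum>i=1..n. \<beta> i / (1 + t k * x i))"
    using nodes unfolding gaussian_quadrature_nodes_def by blast
  have xr: "x i \<in> {-1..1}" if "i \<in> {1..n}" for i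
  proof -
    have "x i \<in> {-1<..<1}" using nodes that unfolding gaussian_quadrature_nodes_def by blast
    then show ?thesis by auto
  qed
  have tr: "t k \<in> {-1<..<1}" if "k \<in> {1..2*n}" for k using t_range that by auto
  have "degree (nodal_poly n x * q) < card {1..2 * n}"
    using degree_mult_le[of "nodal_poly n x" q] q by (simp add: degree_nodal_poly)
  moreover have "inj_on t {1..2*n}" using t_distinct by (rule inj_on_subset) auto
  ultimately obtain c where c: "\<And>y. (\<And>k. k \<in> {1..2*n} \<Longrightarrow> 1 + t k * y \<noteq> 0) \<Longrightarrow>
    poly (nodal_poly n x * q) y / (\<Prod>k\<in>{1..2*n}. 1 + t k * y) = (\<Sum>k\<in>{1..2*n}. c k / (1 + t k * y))"
    using partial_fractions_eval[of "{1..2*n}" t "nodal_poly n x * q"] by blast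
  have c': "poly (nodal_poly n x * q) y / (\<Prod>k\<in>{1..2*n}. 1 + t k * y) = (\<Sum>k\<in>{1..2*n}. c k / (1 + t k * y))"
    if "y \<in> {-1..1}" for y
    using one_plus_mult_pos[OF tr that] by (intro c) force
  have int: "integrable (lebesgue_on {-1..1}) (\<lambda>y. w y / (1 + t k * y))" if k: "k \<in> {1..2*n}" for k
  proof -
    have "integrable (lebesgue_on {-1..1}) (\<lambda>y. 1 / (1 + t k * y) * w y)"
      using one_plus_mult_pos[OF tr[OF k]]
      by (intro integrable_continuous_mult_weight w_integrable continuous_intros) force
    then show ?thesis by simp
  qed
  have "(LINT y|lebesgue_on {-1..1}. poly (nodal_poly n x * q) y / (\<Prod>k\<in>{1..2*n}. 1 + t k * y) * w y) =
      (LINT y|lebesgue_on {-1..1}. (\<Sum>k\<in>{1..2*n}. c k * (w y / (1 + t k * y))))"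
    by (intro Bochner_Integration.integral_cong refl, subst c') (auto simp: sum_distrib_right)
  also have "\<dots> = (\<Sum>k\<in>{1..2*n}. c k * (\<Sum>i=1..n. \<beta> i / (1 + t k * x i)))"
    by (subst Bochner_Integration.integral_sum, intro integrable_mult_right int, assumption)
      (intro sum.cong refl, simp only: integral_mult_right_zero \<beta>)
  also have "\<dots> = (\<Sum>i=1..n. \<beta> i * (\<Sum>k\<in>{1..2*n}. c k / (1 + t k * x i)))"
    unfolding sum_distrib_left by (subst sum.swap) (simp add: mult_ac)
  also have "\<dots> = (\<Sum>i=1..n. \<beta> i * (poly (nodal_poly n x * q) (x i) / (\<Prod>k\<in>{1..2*n}. 1 + t k * x i)))"
    using c'[OF xr] by simp
  also have "\<dots> = 0"
    by (intro sum.neutral ballI) (simp add: nodal_poly_root)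
  finally show ?thesis .
qed

text \<open>
  The difference of the two sides has degree below \<open>n\<close> and \<open>n\<close> distinct zeros.
\<close>
lemma nodal_poly_unique:
  assumes R: "degree R \<le> n" and x: "inj_on x {1..n}" and roots: "\<And>j. j \<in> {1..n} \<Longrightarrow> poly R (x j) = 0"
    and n: "0 < n"
  shows "R = smult (coeff R n / 2 ^ n) (nodal_poly n x)"
proof (rule ccontr)
  define D where "D = R - smult (coeff R n / 2 ^ n) (nodal_poly n x)"
  assume "R \<noteq> smult (coeff R n / 2 ^ n) (nodal_poly n x)"
  then have D: "D \<noteq> 0" by (simp add: D_def)
  have "degree D \<le> n" unfolding D_def
    by (intro degree_diff_le R order_trans[OF degree_smult_le]) (simp add: degree_nodal_poly)
  moreover have "coeff D n = 0" by (simp add: D_def lead_coeff_nodal_poly)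
  ultimately have "degree D < n" using D eq_zero_or_degree_less by blast
  moreover have "x ` {1..n} \<subseteq> {y. poly D y = 0}"
    using roots nodal_poly_root[of _ n x] by (auto simp: D_def)
  then have "card (x ` {1..n}) \<le> card {y. poly D y = 0}"
    by (intro card_mono poly_roots_finite D)
  then have "n \<le> degree D"
    using card_poly_roots_bound[OF D] card_image[OF x] by simp
  ultimately show False by simp
qed

text \<open>
  The numerator \<open>R\<close> of the orthogonal rational function has degree at most \<open>n\<close> and vanishes at the
  \<open>n\<close> nodes, so it is a multiple of the nodal polynomial; the multiple is nonzero because otherwise
  every point of the interval would be a zero. The parameters \<open>t\<^sub>1, \<dots>, t\<^sub>n\<close> enter the
  denominator twice, once from the function itself and once from the functions it is orthogonal to.
\<close>
lemma orthogonal_nodes_orthogonal: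
  assumes w_integrable: "integrable (lebesgue_on {-1..1}) w"
    and t_distinct: "inj_on t {1..}" and t_range: "\<forall>i\<ge>1. t i \<in> {-1<..<1}"
    and nodes: "orthogonal_quadrature_nodes w t n x" and q: "degree q < n"
  shows "(LINT y|lebesgue_on {-1..1}. poly (nodal_poly n x * q) y /
           ((\<Prod>k\<in>{1..n+1}. 1 + t k * y) * (\<Prod>k\<in>{1..n}. 1 + t k * y)) * w y) = 0"
proof -
  obtain c where c: "\<And>i. i \<in> {1..n} \<Longrightarrow>
      (LINT y|lebesgue_on {-1..1}. orth_rational t n c y * (w y / (1 + t i * y))) = 0"
    and inj: "inj_on x {1..n}" and im: "x ` {1..n} = {y \<in> {-1<..<1}. orth_rational t n c y = 0}"
    using nodes unfolding orthogonal_quadrature_nodes_def by blast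
  have n: "0 < n" using q by simp
  have tr: "t k \<in> {-1<..<1}" if "k \<in> {1..n+1}" for k using t_range that by auto
  have pos: "0 < 1 + t k * y" if "k \<in> {1..n+1}" "y \<in> {-1..1}" for k y
    using one_plus_mult_pos[OF tr] that by blast
  (* the summand with fixed coefficient 1 becomes the one of index n + 1 *)
  define c' where "c' i = (if i = n + 1 then 1 else c i)" for i
  define R where "R = (\<Sum>i\<in>{1..n+1}. smult (c' i) (\<Prod>j\<in>{1..n+1} - {i}. [:1, t j:]))"
  define W where "W y = (\<Prod>k\<in>{1..n+1}. 1 + t k * y)" for y
  have W: "0 < W y" if "y \<in> {-1..1}" for y
    unfolding W_def using pos that by (intro prod_pos) auto
  have r_eq: "orth_rational t n c y = poly R y / W y" if y: "y \<in> {-1..1}" for y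
  proof -
    have "poly R y / W y = (\<Sum>i\<in>{1..n+1}. c' i * (\<Prod>j\<in>{1..n+1} - {i}. 1 + t j * y) / W y)"
      unfolding R_def poly_sum poly_smult poly_prod sum_divide_distrib poly_linear ..
    also have "\<dots> = (\<Sum>i\<in>{1..n+1}. c' i / (1 + t i * y))"
    proof (intro sum.cong refl)
      fix i assume i: "i \<in> {1..n+1}"
      have "(\<Prod>j\<in>{1..n+1} - {i}. 1 + t j * y) \<noteq> 0" using pos y by force
      then show "c' i * (\<Prod>j\<in>{1..n+1} - {i}. 1 + t j * y) / W y = c' i / (1 + t i * y)"
        unfolding W_def prod.remove[OF finite_atLeastAtMost i] by simp
    qed
    also have "\<dots> = orth_rational t n c y"
      unfolding orth_rational_def by (simp add: c'_def)
    finally show ?thesis by simp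
  qed
  have root: "orth_rational t n c y = 0 \<longleftrightarrow> poly R y = 0" if "y \<in> {-1..1}" for y
    using r_eq[OF that] W[OF that] by simp
  have "R \<noteq> 0"
  proof
    assume "R = 0"
    then have "x ` {1..n} = {-1<..<1}" unfolding im using root by auto
    then have "finite {-1<..<1::real}" by (metis finite_atLeastAtMost finite_imageI)
    then show False using infinite_Ioo[of "-1" "1::real"] by simp
  qed
  have "degree R \<le> n"
    unfolding R_def
  proof (intro degree_sum_le order_trans[OF degree_smult_le])
    fix i assume i: "i \<in> {1..n+1}"
    show "degree (\<Prod>j\<in>{1..n+1} - {i}. [:1, t j:]) \<le> n"
      using degree_prod_linear(1)[of "{1..n+1} - {i}" t] i by (simp add: card_Diff_singleton_if)
  qed simp
  moreover have "poly R (x j) = 0" if "j \<in> {1..n}" for j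
  proof -
    have "x j \<in> {y \<in> {-1<..<1}. orth_rational t n c y = 0}" using that unfolding im[symmetric] by blast
    then show ?thesis using root[of "x j"] by auto
  qed
  ultimately have Rx: "R = smult (coeff R n / 2 ^ n) (nodal_poly n x)" (is "R = smult ?k _")
    using inj n by (intro nodal_poly_unique) auto
  then have k: "?k \<noteq> 0" using \<open>R \<noteq> 0\<close> by auto
  have "inj_on t {1..n}" using t_distinct by (rule inj_on_subset) auto
  then obtain b where b: "\<And>y. (\<And>k. k \<in> {1..n} \<Longrightarrow> 1 + t k * y \<noteq> 0) \<Longrightarrow>
    poly q y / (\<Prod>k\<in>{1..n}. 1 + t k * y) = (\<Sum>k\<in>{1..n}. b k / (1 + t k * y))"
    using partial_fractions_eval[of "{1..n}" t q] q by auto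
  have b': "poly q y / (\<Prod>k\<in>{1..n}. 1 + t k * y) = (\<Sum>k\<in>{1..n}. b k / (1 + t k * y))"
    if "y \<in> {-1..1}" for y
    using pos[OF _ that] by (intro b) force
  have int: "integrable (lebesgue_on {-1..1}) (\<lambda>y. orth_rational t n c y * (w y / (1 + t k * y)))" if i: "k \<in> {1..n}" for k
  proof -
    have "integrable (lebesgue_on {-1..1}) (\<lambda>y. poly R y / W y * (1 / (1 + t k * y)) * w y)"
      using W pos i
      by (intro integrable_continuous_mult_weight w_integrable continuous_intros)
        (force simp: W_def intro!: continuous_intros)+
    then show ?thesis
      by (rule Bochner_Integration.integrable_cong[THEN iffD1, OF refl, rotated]) (simp add: r_eq)
  qed
  have "(LINT y|lebesgue_on {-1..1}. ?k * (poly (nodal_poly n x * q) y /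
           (W y * (\<Prod>k\<in>{1..n}. 1 + t k * y)) * w y)) =
      (LINT y|lebesgue_on {-1..1}. (\<Sum>k\<in>{1..n}. b k * (orth_rational t n c y * (w y / (1 + t k * y)))))"
  proof (intro Bochner_Integration.integral_cong refl)
    fix y assume "y \<in> space (lebesgue_on {-1..1::real})"
    then have y: "y \<in> {-1..1}" by simp
    have "?k * (poly (nodal_poly n x * q) y / (W y * (\<Prod>k\<in>{1..n}. 1 + t k * y)) * w y) =
        (poly R y / W y) * (poly q y / (\<Prod>k\<in>{1..n}. 1 + t k * y)) * w y"
      by (subst (2) Rx) simp
    also have "\<dots> = (\<Sum>k\<in>{1..n}. b k * (orth_rational t n c y * (w y / (1 + t k * y))))"
      unfolding b'[OF y] r_eq[OF y] by (simp add: sum_distrib_left sum_distrib_right mult_ac)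
    finally show "?k * (poly (nodal_poly n x * q) y / (W y * (\<Prod>k\<in>{1..n}. 1 + t k * y)) * w y) =
       (\<Sum>k\<in>{1..n}. b k * (orth_rational t n c y * (w y / (1 + t k * y))))" .
  qed
  also have "\<dots> = 0"
    by (subst Bochner_Integration.integral_sum, intro integrable_mult_right int, assumption)
      (intro sum.neutral ballI, simp only: integral_mult_right_zero c mult_zero_right)
  finally show ?thesis using k unfolding integral_mult_right_zero W_def by simp
qed

section \<open>Integrals with respect to the limit measures\<close>

lemma nn_integral_add_measure:
  assumes sets: "sets M = sets N" and f: "f \<in> borel_measurable M"
  shows "(\<integral>\<^sup>+x. f x \<partial>(M \<oplus>\<^sub>M N)) = (\<integral>\<^sup>+x. f x \<partial>M) + (\<integral>\<^sup>+x. f x \<partial>N)"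
  using f
proof (induction rule: borel_measurable_induct)
  case (cong f g)
  have sp: "space M = space N" using sets by (rule sets_eq_imp_space_eq)
  have "(\<integral>\<^sup>+x. f x \<partial>(M \<oplus>\<^sub>M N)) = (\<integral>\<^sup>+x. g x \<partial>(M \<oplus>\<^sub>M N))" "(\<integral>\<^sup>+x. f x \<partial>M) = (\<integral>\<^sup>+x. g x \<partial>M)"
    "(\<integral>\<^sup>+x. f x \<partial>N) = (\<integral>\<^sup>+x. g x \<partial>N)"
    using cong(3) sp by (auto intro!: nn_integral_cong)
  then show ?case using cong by simp
next
  case (set A)
  then show ?case using sets by (simp add: emeasure_add_measure)
next
  case (mult u c)
  have [measurable]: "u \<in> borel_measurable M" "u \<in> borel_measurable N" "u \<in> borel_measurable (M \<oplus>\<^sub>M N)"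
    using mult(2) sets by (auto cong: measurable_cong_sets)
  show ?case using mult by (simp add: nn_integral_cmult distrib_left)
next
  case (add u v)
  have [measurable]: "u \<in> borel_measurable M" "u \<in> borel_measurable N" "u \<in> borel_measurable (M \<oplus>\<^sub>M N)"
      "v \<in> borel_measurable M" "v \<in> borel_measurable N" "v \<in> borel_measurable (M \<oplus>\<^sub>M N)"
    using add sets by (auto cong: measurable_cong_sets)
  show ?case using add by (simp add: nn_integral_add ac_simps)
next
  case (seq U)
  have [measurable]: "U i \<in> borel_measurable M" "U i \<in> borel_measurable N" "U i \<in> borel_measurable (M \<oplus>\<^sub>M N)" for i
    using seq(1)[of i] sets by (auto cong: measurable_cong_sets)
  have inc: "incseq (\<lambda>i. integral\<^sup>N K (U i))" for K
    using seq(3) by (auto simp: incseq_def le_fun_def intro!: nn_integral_mono)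
  have S: "integral\<^sup>N K (\<lambda>x. (SUP i. U i) x) = (SUP i. integral\<^sup>N K (U i))" if "\<And>i. U i \<in> borel_measurable K" for K
    using nn_integral_monotone_convergence_SUP[of U K] seq(3) that by (simp add: image_comp)
  show ?case
    by (subst (1 2 3) S) (auto simp: seq ennreal_SUP_add[OF inc inc])
qed

text \<open>
  Every measure in the statement is of this kind, so bounded Borel functions can be
  integrated term by term without further side conditions.
\<close>
definition finite_borel :: "real measure \<Rightarrow> bool" where
  "finite_borel M \<longleftrightarrow> finite_measure M \<and> sets M = sets borel"

lemma finite_borel_integrable:
  assumes "finite_borel M" and [measurable]: "f \<in> borel_measurable borel" and b: "\<And>x. \<bar>f x\<bar> \<le> (C::real)"
  shows "integrable M f"
proof -
  interpret finite_measure M using assms by (simp add: finite_borel_def)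
  have "sets M = sets borel" using assms by (simp add: finite_borel_def)
  then have "f \<in> borel_measurable M" using assms(2) by (simp cong: measurable_cong_sets)
  then show ?thesis using b by (intro integrable_const_bound[of _ C]) auto
qed

lemma finite_borel_add:
  assumes "finite_borel M" "finite_borel N"
  shows "finite_borel (M \<oplus>\<^sub>M N)"
proof -
  have s: "sets M = sets N" "sets M = sets borel" "space M = space N"
    using assms sets_eq_imp_space_eq[of M N] by (auto simp: finite_borel_def)
  have "emeasure (M \<oplus>\<^sub>M N) (space (M \<oplus>\<^sub>M N)) = emeasure M (space M) + emeasure N (space N)"
    using s by (simp add: emeasure_add_measure)
  also have "\<dots> \<noteq> \<infinity>" using assms by (simp add: finite_borel_def finite_measure.emeasure_finite)
  finally show ?thesis using s by (auto simp: finite_borel_def intro: finite_measureI)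
qed

lemma integral_add_measure:
  fixes f :: "real \<Rightarrow> real"
  assumes M: "finite_borel M" and N: "finite_borel N" and f: "f \<in> borel_measurable borel" and b: "\<And>x. \<bar>f x\<bar> \<le> C"
  shows "(LINT x|(M \<oplus>\<^sub>M N). f x) = (LINT x|M. f x) + (LINT x|N. f x)"
proof -
  note i = finite_borel_integrable[OF _ f b]
  have s: "sets M = sets N" "sets M = sets borel" using M N by (auto simp: finite_borel_def)
  then have f': "f \<in> borel_measurable M" using f by (simp cong: measurable_cong_sets)
  have nn: "(\<integral>\<^sup>+x. ennreal (g x) \<partial>(M \<oplus>\<^sub>M N)) = (\<integral>\<^sup>+x. ennreal (g x) \<partial>M) + (\<integral>\<^sup>+x. ennreal (g x) \<partial>N)"
    if "g \<in> borel_measurable M" for g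
    using that by (intro nn_integral_add_measure s) simp
  have fin: "(\<integral>\<^sup>+x. ennreal (f x) \<partial>K) < \<top>" "(\<integral>\<^sup>+x. ennreal (- f x) \<partial>K) < \<top>" if "finite_borel K" for K
    using i[OF that] unfolding real_integrable_def by (auto simp: less_top)
  show ?thesis
    unfolding real_lebesgue_integral_def[OF i[OF finite_borel_add[OF M N]]]
      real_lebesgue_integral_def[OF i[OF M]] real_lebesgue_integral_def[OF i[OF N]]
    using fin[OF M] fin[OF N] f' by (subst (1 2) nn) (auto simp: enn2real_plus)
qed

lemma finite_borel_scale:
  assumes "finite_borel M"
  shows "finite_borel (scale_measure (ennreal c) M)"
proof -
  have "emeasure M (space M) \<noteq> \<infinity>" using assms by (simp add: finite_borel_def finite_measure.emeasure_finite)
  then have "emeasure (scale_measure (ennreal c) M) (space (scale_measure (ennreal c) M)) \<noteq> \<infinity>"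
    by (simp add: space_scale_measure ennreal_mult_eq_top_iff)
  then show ?thesis using assms by (auto simp: finite_borel_def intro: finite_measureI)
qed

lemma integral_scale_measure:
  fixes f :: "real \<Rightarrow> real"
  assumes M: "finite_borel M" and f: "f \<in> borel_measurable borel" and b: "\<And>x. \<bar>f x\<bar> \<le> C" and c: "0 \<le> c"
  shows "(LINT x|scale_measure (ennreal c) M. f x) = c * (LINT x|M. f x)"
proof -
  note i = finite_borel_integrable[OF _ f b]
  have s: "sets M = sets borel" using M by (auto simp: finite_borel_def)
  then have f': "f \<in> borel_measurable M" using f by (simp cong: measurable_cong_sets)
  show ?thesis
    unfolding real_lebesgue_integral_def[OF i[OF finite_borel_scale[OF M]]]
      real_lebesgue_integral_def[OF i[OF M]]
    using f' c by (subst (1 2) nn_integral_scale_measure) (auto simp: enn2real_mult algebra_simps)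
qed

lemma finite_borel_dirac: "finite_borel (dirac a)"
  unfolding finite_borel_def using prob_space_return[of a borel] by (auto simp: prob_space_def)

lemma integral_mixture:
  fixes f :: "real \<Rightarrow> real"
  assumes M: "finite_borel M" "finite_borel N" and f: "f \<in> borel_measurable borel" and b: "\<And>x. \<bar>f x\<bar> \<le> C"
    and c: "0 \<le> p" "0 \<le> q" "0 \<le> r" "0 \<le> s"
    and \<Lambda>_def: "\<Lambda> = scale_measure (ennreal p) (dirac x) \<oplus>\<^sub>M scale_measure (ennreal q) (dirac y)
               \<oplus>\<^sub>M scale_measure (ennreal r) M \<oplus>\<^sub>M scale_measure (ennreal s) N"
  shows "finite_borel \<Lambda>" and "(LINT z|\<Lambda>. f z) = p * f x + q * f y + r * (LINT z|M. f z) + s * (LINT z|N. f z)"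
proof -
  note fb = finite_borel_add finite_borel_scale finite_borel_dirac M
  show "finite_borel \<Lambda>" unfolding \<Lambda>_def by (intro fb)
  show "(LINT z|\<Lambda>. f z) = p * f x + q * f y + r * (LINT z|M. f z) + s * (LINT z|N. f z)"
    unfolding \<Lambda>_def
    by (simp add: integral_add_measure[OF _ _ f b] integral_scale_measure[OF _ f b] fb c integral_return f)
qed

lemma set_integral_mixture:
  fixes f :: "real \<Rightarrow> real"
  assumes M: "finite_borel M" "finite_borel N" and f: "continuous_on {-1..1} f"
    and c: "0 \<le> p" "0 \<le> q" "0 \<le> r" "0 \<le> s" and xy: "x \<in> {-1..1}" "y \<in> {-1..1}"
    and \<Lambda>: "\<Lambda> = scale_measure (ennreal p) (dirac x) \<oplus>\<^sub>M scale_measure (ennreal q) (dirac y)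
               \<oplus>\<^sub>M scale_measure (ennreal r) M \<oplus>\<^sub>M scale_measure (ennreal s) N"
  shows "(LINT z:{-1..1}|\<Lambda>. f z) =
    p * f x + q * f y + r * (LINT z:{-1..1}|M. f z) + s * (LINT z:{-1..1}|N. f z)"
proof -
  have "bounded (f ` {-1..1})" using f by (intro compact_imp_bounded compact_continuous_image) auto
  then obtain C where C: "\<And>z. z \<in> {-1..1} \<Longrightarrow> \<bar>f z\<bar> \<le> C" unfolding bounded_iff by force
  have "0 \<le> C" using C[of 0] by auto
  then have b: "\<bar>indicator {-1..1} z * f z\<bar> \<le> C" for z using C by (auto simp: indicator_def)
  have m: "(\<lambda>z. indicator {-1..1} z * f z) \<in> borel_measurable borel"
    using borel_measurable_continuous_on_indicator[OF _ f] by simp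
  show ?thesis
    unfolding set_lebesgue_integral_def real_scaleR_def integral_mixture(2)[OF M m b c \<Lambda>]
    using xy by simp
qed

lemma finite_borel_prob_measure: "prob_measure_on_interval M \<Longrightarrow> finite_borel M"
  by (auto simp: prob_measure_on_interval_def finite_borel_def prob_space_def)

lemma integral_interval_density:
  fixes f h :: "real \<Rightarrow> real"
  assumes [measurable]: "h \<in> borel_measurable borel" "f \<in> borel_measurable borel"
    and h: "\<And>x. x \<in> {-1..1} \<Longrightarrow> 0 \<le> h x"
  shows "(LINT x|density lborel (\<lambda>x. ennreal (indicator {-1..1} x * h x)). f x) =
           (LINT x|lebesgue_on {-1..1}. f x * h x)"
proof -
  have "(LINT x|density lborel (\<lambda>x. ennreal (indicator {-1..1} x * h x)). f x) =
      (LINT x|lborel. (indicator {-1..1} x * h x) *\<^sub>R f x)"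
    using h by (intro integral_density) (auto simp: indicator_def)
  also have "\<dots> = (LINT x|lebesgue. (indicator {-1..1} x * h x) *\<^sub>R f x)"
    by (rule integral_completion[symmetric]) measurable
  also have "\<dots> = (LINT x|lebesgue_on {-1..1}. f x * h x)"
    by (subst integral_restrict_space) (auto simp: mult_ac)
  finally show ?thesis .
qed

lemma finite_borel_interval_density:
  fixes h :: "real \<Rightarrow> real"
  assumes [measurable]: "h \<in> borel_measurable borel"
    and h: "\<And>x. x \<in> {-1..1} \<Longrightarrow> 0 \<le> h x"
    and int: "integrable (lebesgue_on {-1..1}) h"
  shows "finite_borel (density lborel (\<lambda>x. ennreal (indicator {-1..1} x * h x)))"
proof -
  have "integrable lebesgue (\<lambda>x. indicator {-1..1} x * h x)"
    using int by (simp add: integrable_restrict_space)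
  then have "integrable lborel (\<lambda>x. indicator {-1..1} x * h x)"
    by (subst (asm) integrable_completion) auto
  then have "(\<integral>\<^sup>+x. ennreal (indicator {-1..1} x * h x) \<partial>lborel) \<noteq> \<infinity>"
    unfolding real_integrable_def by simp
  then show ?thesis
    unfolding finite_borel_def by (auto intro!: finite_measureI simp: emeasure_density)
qed

text \<open>
  The Jacobian \<open>sin \<theta>\<close> cancels the singular weight except at the two end points.
\<close>
lemma arcsin_substitution:
  fixes f :: "real \<Rightarrow> real"
  assumes f: "integrable angles (\<lambda>\<theta>. f (cos \<theta>))" and [measurable]: "f \<in> borel_measurable borel"
  shows "integrable (lebesgue_on {-1..1}) (\<lambda>x. f x * (1 / sqrt (1 - x\<^sup>2)))"
    and "(LINT x|lebesgue_on {-1..1}. f x * (1 / sqrt (1 - x\<^sup>2))) = (LINT \<theta>|angles. f (cos \<theta>))"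
proof -
  have ae: "AE \<theta> in angles. f (cos \<theta>) = f (cos \<theta>) * (1 / sqrt (1 - (cos \<theta>)\<^sup>2)) * sin \<theta>"
    using AE_angles_sin_pos
  proof eventually_elim
    case (elim \<theta>)
    have "sqrt (1 - (cos \<theta>)\<^sup>2) = sin \<theta>"
      using elim by (simp add: sin_squared_eq[symmetric])
    then show ?case using elim by simp
  qed
  have m: "(\<lambda>\<theta>. f (cos \<theta>) * (1 / sqrt (1 - (cos \<theta>)\<^sup>2)) * sin \<theta>) \<in> borel_measurable angles"
    by (intro borel_measurable_angles) measurable
  have "integrable angles (\<lambda>\<theta>. f (cos \<theta>) * (1 / sqrt (1 - (cos \<theta>)\<^sup>2)) * sin \<theta>)"
    by (rule integrable_cong_AE_imp[OF f m]) (use ae in eventually_elim, simp)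
  then show i: "integrable (lebesgue_on {-1..1}) (\<lambda>x. f x * (1 / sqrt (1 - x\<^sup>2)))"
    unfolding cos_substitution(1) .
  show "(LINT x|lebesgue_on {-1..1}. f x * (1 / sqrt (1 - x\<^sup>2))) = (LINT \<theta>|angles. f (cos \<theta>))"
    unfolding cos_substitution(2)[OF i, symmetric]
    using ae m f by (intro integral_cong_AE) (auto elim: eventually_mono)
qed

lemma integral_arcsin_measure:
  assumes f: "continuous_on UNIV f"
  shows "finite_borel arcsin_measure"
    and "(LINT x:{-1..1}|arcsin_measure. f x) = (LINT \<theta>|angles. f (cos \<theta>)) / pi"
proof -
  have i: "integrable angles (\<lambda>\<theta>. g (cos \<theta>))" if "continuous_on UNIV g" for g :: "real \<Rightarrow> real"
    using that by (intro continuous_integrable_angles continuous_on_compose2[OF that]) (auto intro!: continuous_intros)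
  have m [measurable]: "f \<in> borel_measurable borel" using f by (rule borel_measurable_continuous_onI)
  have pos: "0 \<le> 1 / pi * (1 / sqrt (1 - x\<^sup>2))" if "x \<in> {-1..1}" for x :: real
    using that by (auto simp: abs_square_le_1 abs_le_iff)
  have i1: "integrable (lebesgue_on {-1..1}) (\<lambda>x. 1 / pi * (1 / sqrt (1 - x\<^sup>2)))"
    by (rule arcsin_substitution(1)) (auto intro!: i)
  show "finite_borel arcsin_measure"
    unfolding arcsin_measure_def by (rule finite_borel_interval_density[OF _ pos i1]) measurable
  have "(LINT x:{-1..1}|arcsin_measure. f x) =
      (LINT x|lebesgue_on {-1..1}. indicator {-1..1} x * f x * (1 / pi * (1 / sqrt (1 - x\<^sup>2))))"
    unfolding set_lebesgue_integral_def real_scaleR_def arcsin_measure_def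
    by (rule integral_interval_density[OF _ _ pos]) measurable
  also have "\<dots> = (LINT x|lebesgue_on {-1..1}. (f x / pi) * (1 / sqrt (1 - x\<^sup>2)))"
    by (intro Bochner_Integration.integral_cong) auto
  also have "\<dots> = (LINT \<theta>|angles. f (cos \<theta>) / pi)"
    by (rule arcsin_substitution(2)) (auto intro!: i continuous_intros f)
  finally show "(LINT x:{-1..1}|arcsin_measure. f x) = (LINT \<theta>|angles. f (cos \<theta>)) / pi" by simp
qed

text \<open>
  The indicator is the one of the integral that defines the density of \<open>mu_b\<close>. At \<open>t = \<plusminus>1\<close> the value
  is \<open>0\<close>, whereas the Poisson kernels themselves concentrate at a point as \<open>t\<close> tends to \<open>\<plusminus>1\<close>.
\<close>
definition poisson :: "real \<Rightarrow> real \<Rightarrow> real" where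
  "poisson t \<theta> = indicator {-1..1} t * (sqrt (1 - t\<^sup>2) / (1 + cos \<theta> * t))"

lemma poisson_eq: "\<bar>t\<bar> < 1 \<Longrightarrow> poisson t \<theta> = sqrt (1 - t\<^sup>2) / (1 + t * cos \<theta>)"
  by (auto simp: poisson_def mult.commute indicator_def)

lemma poisson_outside: "\<not> \<bar>t\<bar> < 1 \<Longrightarrow> poisson t \<theta> = 0"
  by (auto simp: poisson_def indicator_def abs_if split: if_splits)

lemma poisson_nonneg: "0 \<le> poisson t \<theta>"
proof (cases "\<bar>t\<bar> < 1")
  case True
  then show ?thesis using one_plus_mult_cos_pos[OF True, of \<theta>]
    by (auto simp: poisson_eq abs_square_le_1 intro!: divide_nonneg_nonneg)
qed (simp add: poisson_outside)

lemma integrable_poisson: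
  assumes "continuous_on UNIV f"
  shows "integrable angles (\<lambda>\<theta>. f \<theta> * poisson t \<theta>)"
proof (cases "\<bar>t\<bar> < 1")
  case True
  have nz: "1 + t * cos \<theta> \<noteq> 0" for \<theta> using one_plus_mult_cos_pos[OF True, of \<theta>] by simp
  show ?thesis unfolding poisson_eq[OF True]
    by (intro continuous_integrable_angles continuous_intros assms) (use nz in auto)
qed (simp add: poisson_outside)

text \<open>
  After the substitution \<open>x = cos \<theta>\<close> this is Fubini's theorem. The product is integrable because
  each Poisson kernel has total mass at most \<open>\<pi>\<close> on the space of angles.
\<close>
lemma integral_mu_b:
  fixes f :: "real \<Rightarrow> real"
  assumes \<nu>: "finite_borel \<nu>" and f: "continuous_on UNIV f"
  shows "finite_borel (mu_b \<nu>)"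
    and "(LINT x:{-1..1}|mu_b \<nu>. f x) = (LINT t|\<nu>. (LINT \<theta>|angles. f (cos \<theta>) * poisson t \<theta>) / pi)"
proof -
  interpret \<nu>: finite_measure \<nu> using \<nu> by (simp add: finite_borel_def)
  have sets [measurable_cong]: "sets \<nu> = sets borel" using \<nu> by (simp add: finite_borel_def)
  interpret P: pair_sigma_finite \<nu> angles
    by (intro pair_sigma_finite.intro \<nu>.sigma_finite_measure_axioms angles.sigma_finite_measure_axioms)
  define G where "G x = (LINT t:{-1..1}|\<nu>. sqrt (1 - t\<^sup>2) / (1 + x * t))" for x
  have G_cos: "G (cos \<theta>) = (LINT t|\<nu>. poisson t \<theta>)" for \<theta>
    unfolding G_def set_lebesgue_integral_def poisson_def real_scaleR_def ..
  have Gm [measurable]: "G \<in> borel_measurable borel"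
    unfolding G_def[abs_def] set_lebesgue_integral_def by measurable
  have G_nonneg: "0 \<le> G x" if "x \<in> {-1..1}" for x
  proof -
    have "G (cos (arccos x)) \<ge> 0" unfolding G_cos by (intro Bochner_Integration.integral_nonneg poisson_nonneg)
    then show ?thesis using that by simp
  qed
  have snd_meas [measurable]: "(\<lambda>z. snd z) \<in> borel_measurable (\<nu> \<Otimes>\<^sub>M angles)"
    by (rule measurable_compose[OF measurable_snd borel_measurable_angles]) simp
  have fst_meas [measurable]: "(\<lambda>z. fst z) \<in> borel_measurable (\<nu> \<Otimes>\<^sub>M angles)"
    by (rule measurable_compose[OF measurable_fst]) (simp add: measurable_cong_sets[OF sets refl])
  have prod: "integrable (\<nu> \<Otimes>\<^sub>M angles) (\<lambda>(t, \<theta>). g (cos \<theta>) * poisson t \<theta>)"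
    if g: "continuous_on UNIV g" for g :: "real \<Rightarrow> real"
  proof -
    have gm [measurable]: "g \<in> borel_measurable borel" using g by (rule borel_measurable_continuous_onI)
    have gc: "continuous_on UNIV (\<lambda>\<theta>. g (cos \<theta>))"
      by (intro continuous_on_compose2[OF g]) (auto intro!: continuous_intros)
    have "bounded (g ` {-1..1})"
      by (intro compact_imp_bounded compact_continuous_image continuous_on_subset[OF g]) auto
    then obtain C where C: "\<And>y. y \<in> {-1..1} \<Longrightarrow> \<bar>g y\<bar> \<le> C" unfolding bounded_iff by force
    have meas [measurable]: "(\<lambda>(t, \<theta>). g (cos \<theta>) * poisson t \<theta>) \<in> borel_measurable (\<nu> \<Otimes>\<^sub>M angles)"
      unfolding poisson_def split_beta' by measurable
    show ?thesis
    proof (rule P.Fubini_integrable)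
      have int1: "(LINT \<theta>|angles. \<bar>g (cos \<theta>) * poisson t \<theta>\<bar>) \<le> C * pi" for t
      proof (cases "\<bar>t\<bar> < 1")
        case True
        have "(LINT \<theta>|angles. \<bar>g (cos \<theta>) * poisson t \<theta>\<bar>) \<le> (LINT \<theta>|angles. C * poisson t \<theta>)"
        proof (rule integral_mono)
          show "integrable angles (\<lambda>\<theta>. \<bar>g (cos \<theta>) * poisson t \<theta>\<bar>)"
            by (intro integrable_abs integrable_poisson gc)
          show "integrable angles (\<lambda>\<theta>. C * poisson t \<theta>)" by (rule integrable_poisson) simp
          show "\<bar>g (cos \<theta>) * poisson t \<theta>\<bar> \<le> C * poisson t \<theta>" for \<theta>
            using C[of "cos \<theta>"] poisson_nonneg[of t \<theta>] by (auto simp: abs_mult intro!: mult_right_mono)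
        qed
        also have "\<dots> = C * (LINT \<theta>|angles. poisson t \<theta>)" by simp
        also have "(LINT \<theta>|angles. poisson t \<theta>) = pi"
          using poisson_integral[OF True, of 0] unfolding poisson_eq[OF True] by simp
        finally show ?thesis .
      next
        case False
        have "0 \<le> C" using C[of 0] by auto
        then show ?thesis using False by (simp add: poisson_outside)
      qed
      have "integrable \<nu> (\<lambda>t. LINT \<theta>|angles. \<bar>g (cos \<theta>) * poisson t \<theta>\<bar>)"
      proof (rule \<nu>.integrable_const_bound[of _ "C * pi"])
        show "AE t in \<nu>. norm (LINT \<theta>|angles. \<bar>g (cos \<theta>) * poisson t \<theta>\<bar>) \<le> C * pi"
          using int1 by (intro AE_I2) (simp add: abs_of_nonneg Bochner_Integration.integral_nonneg)
        show "(\<lambda>t. LINT \<theta>|angles. \<bar>g (cos \<theta>) * poisson t \<theta>\<bar>) \<in> borel_measurable \<nu>"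
          by (intro angles.borel_measurable_lebesgue_integral) (use meas in \<open>simp add: split_beta'\<close>)
      qed
      then show "integrable \<nu> (\<lambda>t. LINT \<theta>|angles. norm (case (t, \<theta>) of (t, \<theta>) \<Rightarrow> g (cos \<theta>) * poisson t \<theta>))"
        by simp
      show "AE t in \<nu>. integrable angles (\<lambda>\<theta>. case (t, \<theta>) of (t, \<theta>) \<Rightarrow> g (cos \<theta>) * poisson t \<theta>)"
        using integrable_poisson[OF gc] by simp
    qed (rule meas)
  qed
  have iG: "integrable angles (\<lambda>\<theta>. g (cos \<theta>) * G (cos \<theta>))" if g: "continuous_on UNIV g" for g :: "real \<Rightarrow> real"
    unfolding G_cos using P.integrable_snd[OF prod[OF g]] by simp
  have dens: "mu_b \<nu> = density lborel (\<lambda>x. ennreal (indicator {-1..1} x * (G x / pi * (1 / sqrt (1 - x\<^sup>2)))))"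
    unfolding mu_b_def G_def by (simp add: mult_ac)
  have pos: "0 \<le> G x / pi * (1 / sqrt (1 - x\<^sup>2))" if "x \<in> {-1..1}" for x :: real
    using that G_nonneg[OF that] by (auto simp: abs_square_le_1 abs_le_iff intro!: divide_nonneg_nonneg)
  have i1: "integrable (lebesgue_on {-1..1}) (\<lambda>x. G x / pi * (1 / sqrt (1 - x\<^sup>2)))"
    using iG[of "\<lambda>_. 1 / pi"] by (intro arcsin_substitution(1)) auto
  show "finite_borel (mu_b \<nu>)"
    unfolding dens by (rule finite_borel_interval_density[OF _ pos i1]) measurable
  have [measurable]: "f \<in> borel_measurable borel" using f by (rule borel_measurable_continuous_onI)
  have fc: "continuous_on UNIV (\<lambda>x. f x / pi)" by (intro continuous_intros f) simp
  have "(LINT x:{-1..1}|mu_b \<nu>. f x) =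
      (LINT x|lebesgue_on {-1..1}. indicator {-1..1} x * f x * (G x / pi * (1 / sqrt (1 - x\<^sup>2))))"
    unfolding set_lebesgue_integral_def real_scaleR_def dens
    by (rule integral_interval_density[OF _ _ pos]) measurable
  also have "\<dots> = (LINT x|lebesgue_on {-1..1}. (f x / pi * G x) * (1 / sqrt (1 - x\<^sup>2)))"
    by (intro Bochner_Integration.integral_cong) auto
  also have "\<dots> = (LINT \<theta>|angles. f (cos \<theta>) / pi * G (cos \<theta>))"
    by (rule arcsin_substitution(2)) (rule iG[OF fc], measurable)
  also have "\<dots> = (LINT \<theta>|angles. (LINT t|\<nu>. f (cos \<theta>) / pi * poisson t \<theta>))"
    unfolding G_cos by simp
  also have "\<dots> = (LINT t|\<nu>. (LINT \<theta>|angles. f (cos \<theta>) / pi * poisson t \<theta>))"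
    using P.Fubini_integral[OF prod[OF fc]] by simp
  finally show "(LINT x:{-1..1}|mu_b \<nu>. f x) = (LINT t|\<nu>. (LINT \<theta>|angles. f (cos \<theta>) * poisson t \<theta>) / pi)"
    by simp
qed

text \<open>
  The density of \<open>mu_b\<close> carries nothing for parameters \<open>\<plusminus>1\<close>, so atoms of \<open>\<nu>\<close> there would be lost
  on the left-hand side.
\<close>
lemma chebyshev_moment_mu_b:
  assumes \<nu>: "finite_borel \<nu>" and atoms: "measure \<nu> {-1, 1} = 0"
  shows "(LINT x:{-1..1}|mu_b \<nu>. poly (chebyshev m) x) = (LINT t:{-1..1}|\<nu>. (- alpha t) ^ m)"
proof -
  interpret \<nu>: finite_measure \<nu> using \<nu> by (simp add: finite_borel_def)
  have sets [measurable_cong]: "sets \<nu> = sets borel" using \<nu> by (simp add: finite_borel_def)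
  have "{-1, 1} \<in> null_sets \<nu>" using atoms sets by (auto simp: null_sets_def \<nu>.emeasure_eq_measure)
  then have ae: "AE t in \<nu>. t \<notin> {-1, 1}" by (rule AE_not_in)
  have "(LINT x:{-1..1}|mu_b \<nu>. poly (chebyshev m) x) =
      (LINT t|\<nu>. (LINT \<theta>|angles. cos (real m * \<theta>) * poisson t \<theta>) / pi)"
    using integral_mu_b(2)[OF \<nu>, of "poly (chebyshev m)"] by (simp add: poly_chebyshev_cos continuous_on_poly)
  also have "\<dots> = (LINT t|\<nu>. indicator {-1..1} t * (- alpha t) ^ m)"
  proof (rule integral_cong_AE)
    have eq: "(LINT \<theta>|angles. cos (real m * \<theta>) * poisson t \<theta>) / pi = indicator {-1<..<1} t * (- alpha t) ^ m" for t
    proof (cases "\<bar>t\<bar> < 1")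
      case True
      then show ?thesis unfolding poisson_eq[OF True] poisson_integral[OF True] by (auto simp: indicator_def)
    qed (auto simp: poisson_outside indicator_def)
    show "(\<lambda>t. (LINT \<theta>|angles. cos (real m * \<theta>) * poisson t \<theta>) / pi) \<in> borel_measurable \<nu>"
      unfolding eq by measurable
    show "AE t in \<nu>. (LINT \<theta>|angles. cos (real m * \<theta>) * poisson t \<theta>) / pi = indicator {-1..1} t * (- alpha t) ^ m"
      unfolding eq using ae by eventually_elim (auto simp: indicator_def)
  qed measurable
  finally show ?thesis by (simp add: set_lebesgue_integral_def)
qed

lemma chebyshev_moment_arcsin:
  "(LINT x:{-1..1}|arcsin_measure. poly (chebyshev m) x) = 0 ^ m"
  using integral_arcsin_measure(2)[of "poly (chebyshev m)"] integral_cos_multiple[of "int m"]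
  by (simp add: poly_chebyshev_cos continuous_on_poly power_0_left)

section \<open>Chebyshev moments determine the limit distribution\<close>

text \<open>
  Multiplication by \<open>x\<close> stays inside the span of the Chebyshev polynomials, so this span contains all
  powers of \<open>x\<close>.
\<close>
lemma x_mult_chebyshev:
  "[:0, 1:] * chebyshev 0 = chebyshev 1"
  "[:0, 1:] * chebyshev (Suc m) = smult (1 / 2) (chebyshev (Suc (Suc m)) + chebyshev m)"
proof -
  have "[:0, 2:] = smult 2 [:0, 1 :: real:]" by simp
  then show "[:0, 1:] * chebyshev (Suc m) = smult (1 / 2) (chebyshev (Suc (Suc m)) + chebyshev m)"
    by (simp only: chebyshev.simps diff_add_cancel mult_smult_left smult_smult) simp
qed simp

text \<open>
  Linearity extends the convergence from Chebyshev polynomials to all polynomials, and the Weierstrass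
  theorem to all continuous functions.
\<close>
lemma asymptotic_distribution_from_moments:
  assumes \<mu>: "finite_borel \<mu>"
    and x: "\<And>n j. j \<in> {1..n} \<Longrightarrow> x n j \<in> {-1..1}"
    and mom: "\<And>m. (\<lambda>n. 1 / real n * (\<Sum>j=1..n. poly (chebyshev m) (x n j)))
                 \<longlonglongrightarrow> (LINT y:{-1..1}|\<mu>. poly (chebyshev m) y)"
  shows "asymptotic_distribution x \<mu>"
proof -
  interpret finite_measure \<mu> using \<mu> by (simp add: finite_borel_def)
  have sets [measurable_cong]: "sets \<mu> = sets borel" using \<mu> by (simp add: finite_borel_def)
  define I where "I f = (LINT y:{-1..1}|\<mu>. f y)" for f :: "real \<Rightarrow> real"
  define A where "A n f = 1 / real n * (\<Sum>j=1..n. f (x n j))" for n and f :: "real \<Rightarrow> real"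
  have si: "set_integrable \<mu> {-1..1} f" if f: "continuous_on {-1..1} f" for f :: "real \<Rightarrow> real"
  proof -
    have "bounded (f ` {-1..1})" using f by (intro compact_imp_bounded compact_continuous_image) auto
    then obtain C where C: "\<And>y. y \<in> {-1..1} \<Longrightarrow> \<bar>f y\<bar> \<le> C" unfolding bounded_iff by force
    have "0 \<le> C" using C[of 0] by auto
    then show ?thesis
      unfolding set_integrable_def real_scaleR_def
      using f C borel_measurable_continuous_on_indicator[OF _ f]
      by (intro finite_borel_integrable[OF \<mu>, of _ C]) (auto simp: indicator_def)
  qed
  (* the polynomials for which convergence holds form a subspace that is closed under multiplication by x *)
  define S where "S = {p. (\<lambda>n. A n (poly p)) \<longlonglongrightarrow> I (poly p)}"
  have S_add: "p + q \<in> S" if "p \<in> S" "q \<in> S" for p q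
  proof -
    have "A n (poly (p + q)) = A n (poly p) + A n (poly q)" for n
      unfolding A_def by (simp add: sum.distrib distrib_left)
    moreover have "I (\<lambda>y. poly p y + poly q y) = I (poly p) + I (poly q)"
      unfolding I_def by (intro set_integral_add si continuous_intros)
    moreover have "poly (p + q) = (\<lambda>y. poly p y + poly q y)" by auto
    ultimately show ?thesis using that unfolding S_def by (auto intro: tendsto_add)
  qed
  have S_smult: "smult c p \<in> S" if "p \<in> S" for c p
  proof -
    have "A n (poly (smult c p)) = c * A n (poly p)" for n
      unfolding A_def by (simp add: sum_distrib_left mult_ac)
    moreover have "I (\<lambda>y. c * poly p y) = c * I (poly p)" unfolding I_def by simp
    moreover have "poly (smult c p) = (\<lambda>y. c * poly p y)" by auto
    ultimately show ?thesis using that unfolding S_def by (auto intro: tendsto_mult_left)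
  qed
  have S_monom: "monom 1 i * chebyshev m \<in> S" for i m
  proof (induction i arbitrary: m)
    case 0
    then show ?case using mom by (simp add: S_def A_def I_def)
  next
    case (Suc i)
    have eq: "monom 1 (Suc i) * chebyshev m = monom 1 i * ([:0, 1:] * chebyshev m)"
      by (simp add: monom_Suc)
    show ?case
    proof (cases m)
      case 0
      show ?thesis unfolding eq unfolding 0 x_mult_chebyshev by (rule Suc.IH)
    next
      case (Suc m')
      show ?thesis unfolding eq unfolding Suc x_mult_chebyshev mult_smult_right distrib_left
        by (intro S_smult S_add Suc.IH)
    qed
  qed
  have S_poly: "p \<in> S" for p
  proof -
    have "(\<Sum>i\<le>N. smult (coeff p i) (monom 1 i * chebyshev 0)) \<in> S" for N
      using S_monom[of 0 0] by (induction N) (auto intro!: S_add S_smult S_monom simp del: chebyshev.simps)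
    then have "(\<Sum>i\<le>degree p. monom (coeff p i) i) \<in> S" by (simp add: smult_monom)
    then show ?thesis unfolding poly_as_sum_of_monoms .
  qed
  show ?thesis
    unfolding asymptotic_distribution_def
  proof (intro allI impI)
    fix f :: "real \<Rightarrow> real" assume f: "continuous_on {-1..1} f"
    have "(\<lambda>n. A n f) \<longlonglongrightarrow> I f"
    proof (rule tendstoI)
      fix e :: real assume e: "0 < e"
      define c where "c = measure \<mu> (space \<mu>) + 2"
      have c: "0 < c" unfolding c_def by (simp add: add_nonneg_pos)
      define d where "d = e / c"
      have d: "0 < d" using e c by (simp add: d_def)
      obtain g where g: "real_polynomial_function g" "\<And>y. y \<in> {-1..1} \<Longrightarrow> \<bar>f y - g y\<bar> < d"
        using Stone_Weierstrass_real_polynomial_function[OF _ f d] by auto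
      obtain a N where "g = (\<lambda>y. \<Sum>i\<le>N. a i * y ^ i)"
        using g(1) unfolding real_polynomial_function_iff_sum by blast
      then have gp: "g = poly (\<Sum>i\<le>N. monom (a i) i)" by (auto simp: poly_sum poly_monom)
      have cg: "continuous_on {-1..1} g" unfolding gp by (intro continuous_intros)
      have "(\<lambda>n. A n g) \<longlonglongrightarrow> I g" using S_poly unfolding gp S_def by blast
      then have "\<forall>\<^sub>F n in sequentially. dist (A n g) (I g) < d" using d by (rule tendstoD)
      then show "\<forall>\<^sub>F n in sequentially. dist (A n f) (I f) < e"
      proof eventually_elim
        case (elim n)
        have 1: "\<bar>A n f - A n g\<bar> \<le> d"
        proof (cases "n = 0")
          case False
          have "\<bar>\<Sum>j=1..n. f (x n j) - g (x n j)\<bar> \<le> (\<Sum>j=1..n. d)"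
            by (intro order_trans[OF sum_abs] sum_mono less_imp_le g x)
          then show ?thesis using False unfolding A_def
            by (simp add: sum_subtractf abs_mult field_simps flip: right_diff_distrib)
        qed (use d in \<open>simp add: A_def\<close>)
        have "\<bar>I f - I g\<bar> = \<bar>LINT y:{-1..1}|\<mu>. f y - g y\<bar>"
          unfolding I_def by (subst set_integral_diff[OF si[OF f] si[OF cg]]) simp
        also have "\<dots> \<le> (LINT y:{-1..1}|\<mu>. \<bar>f y - g y\<bar>)"
          using set_integral_norm_bound[OF si, of "\<lambda>y. f y - g y"] f cg by (auto intro!: continuous_intros)
        also have "\<dots> \<le> (LINT y|\<mu>. d)"
          unfolding set_lebesgue_integral_def
        proof (rule integral_mono)
          show "integrable \<mu> (\<lambda>y. indicator {-1..1} y *\<^sub>R \<bar>f y - g y\<bar>)"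
            using si[OF continuous_on_rabs[OF continuous_on_diff[OF f cg]]] unfolding set_integrable_def .
          show "indicator {-1..1} y *\<^sub>R \<bar>f y - g y\<bar> \<le> d" for y
            using g(2)[of y] d by (auto simp: indicator_def)
        qed simp
        also have "\<dots> = d * measure \<mu> (space \<mu>)" by simp
        finally have 2: "\<bar>I f - I g\<bar> \<le> d * measure \<mu> (space \<mu>)" .
        have "dist (A n f) (I f) \<le> \<bar>A n f - A n g\<bar> + \<bar>A n g - I g\<bar> + \<bar>I f - I g\<bar>"
          unfolding dist_real_def by linarith
        also have "\<dots> < d + d + d * measure \<mu> (space \<mu>)"
          using 1 2 elim unfolding dist_real_def by linarith
        also have "\<dots> = d * c" by (simp add: c_def algebra_simps)
        also have "\<dots> = e" using c by (simp add: d_def)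
        finally show ?case .
      qed
    qed
    then show "(\<lambda>n. 1 / real n * (\<Sum>j=1..n. f (x n j))) \<longlonglongrightarrow> (LINT y:{-1..1}|\<mu>. f y)"
      unfolding A_def I_def .
  qed
qed

section \<open>The asymptotic distribution of the nodes\<close>

text \<open>
  Here \<open>s n k\<close> are the parameters in the \<open>n\<close>-th weight. The denominator \<open>\<Prod>(1 + s y)\<close>
  differs from \<open>\<Prod>(1 + alpha(s)\<^sup>2 + 2 alpha(s) y)\<close> by a constant factor, which does not
  affect orthogonality. The index type is arbitrary since the orthogonal rule uses parameters with
  multiplicity.
\<close>
lemma nodes_moments:
  fixes w :: "real \<Rightarrow> real" and x :: "nat \<Rightarrow> nat \<Rightarrow> real"
    and K :: "nat \<Rightarrow> 'k set" and s :: "nat \<Rightarrow> 'k \<Rightarrow> real"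
  assumes w_integrable: "integrable (lebesgue_on {-1..1}) w"
    and w_pos: "AE x in lebesgue_on {-1..1}. 0 < w x"
    and x: "\<And>n j. j \<in> {1..n} \<Longrightarrow> x n j \<in> {-1..1}"
    and K: "\<And>n. finite (K n)" "\<And>n. card (K n) \<le> 2 * n + 1"
    and s: "\<And>n k. k \<in> K n \<Longrightarrow> \<bar>s n k\<bar> < 1"
    and centre: "\<forall>\<^sub>F n in sequentially. \<exists>K' k0. K' \<subseteq> K n \<and> card K' = 2 * n \<and> card (K n - K') \<le> 1 \<and>
        (\<forall>k\<in>K n - K'. \<bar>s n k\<bar> \<le> 1 / 2) \<and> k0 \<in> K' \<and> \<bar>s n k0\<bar> \<le> 1 / 2"
    and orth: "\<And>n q. 0 < n \<Longrightarrow> degree q < n \<Longrightarrow>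
      (LINT y|lebesgue_on {-1..1}. poly (nodal_poly n (x n) * q) y / (\<Prod>k\<in>K n. 1 + s n k * y) * w y) = 0"
    and lim: "(\<lambda>n. (\<Sum>k\<in>K n. (- alpha (s n k)) ^ m) / 2 / real n) \<longlonglongrightarrow> l"
    and m: "0 < m"
  shows "(\<lambda>n. 1 / real n * (\<Sum>j=1..n. poly (chebyshev m) (x n j))) \<longlonglongrightarrow> l"
proof -
  have s': "s n k \<in> {-1..1}" if "k \<in> K n" for n k using s[OF that] by auto
  have a: "\<bar>alpha (s n k)\<bar> < 1" if "k \<in> K n" for n k
    using abs_alpha_le[OF s'[OF that]] s[OF that] by linarith
  have bound: "\<forall>\<^sub>F n in sequentially.
      (LINT y|lebesgue_on {-1..1}. (\<Prod>j=1..n. 2 * y - 2 * x n j)\<^sup>2 /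
         (\<Prod>k\<in>K n. 1 + (alpha (s n k))\<^sup>2 + 2 * alpha (s n k) * y) * w y)
      \<le> 64 * (LINT y|lebesgue_on {-1..1}. w y)"
    using centre eventually_gt_at_top[of 0]
  proof eventually_elim
    case (elim n)
    then obtain K' k0 where K': "K' \<subseteq> K n" "card K' = 2 * n" "card (K n - K') \<le> 1"
      "\<And>k. k \<in> K n - K' \<Longrightarrow> \<bar>s n k\<bar> \<le> 1 / 2" "k0 \<in> K'" "\<bar>s n k0\<bar> \<le> 1 / 2" by blast
    have half: "\<bar>alpha (s n k)\<bar> \<le> 1 / 2" if "k \<in> K n" "\<bar>s n k\<bar> \<le> 1 / 2" for k
      using abs_alpha_le[OF s'[OF that(1)]] that(2) by linarith
    show ?case
    proof (rule orthogonal_norm_bound[OF w_integrable w_pos K(1) a K'(1-3) _ K'(5) _ elim(2)])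
      show "\<bar>alpha (s n k)\<bar> \<le> 1 / 2" if "k \<in> K n - K'" for k
        using that K'(4) by (intro half) auto
      show "\<bar>alpha (s n k0)\<bar> \<le> 1 / 2" using K' by (intro half) auto
      fix q :: "real poly" assume q: "degree q < n"
      define C where "C = (\<Prod>k\<in>K n. 1 + (alpha (s n k))\<^sup>2)"
      have "(\<Prod>k\<in>K n. 1 + (alpha (s n k))\<^sup>2 + 2 * alpha (s n k) * y) = C * (\<Prod>k\<in>K n. 1 + s n k * y)" for y
        unfolding C_def prod.distrib[symmetric] by (intro prod.cong refl quadratic_factor_alpha s')
      then have "(LINT y|lebesgue_on {-1..1}. poly (nodal_poly n (x n) * q) y /
          (\<Prod>k\<in>K n. 1 + (alpha (s n k))\<^sup>2 + 2 * alpha (s n k) * y) * w y) =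
          (LINT y|lebesgue_on {-1..1}. 1 / C * (poly (nodal_poly n (x n) * q) y / (\<Prod>k\<in>K n. 1 + s n k * y) * w y))"
        by (simp add: mult_ac)
      also have "\<dots> = 0" unfolding integral_mult_right_zero using orth[OF elim(2) q] by simp
      finally show "(LINT y|lebesgue_on {-1..1}. poly (nodal_poly n (x n) * q) y /
          (\<Prod>k\<in>K n. 1 + (alpha (s n k))\<^sup>2 + 2 * alpha (s n k) * y) * w y) = 0" .
    qed auto
  qed
  have "(\<lambda>n. ((\<Sum>j=1..n. cos (real m * arccos (x n j))) - (\<Sum>k\<in>K n. (- alpha (s n k)) ^ m) / 2) / real n)
      \<longlonglongrightarrow> 0"
    by (rule moments_of_near_extremal_polynomials[OF w_integrable w_pos x K a bound m])
  from tendsto_add[OF this lim]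
  have "(\<lambda>n. (\<Sum>j=1..n. cos (real m * arccos (x n j))) / real n) \<longlonglongrightarrow> l"
    by (simp add: diff_divide_distrib)
  moreover have "(\<Sum>j=1..n. cos (real m * arccos (x n j))) = (\<Sum>j=1..n. poly (chebyshev m) (x n j))" for n
  proof (intro sum.cong refl)
    fix j assume "j \<in> {1..n}"
    then show "cos (real m * arccos (x n j)) = poly (chebyshev m) (x n j)"
      using x[of j n] poly_chebyshev_cos[of m "arccos (x n j)"] by simp
  qed
  ultimately show ?thesis by simp
qed

context
  fixes t :: "nat \<Rightarrow> real" and p q r :: real and \<nu> \<nu>\<^sub>0 \<mu> :: "real measure"
  assumes t_range: "\<forall>i\<ge>1. t i \<in> {-1<..<1}"
    and t_distribution: "asymptotic_distribution (\<lambda>n j. t j) \<nu>"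
    and pqr: "0 < p" "0 < q" "0 < r" "p + q + r \<le> 1"
    and nu0: "prob_measure_on_interval \<nu>\<^sub>0"
    and nu0_no_endpoint_atoms: "p + q + r < 1 \<Longrightarrow> measure \<nu>\<^sub>0 {-1, 1} = 0"
    and nu: "\<nu> = scale_measure (ennreal p) (dirac (-1)) \<oplus>\<^sub>M scale_measure (ennreal q) (dirac 1)
               \<oplus>\<^sub>M scale_measure (ennreal r) (dirac 0)
               \<oplus>\<^sub>M scale_measure (ennreal (1 - (p + q + r))) \<nu>\<^sub>0"
    and mu: "\<mu> = scale_measure (ennreal p) (dirac 1) \<oplus>\<^sub>M scale_measure (ennreal q) (dirac (-1))
               \<oplus>\<^sub>M scale_measure (ennreal r) arcsin_measure
               \<oplus>\<^sub>M scale_measure (ennreal (1 - (p + q + r))) (mu_b \<nu>\<^sub>0)"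
begin

private lemma nonneg: "0 \<le> p" "0 \<le> q" "0 \<le> r" "0 \<le> 1 - (p + q + r)"
  using pqr by auto

private lemma finite_borel_nu0: "finite_borel \<nu>\<^sub>0"
  by (rule finite_borel_prob_measure[OF nu0])

private lemma finite_borel_mu_b: "finite_borel (mu_b \<nu>\<^sub>0)"
  by (rule integral_mu_b(1)[OF finite_borel_nu0, of "\<lambda>_. 0"]) simp

private lemma finite_borel_arcsin: "finite_borel arcsin_measure"
  by (rule integral_arcsin_measure(1)[of "\<lambda>_. 0"]) simp

lemma finite_borel_mu: "finite_borel \<mu>"
  unfolding mu by (intro finite_borel_add finite_borel_scale finite_borel_dirac finite_borel_mu_b finite_borel_arcsin)

lemma integral_nu:
  assumes f: "continuous_on {-1..1} f"
  shows "(LINT y:{-1..1}|\<nu>. f y) =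
    p * f (-1) + q * f 1 + r * f 0 + (1 - (p + q + r)) * (LINT y:{-1..1}|\<nu>\<^sub>0. f y)"
proof -
  have m: "(\<lambda>z. indicator {-1..1} z * f z) \<in> borel_measurable borel"
    using borel_measurable_continuous_on_indicator[OF _ f] by simp
  have "(LINT y:{-1..1}|dirac 0. f y) = f 0"
    unfolding set_lebesgue_integral_def real_scaleR_def using m by (subst integral_return) auto
  then show ?thesis
    using set_integral_mixture[OF finite_borel_dirac finite_borel_nu0 f nonneg _ _ nu] by simp
qed

text \<open>
  The point masses match term by term: \<open>T\<^sub>m\<close> at \<open>1\<close> and \<open>-1\<close> against \<open>(- alpha)\<^sup>m\<close> at \<open>-1\<close> and \<open>1\<close>, and
  the arcsine measure against the point mass at \<open>0\<close>.
\<close>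
lemma moments_mu_nu:
  "(LINT y:{-1..1}|\<mu>. poly (chebyshev m) y) = (LINT y:{-1..1}|\<nu>. (- alpha y) ^ m)"
proof -
  have "(LINT y:{-1..1}|\<mu>. poly (chebyshev m) y) =
      p * poly (chebyshev m) 1 + q * poly (chebyshev m) (-1)
      + r * (LINT y:{-1..1}|arcsin_measure. poly (chebyshev m) y)
      + (1 - (p + q + r)) * (LINT y:{-1..1}|mu_b \<nu>\<^sub>0. poly (chebyshev m) y)"
    by (rule set_integral_mixture[OF finite_borel_arcsin finite_borel_mu_b _ nonneg _ _ mu])
      (auto intro!: continuous_intros)
  also have "poly (chebyshev m) 1 = 1" using poly_chebyshev_cos[of m 0] by simp
  also have "poly (chebyshev m) (-1) = (-1) ^ m" using poly_chebyshev_cos[of m pi] by simp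
  also have "(LINT y:{-1..1}|arcsin_measure. poly (chebyshev m) y) = 0 ^ m" by (rule chebyshev_moment_arcsin)
  also have "(1 - (p + q + r)) * (LINT y:{-1..1}|mu_b \<nu>\<^sub>0. poly (chebyshev m) y) =
      (1 - (p + q + r)) * (LINT y:{-1..1}|\<nu>\<^sub>0. (- alpha y) ^ m)"
  proof (cases "p + q + r < 1")
    case True
    show ?thesis using chebyshev_moment_mu_b[OF finite_borel_nu0 nu0_no_endpoint_atoms[OF True]] by simp
  qed (use pqr in simp)
  finally show ?thesis
    by (subst integral_nu) (auto intro!: continuous_intros continuous_on_alpha)
qed

lemma alpha_averages:
  "(\<lambda>n. 1 / real n * (\<Sum>k=1..n. (- alpha (t k)) ^ m)) \<longlonglongrightarrow> (LINT y:{-1..1}|\<mu>. poly (chebyshev m) y)"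
proof -
  have "continuous_on {-1..1} (\<lambda>y. (- alpha y) ^ m)" by (intro continuous_intros continuous_on_alpha)
  then show ?thesis using t_distribution unfolding asymptotic_distribution_def moments_mu_nu by blast
qed

text \<open>
  The mass \<open>r\<close> of \<open>\<nu>\<close> at \<open>0\<close> is detected by a bump function supported in \<open>{-1/2..1/2}\<close>.
\<close>
lemma eventually_central_parameter:
  "\<forall>\<^sub>F n in sequentially. \<exists>k\<in>{1..n}. \<bar>t k\<bar> \<le> 1 / 2"
proof -
  define f where "f y = max 0 (1 - 2 * \<bar>y\<bar>)" for y :: real
  have f: "continuous_on {-1..1} f" unfolding f_def[abs_def] by (intro continuous_intros)
  have "0 \<le> (LINT y:{-1..1}|\<nu>\<^sub>0. f y)"
    unfolding set_lebesgue_integral_def by (intro Bochner_Integration.integral_nonneg) (auto simp: f_def)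
  from mult_nonneg_nonneg[OF nonneg(4) this] have "r \<le> (LINT y:{-1..1}|\<nu>. f y)"
    unfolding integral_nu[OF f] by (simp add: f_def[of 0] f_def[of 1] f_def[of "-1"])
  then have "0 < (LINT y:{-1..1}|\<nu>. f y)" using pqr by linarith
  moreover have "(\<lambda>n. 1 / real n * (\<Sum>k=1..n. f (t k))) \<longlonglongrightarrow> (LINT y:{-1..1}|\<nu>. f y)"
    using t_distribution f unfolding asymptotic_distribution_def by blast
  ultimately have "\<forall>\<^sub>F n in sequentially. 0 < 1 / real n * (\<Sum>k=1..n. f (t k))"
    by (rule order_tendstoD(1)[rotated])
  then show ?thesis
  proof eventually_elim
    case (elim n)
    show ?case
    proof (rule ccontr)
      assume "\<not> ?thesis"
      then have "f (t k) = 0" if "k \<in> {1..n}" for k using that by (force simp: f_def max_def)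
      then have "(\<Sum>k=1..n. f (t k)) = 0" by (rule sum.neutral[OF ballI])
      then show False using elim by simp
    qed
  qed
qed

context
  fixes w :: "real \<Rightarrow> real"
  assumes w_integrable: "integrable (lebesgue_on {-1..1}) w"
    and w_pos: "AE x in lebesgue_on {-1..1}. 0 < w x"
    and t_distinct: "inj_on t {1..}"
begin

private lemma moment_zero: "(\<lambda>n. 1 / real n * (\<Sum>j=1..n. poly (chebyshev 0) (x n j)))
    \<longlonglongrightarrow> (LINT y:{-1..1}|\<mu>. poly (chebyshev 0) y)"
  using alpha_averages[of 0] by simp

text \<open>
  There are exactly \<open>2n\<close> parameters, each used once, so the average of \<open>(- alpha)\<^sup>m\<close> is taken along the
  subsequence \<open>2n\<close>.
\<close>
lemma gaussian_asymptotic_distribution: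
  assumes nodes: "\<forall>n\<ge>1. gaussian_quadrature_nodes w t n (x n)"
  shows "asymptotic_distribution x \<mu>"
proof (rule asymptotic_distribution_from_moments[OF finite_borel_mu])
  have node: "gaussian_quadrature_nodes w t n (x n)" if "0 < n" for n using nodes that by auto
  show x: "x n j \<in> {-1..1}" if "j \<in> {1..n}" for n j
  proof -
    have "x n ` {1..n} \<subseteq> {-1<..<1}" using node[of n] that unfolding gaussian_quadrature_nodes_def by auto
    then have "x n j \<in> {-1<..<1}" using that by blast
    then show ?thesis by auto
  qed
  fix m
  show "(\<lambda>n. 1 / real n * (\<Sum>j=1..n. poly (chebyshev m) (x n j)))
      \<longlonglongrightarrow> (LINT y:{-1..1}|\<mu>. poly (chebyshev m) y)"
  proof (cases "m = 0")
    case False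
    show ?thesis
    proof (rule nodes_moments[where K = "\<lambda>n. {1..2 * n}" and s = "\<lambda>n k. t k", OF w_integrable w_pos x])
      show "\<bar>t k\<bar> < 1" if "k \<in> {1..2 * n}" for k n using t_range that by (auto simp: abs_less_iff)
      show "\<forall>\<^sub>F n in sequentially. \<exists>K' k0. K' \<subseteq> {1..2 * n} \<and> card K' = 2 * n \<and> card ({1..2 * n} - K') \<le> 1 \<and>
          (\<forall>k\<in>{1..2 * n} - K'. \<bar>t k\<bar> \<le> 1 / 2) \<and> k0 \<in> K' \<and> \<bar>t k0\<bar> \<le> 1 / 2"
        using eventually_central_parameter
      proof eventually_elim
        case (elim n)
        then obtain k0 where "k0 \<in> {1..n}" "\<bar>t k0\<bar> \<le> 1 / 2" by blast
        then show ?case by (intro exI[of _ "{1..2 * n}"] exI[of _ k0]) auto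
      qed
      show "(LINT y|lebesgue_on {-1..1}. poly (nodal_poly n (x n) * q) y / (\<Prod>k\<in>{1..2 * n}. 1 + t k * y) * w y) = 0"
        if "0 < n" "degree q < n" for n q
        by (rule gaussian_nodes_orthogonal[OF w_integrable t_distinct t_range node that(2)]) (rule that)
      have "filterlim (\<lambda>n::nat. 2 * n) sequentially sequentially"
        by (rule filterlim_subseq) (simp add: strict_mono_def)
      from filterlim_compose[OF alpha_averages[of m] this]
      show "(\<lambda>n. (\<Sum>k\<in>{1..2 * n}. (- alpha (t k)) ^ m) / 2 / real n) \<longlonglongrightarrow> (LINT y:{-1..1}|\<mu>. poly (chebyshev m) y)"
        by simp
    qed (use False in auto)
  qed (use moment_zero in simp)
qed

text \<open>
  The index set is a disjoint union because \<open>t\<^sub>1, \<dots>, t\<^sub>n\<close> occur twice. One of its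
  \<open>2n + 1\<close> elements has to be left out of the competitor; a copy of a parameter of modulus at most
  \<open>1 / 2\<close> is chosen, rather than \<open>t\<^sub>n\<^sub>+\<^sub>1\<close>, whose factor may be arbitrarily close to \<open>0\<close>
  on the interval. The other copy then serves as the small parameter.
\<close>
lemma orthogonal_asymptotic_distribution:
  assumes nodes: "\<forall>n\<ge>1. orthogonal_quadrature_nodes w t n (x n)"
  shows "asymptotic_distribution x \<mu>"
proof (rule asymptotic_distribution_from_moments[OF finite_borel_mu])
  have node: "orthogonal_quadrature_nodes w t n (x n)" if "0 < n" for n using nodes that by auto
  show x: "x n j \<in> {-1..1}" if "j \<in> {1..n}" for n j
  proof -
    have "x n ` {1..n} \<subseteq> {-1<..<1}" using node[of n] that unfolding orthogonal_quadrature_nodes_def by auto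
    then have "x n j \<in> {-1<..<1}" using that by blast
    then show ?thesis by auto
  qed
  fix m
  define K where "K n = {1..n+1} <+> {1..n}" for n :: nat
  define s where "s i = (case i of Inl k \<Rightarrow> t k | Inr k \<Rightarrow> t k)" for i :: "nat + nat"
  have K: "finite (K n)" "card (K n) = 2 * n + 1" for n
    unfolding K_def by (simp_all add: card_Plus)
  have s: "s i \<in> {-1<..<1}" if "i \<in> K n" for i n
    using that t_range by (auto simp: K_def s_def)
  show "(\<lambda>n. 1 / real n * (\<Sum>j=1..n. poly (chebyshev m) (x n j)))
      \<longlonglongrightarrow> (LINT y:{-1..1}|\<mu>. poly (chebyshev m) y)"
  proof (cases "m = 0")
    case False
    show ?thesis
    proof (rule nodes_moments[where K = K and s = "\<lambda>_. s", OF w_integrable w_pos x])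
      show "\<bar>s k\<bar> < 1" if "k \<in> K n" for k n using s[OF that] by (auto simp: abs_less_iff)
      show "\<forall>\<^sub>F n in sequentially. \<exists>K' k0. K' \<subseteq> K n \<and> card K' = 2 * n \<and> card (K n - K') \<le> 1 \<and>
          (\<forall>k\<in>K n - K'. \<bar>s k\<bar> \<le> 1 / 2) \<and> k0 \<in> K' \<and> \<bar>s k0\<bar> \<le> 1 / 2"
        using eventually_central_parameter
      proof eventually_elim
        case (elim n)
        then obtain k0 where k0: "k0 \<in> {1..n}" "\<bar>t k0\<bar> \<le> 1 / 2" by blast
        have mem: "Inr k0 \<in> K n" "Inl k0 \<in> K n" using k0 by (auto simp: K_def)
        have "K n - (K n - {Inr k0}) = {Inr k0}" using mem by auto
        moreover have "card (K n - {Inr k0}) = 2 * n" using K mem by simp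
        ultimately show ?case
          using mem k0 by (intro exI[of _ "K n - {Inr k0}"] exI[of _ "Inl k0"]) (auto simp: s_def)
      qed
      show "(LINT y|lebesgue_on {-1..1}. poly (nodal_poly n (x n) * q) y / (\<Prod>k\<in>K n. 1 + s k * y) * w y) = 0"
        if "0 < n" "degree q < n" for n q
      proof -
        have "(\<Prod>k\<in>K n. 1 + s k * y) = (\<Prod>k\<in>{1..n+1}. 1 + t k * y) * (\<Prod>k\<in>{1..n}. 1 + t k * y)" for y
          unfolding K_def s_def by (subst prod.Plus) auto
        then show ?thesis
          using orthogonal_nodes_orthogonal[OF w_integrable t_distinct t_range node[OF that(1)] that(2)] by simp
      qed
      let ?h = "\<lambda>k. (- alpha (t k)) ^ m"
      have h: "\<bar>?h k\<bar> \<le> 1" if "1 \<le> k" for k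
      proof -
        have tk: "t k \<in> {-1..1}" "\<bar>t k\<bar> \<le> 1" using t_range that by (auto simp: abs_le_iff less_imp_le)
        have "\<bar>- alpha (t k)\<bar> \<le> 1" using abs_alpha_le[OF tk(1)] tk(2) by simp
        then show ?thesis unfolding power_abs by (intro power_le_one) auto
      qed
      have "(\<lambda>n. ?h (n + 1) / 2 / real n) \<longlonglongrightarrow> 0"
      proof (rule Lim_null_comparison[OF always_eventually[OF allI] lim_const_over_n[of "1 / 2"]])
        show "norm (?h (n + 1) / 2 / real n) \<le> 1 / 2 / real n" for n
          using h[of "n + 1"] by (simp add: divide_right_mono)
      qed
      from tendsto_add[OF alpha_averages[of m] this]
      show "(\<lambda>n. (\<Sum>k\<in>K n. (- alpha (s k)) ^ m) / 2 / real n) \<longlonglongrightarrow> (LINT y:{-1..1}|\<mu>. poly (chebyshev m) y)"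
        unfolding K_def s_def by (subst sum.Plus) (auto simp: add_divide_distrib)
    qed (use False K in auto)
  qed (use moment_zero in simp)
qed

end

end

theorem theorem2:
  fixes w :: "real \<Rightarrow> real" and t :: "nat \<Rightarrow> real" and p q r :: real
    and \<nu> \<nu>\<^sub>0 \<mu> :: "real measure"
  assumes w_integrable: "integrable (lebesgue_on {-1..1}) w"
    and w_pos: "AE x in lebesgue_on {-1..1}. 0 < w x"
    and t_distinct: "inj_on t {1..}"
    and t_range: "\<forall>i\<ge>1. t i \<in> {-1<..<1}"
    and t_distribution: "asymptotic_distribution (\<lambda>n j. t j) \<nu>"
    and pqr: "0 < p" "0 < q" "0 < r" "p + q + r \<le> 1"
    and nu0: "prob_measure_on_interval \<nu>\<^sub>0"
    and nu0_log: "(\<integral>\<^sup>+ s. neg_log_abs s \<partial>\<nu>\<^sub>0) < \<infinity>"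
    and nu0_no_endpoint_atoms: "p + q + r < 1 \<Longrightarrow> measure \<nu>\<^sub>0 {-1, 1} = 0"
    and nu: "\<nu> = scale_measure (ennreal p) (dirac (-1)) \<oplus>\<^sub>M scale_measure (ennreal q) (dirac 1)
               \<oplus>\<^sub>M scale_measure (ennreal r) (dirac 0)
               \<oplus>\<^sub>M scale_measure (ennreal (1 - (p + q + r))) \<nu>\<^sub>0"
    and mu: "\<mu> = scale_measure (ennreal p) (dirac 1) \<oplus>\<^sub>M scale_measure (ennreal q) (dirac (-1))
               \<oplus>\<^sub>M scale_measure (ennreal r) arcsin_measure
               \<oplus>\<^sub>M scale_measure (ennreal (1 - (p + q + r))) (mu_b \<nu>\<^sub>0)"
  shows "(\<forall>x. (\<forall>n\<ge>1. orthogonal_quadrature_nodes w t n (x n)) \<longrightarrow> asymptotic_distribution x \<mu>) \<and>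
         (\<forall>x. (\<forall>n\<ge>1. gaussian_quadrature_nodes w t n (x n)) \<longrightarrow> asymptotic_distribution x \<mu>)"
  using orthogonal_asymptotic_distribution[OF t_range t_distribution pqr nu0 nu0_no_endpoint_atoms nu mu
      w_integrable w_pos t_distinct]
    gaussian_asymptotic_distribution[OF t_range t_distribution pqr nu0 nu0_no_endpoint_atoms nu mu
      w_integrable w_pos t_distinct]
  by blast

end
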